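(* Let $X$ be a closed manifold of dimension at least $3$ or the Hilbert cube. Then the flow $\mathrm{Homeo}(X)\curvearrowright \mathcal{C}(X)$ has meager orbits, i.e. every $\mathrm{Homeo}(X)$-orbit in $\mathcal{C}(X)$ is meager in $\mathcal{C}(X)$. In particular, if $G\le \mathrm{Homeo}(X)$ is locally transitive, then the universal minimal flow of $G$ has meager orbits.
   Context: A closed manifold is a compact, connected topological manifold without boundary. $\mathrm{Homeo}(X)$ is the group of all homeomorphisms of $X$ with the compact-open topology; a subgroup $G\le \mathrm{Homeo}(X)$ carries the subspace topology. For a compact space $Y$, $V(Y)$ denotes the space of non-empty compact subsets of $Y$ with the Vietoris topology, and $V^2(Y)=V(V(Y))$. A maximal chain of closed subsets of $X$ is an element $c\in V^2(X)$ whose members are linearly ordered by inclusion and which is maximal with this property (if $K\in V(X)$ and $c\cup\{K\}$ is linearly ordered by inclusion, then $K\in c$). $\Phi(X)\subseteq V^2(X)$ is the space of maximal chains. A chain $c\in\Phi(X)$ is connected if it is connected as a compact subspace of $V(X)$; equivalently, each member of $c$ is a connected subset of $X$. Then $\mathcal{C}(X)=\{c\in\Phi(X): c\text{ is connected}\}$, a compact space with the topology inherited from $V^2(X)$, on which $\mathrm{Homeo}(X)$ acts continuously by the action induced from $X$. For a subgroup $G\le \mathrm{Homeo}(X)$ and an open set $U\subseteq X$, the rigid stabilizer $G_U$ is the subgroup of all $g\in G$ that fix every point of $X\setminus U$. The subgroup $G$ is locally transitive if for every open $U\subseteq X$ and every $x\in U$, the set $G_U\cdot x$ contains a neighborhood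 of $x$. For a topological group $G$, a $G$-flow is a continuous action of $G$ on a compact Hausdorff space; it is minimal if all orbits are dense. The universal minimal flow of $G$ is the minimal $G$-flow (unique up to isomorphism) that admits every minimal $G$-flow as a factor, i.e. that maps onto every minimal $G$-flow by a continuous $G$-equivariant map. A flow has meager orbits if each of its orbits is a meager subset. *)

theory Defs
  imports "HOL-Analysis.Analysis" "HOL-Algebra.Group_Action"
begin

section \<open>Closed manifolds and the Hilbert cube\<close>

definition closed_manifold :: "nat \<Rightarrow> 'a topology \<Rightarrow> bool" where
  "closed_manifold n X \<longleftrightarrow>
     topspace X \<noteq> {} \<and> Hausdorff_space X \<and> second_countable X \<and>
     compact_space X \<and> connected_space X \<and>
     (\<forall>x\<in>topspace X. \<exists>U. openin X U \<and> x \<in> U \<and>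
        subtopology X U homeomorphic_space Euclidean_space n)"

definition hilbert_cube :: "(nat \<Rightarrow> real) topology" where
  "hilbert_cube = product_topology (\<lambda>_. top_of_set {0..1}) UNIV"


section \<open>Meager sets\<close>

definition nowhere_dense_in :: "'a topology \<Rightarrow> 'a set \<Rightarrow> bool" where
  "nowhere_dense_in X A \<longleftrightarrow> A \<subseteq> topspace X \<and> X interior_of (X closure_of A) = {}"

definition meager_in :: "'a topology \<Rightarrow> 'a set \<Rightarrow> bool" where
  "meager_in X A \<longleftrightarrow>
     (\<exists>\<N>. countable \<N> \<and> (\<forall>N\<in>\<N>. nowhere_dense_in X N) \<and> A = \<Union>\<N>)"


section \<open>Flows\<close>

text \<open>A topological group is given by a group \<open>G\<close> together with a topology \<open>T\<close> on its carrier.\<close>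

definition flow :: "('g, 'r) monoid_scheme \<Rightarrow> 'g topology \<Rightarrow> 'b topology \<Rightarrow> ('g \<Rightarrow> 'b \<Rightarrow> 'b) \<Rightarrow> bool" where
  "flow G T M \<phi> \<longleftrightarrow>
     compact_space M \<and> Hausdorff_space M \<and> group_action G (topspace M) \<phi> \<and>
     continuous_map (prod_topology T M) M (\<lambda>(g, y). \<phi> g y)"

text \<open>Minimal flows are nonempty. Otherwise the empty flow would be minimal, and no minimal flow
  could map onto all the others.\<close>

definition minimal_flow :: "('g, 'r) monoid_scheme \<Rightarrow> 'g topology \<Rightarrow> 'b topology \<Rightarrow> ('g \<Rightarrow> 'b \<Rightarrow> 'b) \<Rightarrow> bool" where
  "minimal_flow G T M \<phi> \<longleftrightarrow>
     flow G T M \<phi> \<and> topspace M \<noteq> {} \<and>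
     (\<forall>y\<in>topspace M. M closure_of orbit G \<phi> y = topspace M)"

definition factor_map ::
  "('g, 'r) monoid_scheme \<Rightarrow> 'b topology \<Rightarrow> ('g \<Rightarrow> 'b \<Rightarrow> 'b) \<Rightarrow> 'c topology \<Rightarrow> ('g \<Rightarrow> 'c \<Rightarrow> 'c) \<Rightarrow> ('b \<Rightarrow> 'c) \<Rightarrow> bool" where
  "factor_map G M \<phi> N \<psi> \<pi> \<longleftrightarrow>
     continuous_map M N \<pi> \<and> \<pi> ` topspace M = topspace N \<and>
     (\<forall>g\<in>carrier G. \<forall>y\<in>topspace M. \<pi> (\<phi> g y) = \<psi> g (\<pi> y))"

text \<open>A definition cannot quantify over all types, so universality is required with respect to
  minimal flows on subsets of the type \<open>'g set set\<close>. This is no restriction: in a minimal flow some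
  orbit, the image of \<open>G\<close> under an orbit map, is dense, and a Hausdorff space with a dense image of
  \<open>G\<close> injects into the double power set of \<open>G\<close>. Lemma \<open>universal_minimal_flow_factor\<close> below
  derives the property for minimal flows on an arbitrary type.\<close>

definition universal_minimal_flow ::
  "('g, 'r) monoid_scheme \<Rightarrow> 'g topology \<Rightarrow> 'b topology \<Rightarrow> ('g \<Rightarrow> 'b \<Rightarrow> 'b) \<Rightarrow> bool" where
  "universal_minimal_flow G T M \<phi> \<longleftrightarrow>
     minimal_flow G T M \<phi> \<and>
     (\<forall>(N :: 'g set set topology) \<psi>.
        minimal_flow G T N \<psi> \<longrightarrow> (\<exists>\<pi>. factor_map G M \<phi> N \<psi> \<pi>))"

definition has_meager_orbits :: "('g, 'r) monoid_scheme \<Rightarrow> 'b topology \<Rightarrow> ('g \<Rightarrow> 'b \<Rightarrow> 'b) \<Rightarrow> bool" where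
  "has_meager_orbits G M \<phi> \<longleftrightarrow> (\<forall>y\<in>topspace M. meager_in M (orbit G \<phi> y))"


section \<open>Homeomorphism groups\<close>

text \<open>As in \<^const>\<open>BijGroup\<close>, elements are extensional functions, so that a homeomorphism of \<open>X\<close> is
  represented by exactly one element.\<close>

definition homeo_group :: "'a topology \<Rightarrow> ('a \<Rightarrow> 'a) monoid" where
  "homeo_group X =
     BijGroup (topspace X) \<lparr>carrier := {f \<in> Bij (topspace X). homeomorphic_map X X f}\<rparr>"

definition homeo_topology :: "'a topology \<Rightarrow> ('a \<Rightarrow> 'a) topology" where
  "homeo_topology X = topology_generated_by
     {{f \<in> carrier (homeo_group X). f ` K \<subseteq> U} | K U. compactin X K \<and> openin X U}"

definition rigid_stabilizer :: "'a topology \<Rightarrow> ('a \<Rightarrow> 'a) set \<Rightarrow> 'a set \<Rightarrow> ('a \<Rightarrow> 'a) set" where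
  "rigid_stabilizer X G U = {g \<in> G. \<forall>x \<in> topspace X - U. g x = x}"

definition locally_transitive :: "'a topology \<Rightarrow> ('a \<Rightarrow> 'a) set \<Rightarrow> bool" where
  "locally_transitive X G \<longleftrightarrow>
     (\<forall>U x. openin X U \<and> x \<in> U \<longrightarrow>
        (\<exists>W. openin X W \<and> x \<in> W \<and> W \<subseteq> {g x | g. g \<in> rigid_stabilizer X G U}))"


section \<open>The Vietoris topology and maximal chains\<close>

definition vietoris :: "'a topology \<Rightarrow> 'a set topology" where
  "vietoris Y = topology_generated_by
     ({{K. compactin Y K \<and> K \<noteq> {} \<and> K \<subseteq> U} | U. openin Y U} \<union>
      {{K. compactin Y K \<and> K \<noteq> {} \<and> K \<inter> U \<noteq> {}} | U. openin Y U})"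

definition maximal_chains :: "'a topology \<Rightarrow> 'a set set set" where
  "maximal_chains X =
     {c \<in> topspace (vietoris (vietoris X)).
        chain\<^sub>\<subseteq> c \<and>
        (\<forall>K \<in> topspace (vietoris X). chain\<^sub>\<subseteq> (c \<union> {K}) \<longrightarrow> K \<in> c)}"

definition connected_chains :: "'a topology \<Rightarrow> 'a set set topology" where
  "connected_chains X =
     subtopology (vietoris (vietoris X)) {c \<in> maximal_chains X. connectedin (vietoris X) c}"

definition chain_action :: "'a topology \<Rightarrow> ('a \<Rightarrow> 'a) \<Rightarrow> 'a set set \<Rightarrow> 'a set set" where
  "chain_action X g = (\<lambda>c \<in> topspace (connected_chains X). (\<lambda>K. g ` K) ` c)"


section \<open>Basic facts\<close>

lemma topspace_vietoris: "topspace (vietoris Y) = {K. compactin Y K \<and> K \<noteq> {}}" (is "_ = ?V")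
proof
  show "topspace (vietoris Y) \<subseteq> ?V"
    unfolding vietoris_def topology_generated_by_topspace by blast
  have "?V = {K. compactin Y K \<and> K \<noteq> {} \<and> K \<subseteq> topspace Y}"
    using compactin_subset_topspace by blast
  then have "openin (vietoris Y) ?V"
    unfolding vietoris_def by (intro topology_generated_by_Basis) blast
  then show "?V \<subseteq> topspace (vietoris Y)"
    by (rule openin_subset)
qed

lemma topspace_homeo_topology: "topspace (homeo_topology X) = carrier (homeo_group X)"
proof -
  have "{f \<in> carrier (homeo_group X). f ` {} \<subseteq> {}}
    \<in> {{f \<in> carrier (homeo_group X). f ` K \<subseteq> U} | K U. compactin X K \<and> openin X U}"
    using compactin_empty openin_empty by blast
  then show ?thesis
    unfolding homeo_topology_def topology_generated_by_topspace by blast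
qed

lemma subgroup_homeo: "subgroup (carrier (homeo_group X)) (BijGroup (topspace X))"
proof -
  interpret group "BijGroup (topspace X)" by (rule group_BijGroup)
  let ?S = "topspace X"
  have car: "carrier (homeo_group X) = {f \<in> Bij ?S. homeomorphic_map X X f}"
    by (simp add: homeo_group_def)
  show ?thesis
  proof
    show "carrier (homeo_group X) \<subseteq> carrier (BijGroup ?S)"
      by (auto simp: car BijGroup_def)
  next
    fix f g assume f: "f \<in> carrier (homeo_group X)" and g: "g \<in> carrier (homeo_group X)"
    have "homeomorphic_map X X (f \<circ> g)"
      using f g homeomorphic_map_compose car by blast
    then have "homeomorphic_map X X (compose ?S f g)"
      by (rule homeomorphic_map_eq) (simp add: compose_def)
    then show "f \<otimes>\<^bsub>BijGroup ?S\<^esub> g \<in> carrier (homeo_group X)"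
      using f g by (simp add: car BijGroup_def compose_Bij)
  next
    have "homeomorphic_map X X (\<lambda>x\<in>?S. x)"
      by (rule homeomorphic_map_eq[of _ _ id]) auto
    then show "\<one>\<^bsub>BijGroup ?S\<^esub> \<in> carrier (homeo_group X)"
      by (simp add: car BijGroup_def id_Bij)
  next
    fix f assume f: "f \<in> carrier (homeo_group X)"
    then have fB: "f \<in> Bij ?S" and "homeomorphic_map X X f"
      by (auto simp: car)
    then obtain h where h: "homeomorphic_maps X X f h"
      using homeomorphic_map_maps by blast
    have "homeomorphic_map X X h"
      using h homeomorphic_maps_map by blast
    moreover have "h x = (\<lambda>x\<in>?S. inv_into ?S f x) x" if "x \<in> ?S" for x
    proof -
      have "inj_on f ?S" using fB by (simp add: Bij_def bij_betw_def)
      moreover have "h x \<in> ?S" "f (h x) = x"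
        using h that by (auto simp: homeomorphic_maps_def continuous_map_def)
      ultimately show ?thesis
        using that by (metis inv_into_f_f restrict_apply')
    qed
    ultimately have "homeomorphic_map X X (\<lambda>x\<in>?S. inv_into ?S f x)"
      by (rule homeomorphic_map_eq)
    then show "inv\<^bsub>BijGroup ?S\<^esub> f \<in> carrier (homeo_group X)"
      using fB by (simp add: car inv_BijGroup restrict_inv_into_Bij)
  qed
qed

lemma group_homeo: "group (homeo_group X)"
  using subgroup.subgroup_is_group[OF subgroup_homeo group_BijGroup]
  by (simp add: homeo_group_def)

lemma minimal_flow_copy:
  fixes N :: "'c topology" and T :: "'g topology"
  assumes "minimal_flow G T N \<psi>"
  obtains N' :: "'g set set topology" and \<psi>' \<pi>
  where "minimal_flow G T N' \<psi>'" and "factor_map G N' \<psi>' N \<psi> \<pi>"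
proof -
  have comp: "compact_space N" and haus: "Hausdorff_space N"
    and act: "group_action G (topspace N) \<psi>"
    and cont: "continuous_map (prod_topology T N) N (\<lambda>(g, y). \<psi> g y)"
    and ne: "topspace N \<noteq> {}"
    and dense: "\<And>y. y \<in> topspace N \<Longrightarrow> N closure_of orbit G \<psi> y = topspace N"
    using assms by (auto simp: minimal_flow_def flow_def)
  interpret group_action G "topspace N" \<psi> by (rule act)
  interpret G: group G using group_hom group_hom.axioms(1) by blast
  obtain x0 where x0: "x0 \<in> topspace N" using ne by blast
  define f where "f y = {{g \<in> carrier G. \<psi> g x0 \<in> U} | U. openin N U \<and> y \<in> U}" for y
  have inj: "inj_on f (topspace N)"
  proof (rule inj_onI, rule ccontr)
    fix y z assume y: "y \<in> topspace N" and z: "z \<in> topspace N" and fyz: "f y = f z" and "y \<noteq> z"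
    obtain U V where UV: "openin N U" "openin N V" "y \<in> U" "z \<in> V" "disjnt U V"
      using haus y z \<open>y \<noteq> z\<close> by (meson Hausdorff_space_def)
    have "{g \<in> carrier G. \<psi> g x0 \<in> U} \<in> f y"
      unfolding f_def using UV(1,3) by blast
    then obtain V' where V': "openin N V'" "z \<in> V'"
      and eq: "{g \<in> carrier G. \<psi> g x0 \<in> U} = {g \<in> carrier G. \<psi> g x0 \<in> V'}"
      unfolding fyz unfolding f_def by blast
    have "z \<in> N closure_of orbit G \<psi> x0" using dense x0 z by simp
    moreover have "openin N (V \<inter> V')" "z \<in> V \<inter> V'" using UV V' by auto
    ultimately obtain w where "w \<in> orbit G \<psi> x0" "w \<in> V \<inter> V'"
      by (meson in_closure_of)
    then obtain g where "g \<in> carrier G" "\<psi> g x0 \<in> V" "\<psi> g x0 \<in> V'"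
      by (auto simp: orbit_def)
    then show False using eq UV by (auto simp: disjnt_iff)
  qed
  define A where "A = f ` topspace N"
  define h where "h = inv_into (topspace N) f"
  define N' where "N' = pullback_topology A h N"
  define \<psi>' where "\<psi>' g = (\<lambda>a\<in>A. f (\<psi> g (h a)))" for g
  have hA: "h a \<in> topspace N" "f (h a) = a" if "a \<in> A" for a
    using that by (auto simp: h_def A_def inv_into_into f_inv_into_f)
  have hf: "h (f y) = y" "f y \<in> A" if "y \<in> topspace N" for y
    using that inj by (auto simp: h_def A_def)
  have top: "topspace N' = A"
    using hA by (auto simp: N'_def topspace_pullback_topology)
  have h_cont: "continuous_map N' N h"
    using continuous_map_pullback[OF continuous_map_id, of A h N] by (simp add: N'_def)
  have f_cont: "continuous_map N N' f"
    unfolding N'_def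
  proof (rule continuous_map_pullback')
    show "continuous_map N N (h \<circ> f)"
      by (rule continuous_map_eq[of _ _ id]) (auto simp: hf)
    show "topspace N \<subseteq> f -` A" using hf by auto
  qed
  have hm: "homeomorphic_maps N' N h f"
    by (simp add: homeomorphic_maps_def h_cont f_cont top hA hf)
  then have hs: "N' homeomorphic_space N" by (auto simp: homeomorphic_space_def)
  have eqv: "h (\<psi>' g a) = \<psi> g (h a)" if "g \<in> carrier G" "a \<in> A" for g a
    using that hf hA element_image[of g "h a"] by (simp add: \<psi>'_def)
  have bij_h: "bij_betw h A (topspace N)"
    using hA hf by (intro bij_betw_byWitness[where f' = f]) auto
  have Bij': "\<psi>' g \<in> Bij A" if "g \<in> carrier G" for g
  proof -
    have "bij_betw (f \<circ> (\<psi> g \<circ> h)) A A"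
    proof (intro bij_betw_trans)
      show "bij_betw h A (topspace N)" by (rule bij_h)
      show "bij_betw (\<psi> g) (topspace N) (topspace N)"
        using bij_prop0[OF that] by (simp add: Bij_def)
      show "bij_betw f (topspace N) A"
        using inj by (simp add: bij_betw_def A_def)
    qed
    then have "bij_betw (\<psi>' g) A A"
      by (rule iffD1[OF bij_betw_cong, rotated]) (simp add: \<psi>'_def)
    then show ?thesis by (simp add: Bij_def \<psi>'_def)
  qed
  have "group_hom G (BijGroup A) \<psi>'"
  proof (intro group_hom.intro group_hom_axioms.intro homI)
    show "group G" by (rule G.is_group)
    show "group (BijGroup A)" by (rule group_BijGroup)
    show "\<psi>' g \<in> carrier (BijGroup A)" if "g \<in> carrier G" for g
      using Bij'[OF that] by (simp add: BijGroup_def)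
    fix g k assume g: "g \<in> carrier G" and k: "k \<in> carrier G"
    have "\<psi>' (g \<otimes>\<^bsub>G\<^esub> k) = compose A (\<psi>' g) (\<psi>' k)"
    proof
      fix a
      show "\<psi>' (g \<otimes>\<^bsub>G\<^esub> k) a = compose A (\<psi>' g) (\<psi>' k) a"
      proof (cases "a \<in> A")
        case True
        then have "\<psi>' k a \<in> A" using Bij'[OF k] Bij_imp_funcset by blast
        then show ?thesis
          using True g k hA eqv[OF k True] composition_rule[of "h a" g k]
          by (simp add: compose_def \<psi>'_def[of g] \<psi>'_def[of "g \<otimes>\<^bsub>G\<^esub> k"])
      qed (simp add: \<psi>'_def compose_def)
    qed
    then show "\<psi>' (g \<otimes>\<^bsub>G\<^esub> k) = \<psi>' g \<otimes>\<^bsub>BijGroup A\<^esub> \<psi>' k"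
      using Bij'[OF g] Bij'[OF k] by (simp add: BijGroup_def)
  qed
  then have act': "group_action G (topspace N') \<psi>'"
    by (simp add: group_action_def top)
  have "continuous_map (prod_topology T N') (prod_topology T N) (\<lambda>(g, a). (g, h a))"
    by (simp add: continuous_map_prod_top h_cont)
  then have "continuous_map (prod_topology T N') N' (f \<circ> ((\<lambda>(g, y). \<psi> g y) \<circ> (\<lambda>(g, a). (g, h a))))"
    by (rule continuous_map_compose[OF continuous_map_compose[OF _ cont] f_cont])
  then have cont': "continuous_map (prod_topology T N') N' (\<lambda>(g, a). \<psi>' g a)"
    by (rule continuous_map_eq) (auto simp: \<psi>'_def top)
  have orb: "orbit G \<psi>' a = f ` orbit G \<psi> (h a)" if "a \<in> A" for a
    using that by (auto simp: orbit_def \<psi>'_def)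
  have "N' closure_of orbit G \<psi>' a = topspace N'" if "a \<in> A" for a
  proof -
    have sub: "orbit G \<psi> (h a) \<subseteq> topspace N"
      unfolding orbit_def using hA(1)[OF that] element_image by blast
    have "homeomorphic_map N N' f"
      using hm by (simp add: homeomorphic_maps_map)
    then have "N' closure_of (f ` orbit G \<psi> (h a)) = f ` (N closure_of orbit G \<psi> (h a))"
      using sub by (rule homeomorphic_map_closure_of)
    then show ?thesis
      using that hA dense by (simp add: orb top A_def)
  qed
  moreover have "compact_space N'" "Hausdorff_space N'"
    using homeomorphic_compact_space[OF hs] homeomorphic_Hausdorff_space[OF hs] comp haus by auto
  moreover have "topspace N' \<noteq> {}"
    using ne by (simp add: top A_def)
  ultimately have "minimal_flow G T N' \<psi>'"
    using act' cont' unfolding minimal_flow_def flow_def top by blast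
  moreover have "factor_map G N' \<psi>' N \<psi> h"
    using h_cont bij_h eqv by (simp add: factor_map_def top bij_betw_def)
  ultimately show thesis by (rule that)
qed

lemma universal_minimal_flow_factor:
  assumes M: "universal_minimal_flow G T M \<phi>" and N: "minimal_flow G T N \<psi>"
  shows "\<exists>\<pi>. factor_map G M \<phi> N \<psi> \<pi>"
proof -
  obtain N' :: "'a set set topology" and \<psi>' \<rho>
    where N': "minimal_flow G T N' \<psi>'" and \<rho>: "factor_map G N' \<psi>' N \<psi> \<rho>"
    by (rule minimal_flow_copy[OF N])
  then obtain \<pi> where \<pi>: "factor_map G M \<phi> N' \<psi>' \<pi>"
    using M by (auto simp: universal_minimal_flow_def)
  have "\<pi> y \<in> topspace N'" if "y \<in> topspace M" for y
    using \<pi> that by (auto simp: factor_map_def)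
  moreover have "(\<rho> \<circ> \<pi>) ` topspace M = topspace N"
    using \<pi> \<rho> unfolding factor_map_def image_comp[symmetric] by simp
  moreover have "continuous_map M N (\<rho> \<circ> \<pi>)"
    using \<pi> \<rho> by (intro continuous_map_compose[of M N' \<pi>]) (auto simp: factor_map_def)
  ultimately have "factor_map G M \<phi> N \<psi> (\<rho> \<circ> \<pi>)"
    using \<pi> \<rho> unfolding factor_map_def
    by simp
  then show ?thesis by blast
qed

end

theory Submission
  imports Defs
begin

text \<open>
  Let \<open>c\<close> be a maximal connected chain. Cover the homeomorphism group by countably many sets of
  mutually close homeomorphisms, and suppose that the images of \<open>c\<close> under one of these sets \<open>S\<close> were
  dense in an open set \<open>\<O>\<close> of chains. In dimension at least 3, arcs do not separate, so \<open>\<O>\<close>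
  contains all chains that follow a sufficiently fine arc \<open>h\<close> (a chain of small links), and \<open>h\<close> can
  be prolonged freely. Fix four distant regions, numbered from 0 to 3, and prolong \<open>h\<close> in two ways:
  cycling many times through the regions 0, 1, 2 while avoiding 3, and cycling many times through
  0, 1, 3 while avoiding 2. Chains in \<open>S c\<close> that follow the two arcs provide a member \<open>L\<close> of \<open>c\<close>
  and two nearby maps of \<open>L\<close>, into neighbourhoods of the two arcs, one of them reaching the end of
  its arc. Then one of the two cyclic words is read off by walking back and forth along the other
  arc. Reading a cyclic word forces the walk to move monotonically, so it must leave \<open>h\<close> and enter
  a part of the arc that avoids one of its letters, which is absurd.

  For locally transitive \<open>G\<close>, any chain can be pushed into a tube around \<open>h\<close>, link by link; so the
  connected chains form a minimal flow. It is a factor of the universal minimal flow, and factor maps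
  of minimal flows pull meager sets back to meager sets.
\<close>

section \<open>The Vietoris topology\<close>

text \<open>Dimension enters only through \<open>tame_space\<close>, so manifolds and the Hilbert
  cube are treated alike, and arcs are replaced by chains of small continua. The member
  \<open>L\<close> comes from comparability: each of the two prolongations is followed by the image
  of some member of \<open>c\<close>, and the smaller of these two members is mapped into both
  neighbourhoods. Words need three letters. Walking back and forth along an arc that alternates
  between two regions already reads arbitrarily long alternating words. A cyclic word over three
  letters winds around a triangle, and the lift to the integers turns winding into displacement. On
  the other arc one letter disappears after the \<open>r\<close> common links, so two values of the
  lift differ by at most \<open>2 * r + 6\<close>, whereas reading the whole word displaces the lift
  by almost its length \<open>M\<close>. This dictates the size of \<open>M\<close>.\<close>

lemma compact_space_topology_generated_by:
  assumes "\<And>C. C \<subseteq> \<B> \<Longrightarrow> \<Union>C = \<Union>\<B> \<Longrightarrow> \<exists>C'. finite C' \<and> C' \<subseteq> C \<and> \<Union>C' = \<Union>\<B>"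
  shows "compact_space (topology_generated_by \<B>)"
proof (rule Alexander_subbase)
  let ?T = "topology (arbitrary union_of (finite intersection_of (\<lambda>x. x \<in> \<B>) relative_to \<Union>\<B>))"
  have op: "openin ?T = arbitrary union_of (finite intersection_of (\<lambda>x. x \<in> \<B>) relative_to \<Union>\<B>)"
    using istopology_subbase topology_inverse' by blast
  show "?T = topology_generated_by \<B>"
  proof (rule topology_eq[THEN iffD2], intro allI iffI)
    fix S assume "openin ?T S"
    then show "openin (topology_generated_by \<B>) S"
      by (rule minimal_topology_subbase[rotated 2])
        (use topology_generated_by_Basis openin_topspace[of "topology_generated_by \<B>"] in auto)
  next
    fix S assume "openin (topology_generated_by \<B>) S"
    then have "generate_topology_on \<B> S" by (rule openin_topology_generated_by)
    then show "openin ?T S"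
    proof (rule generate_topology_on_coarsest[rotated 2])
      show "istopology (openin ?T)" by simp
      fix S assume "S \<in> \<B>"
      then have "(finite intersection_of (\<lambda>x. x \<in> \<B>) relative_to \<Union>\<B>) S"
        unfolding relative_to_def intersection_of_def
        by (intro exI[of _ S] conjI exI[of _ "{S}"]) auto
      then show "openin ?T S" unfolding op by (rule arbitrary_union_of_inc)
    qed
  qed
next
  fix C assume "C \<subseteq> \<B>" "\<Union>C = topspace (topology_generated_by \<B>)"
  then show "\<exists>C'. finite C' \<and> C' \<subseteq> C \<and> \<Union>C' = topspace (topology_generated_by \<B>)"
    using assms by simp
qed

text \<open>A base of the Vietoris topology: in a finite intersection of subbasic sets the inclusion
  conditions merge into one, and the meeting conditions are collected in
  \<open>\<G>\<close>.\<close>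

definition vietoris_box :: "'a topology \<Rightarrow> 'a set \<Rightarrow> 'a set set \<Rightarrow> 'a set set" where
  "vietoris_box Y U \<G> = {K. compactin Y K \<and> K \<noteq> {} \<and> K \<subseteq> U \<and> (\<forall>G\<in>\<G>. K \<inter> G \<noteq> {})}"

lemma openin_vietoris_subset:
  "openin Y U \<Longrightarrow> openin (vietoris Y) {K. compactin Y K \<and> K \<noteq> {} \<and> K \<subseteq> U}"
  unfolding vietoris_def by (rule topology_generated_by_Basis) blast

lemma openin_vietoris_meets:
  "openin Y U \<Longrightarrow> openin (vietoris Y) {K. compactin Y K \<and> K \<noteq> {} \<and> K \<inter> U \<noteq> {}}"
  unfolding vietoris_def by (rule topology_generated_by_Basis) blast

lemma openin_vietoris_box:
  assumes "openin Y U" "finite \<G>" "\<And>G. G \<in> \<G> \<Longrightarrow> openin Y G"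
  shows "openin (vietoris Y) (vietoris_box Y U \<G>)"
proof -
  have "vietoris_box Y U \<G> = {K. compactin Y K \<and> K \<noteq> {} \<and> K \<subseteq> U}
     \<inter> (\<Inter>G\<in>\<G>. {K. compactin Y K \<and> K \<noteq> {} \<and> K \<inter> G \<noteq> {}} \<union> {})" if "\<G> \<noteq> {}"
    using that unfolding vietoris_box_def by auto
  moreover have "openin (vietoris Y) (\<Inter>G\<in>\<G>. {K. compactin Y K \<and> K \<noteq> {} \<and> K \<inter> G \<noteq> {}} \<union> {})" if "\<G> \<noteq> {}"
    using assms that openin_vietoris_meets by (intro openin_Inter) auto
  ultimately show ?thesis
    using openin_vietoris_subset[OF assms(1)] openin_Int
    by (cases "\<G> = {}") (auto simp: vietoris_box_def)
qed

lemma openin_vietoris_obtain_box: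
  assumes "openin (vietoris Y) \<O>" "K \<in> \<O>"
  obtains U \<G> where "openin Y U" "finite \<G>" "\<And>G. G \<in> \<G> \<Longrightarrow> openin Y G"
    "K \<in> vietoris_box Y U \<G>" "vietoris_box Y U \<G> \<subseteq> \<O>"
proof -
  have "generate_topology_on
     ({{K. compactin Y K \<and> K \<noteq> {} \<and> K \<subseteq> U} | U. openin Y U} \<union>
      {{K. compactin Y K \<and> K \<noteq> {} \<and> K \<inter> U \<noteq> {}} | U. openin Y U}) \<O>"
    using assms(1) unfolding vietoris_def by (rule openin_topology_generated_by)
  then have "K \<in> \<O> \<Longrightarrow> \<exists>U \<G>. openin Y U \<and> finite \<G> \<and> (\<forall>G\<in>\<G>. openin Y G) \<and>
    K \<in> vietoris_box Y U \<G> \<and> vietoris_box Y U \<G> \<subseteq> \<O>"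
  proof induction
    case (Int a b)
    then obtain U \<G> U' \<G>' where *:
      "openin Y U \<and> finite \<G> \<and> (\<forall>G\<in>\<G>. openin Y G) \<and> K \<in> vietoris_box Y U \<G> \<and> vietoris_box Y U \<G> \<subseteq> a"
      "openin Y U' \<and> finite \<G>' \<and> (\<forall>G\<in>\<G>'. openin Y G) \<and> K \<in> vietoris_box Y U' \<G>' \<and> vietoris_box Y U' \<G>' \<subseteq> b"
      by blast
    have "finite (\<G> \<union> \<G>')" "\<forall>G\<in>\<G> \<union> \<G>'. openin Y G" "openin Y (U \<inter> U')"
      using * by auto
    moreover have "vietoris_box Y (U \<inter> U') (\<G> \<union> \<G>') = vietoris_box Y U \<G> \<inter> vietoris_box Y U' \<G>'"
      by (auto simp: vietoris_box_def)
    ultimately show ?case using * by (metis Int_iff Int_mono)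
  next
    case (UN k)
    then obtain a where "a \<in> k" "K \<in> a" by blast
    with UN(2)[OF this] show ?case by blast
  next
    case (Basis s)
    then consider U where "openin Y U" "s = {K. compactin Y K \<and> K \<noteq> {} \<and> K \<subseteq> U}"
      | U where "openin Y U" "s = {K. compactin Y K \<and> K \<noteq> {} \<and> K \<inter> U \<noteq> {}}"
      by blast
    then show ?case
    proof cases
      case 1 then show ?thesis
        using Basis(2) by (intro exI[of _ U] exI[of _ "{}"]) (auto simp: vietoris_box_def)
    next
      case 2
      then show ?thesis
        using Basis(2) compactin_subset_topspace
        by (intro exI[of _ "topspace Y"] exI[of _ "{U}"]) (auto simp: vietoris_box_def)
    qed
  qed simp
  then show thesis using assms(2) that by metis
qed

lemma Hausdorff_space_vietoris:
  assumes H: "Hausdorff_space Y"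
  shows "Hausdorff_space (vietoris Y)"
proof -
  have sep: "\<exists>\<U> \<V>. openin (vietoris Y) \<U> \<and> openin (vietoris Y) \<V> \<and> K \<in> \<U> \<and> L \<in> \<V> \<and> disjnt \<U> \<V>"
    if K: "K \<in> topspace (vietoris Y)" and L: "L \<in> topspace (vietoris Y)" and "\<not> K \<subseteq> L" for K L
  proof -
    obtain x where x: "x \<in> K" "x \<notin> L" using \<open>\<not> K \<subseteq> L\<close> by blast
    have "compactin Y {x}" "compactin Y L" "disjnt {x} L"
      using x K L compactin_subset_topspace by (auto simp: topspace_vietoris)
    then obtain U V where "openin Y U" "openin Y V" "{x} \<subseteq> U" "L \<subseteq> V" "disjnt U V"
      using Hausdorff_space_compact_separation[OF H] by metis
    then show ?thesis
      using x K L openin_vietoris_meets[of Y U] openin_vietoris_subset[of Y V]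
      by (intro exI[of _ "{K. compactin Y K \<and> K \<noteq> {} \<and> K \<inter> U \<noteq> {}}"]
          exI[of _ "{K. compactin Y K \<and> K \<noteq> {} \<and> K \<subseteq> V}"])
        (auto simp: topspace_vietoris disjnt_iff)
  qed
  show ?thesis
    unfolding Hausdorff_space_def
  proof (intro allI impI)
    fix K L assume KL: "K \<in> topspace (vietoris Y) \<and> L \<in> topspace (vietoris Y) \<and> K \<noteq> L"
    show "\<exists>U V. openin (vietoris Y) U \<and> openin (vietoris Y) V \<and> K \<in> U \<and> L \<in> V \<and> disjnt U V"
    proof (cases "K \<subseteq> L")
      case True
      then have "\<not> L \<subseteq> K" using KL by blast
      then show ?thesis using sep[of L K] KL by (meson disjnt_sym)
    qed (use sep KL in blast)
  qed
qed

text \<open>By Alexander's theorem only covers by subbasic sets count. The points missed by all open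
  sets of \<open>M\<close> form a compact \<open>K\<close>, which no meeting set of the cover
  contains; if nonempty, it is caught by a set \<open>?s U\<close>. The compact complement of
  \<open>U\<close> is then covered by finitely many members of \<open>M\<close>.\<close>

lemma compact_space_vietoris:
  assumes "compact_space Y"
  shows "compact_space (vietoris Y)"
  unfolding vietoris_def
proof (rule compact_space_topology_generated_by)
  let ?s = "\<lambda>U. {K. compactin Y K \<and> K \<noteq> {} \<and> K \<subseteq> U}"
  let ?m = "\<lambda>U. {K. compactin Y K \<and> K \<noteq> {} \<and> K \<inter> U \<noteq> {}}"
  let ?B = "{?s U | U. openin Y U} \<union> {?m U | U. openin Y U}"
  have top: "\<Union>?B = {K. compactin Y K \<and> K \<noteq> {}}"
    using topspace_vietoris[of Y] unfolding vietoris_def topology_generated_by_topspace .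
  fix C assume C: "C \<subseteq> ?B" "\<Union>C = \<Union>?B"
  define M where "M = {U. openin Y U \<and> ?m U \<in> C}"
  define K where "K = topspace Y - \<Union>M"
  have K: "compactin Y K"
    unfolding K_def by (intro closedin_compact_space[OF assms] closedin_diff openin_Union) (auto simp: M_def)
  show "\<exists>C'. finite C' \<and> C' \<subseteq> C \<and> \<Union>C' = \<Union>?B"
  proof -
    \<comment> \<open>If \<open>K\<close> is empty, the family \<open>M\<close> already covers
      \<open>Y\<close>, and \<open>U = {}\<close> lets the compactness argument below run on the
      whole space.\<close>
    obtain U where U: "openin Y U" "K \<subseteq> U" "K = {} \<and> U = {} \<or> ?s U \<in> C"
    proof (cases "K = {}")
      case False
      then have "K \<in> \<Union>C" using K C top by auto
      then obtain c where c: "c \<in> C" "K \<in> c" by blast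
      have "c \<in> ?B" using c(1) C(1) by (rule subsetD[rotated])
      then consider U where "openin Y U" "c = ?s U" | U where "openin Y U" "c = ?m U"
        by (elim UnE CollectE exE conjE) auto
      then show ?thesis
      proof cases
        case 2 then show ?thesis using c by (auto simp: K_def M_def)
      qed (use c that in auto)
    qed (use that in auto)
    have "compactin Y (topspace Y - U)"
      using U(1) assms by (intro closedin_compact_space) auto
    moreover have "topspace Y - U \<subseteq> \<Union>M" using U by (auto simp: K_def)
    moreover have "\<And>V. V \<in> M \<Longrightarrow> openin Y V" by (simp add: M_def)
    ultimately have "\<exists>F. finite F \<and> F \<subseteq> M \<and> topspace Y - U \<subseteq> \<Union>F" by (intro compactinD)
    then obtain F where F: "finite F" "F \<subseteq> M" "topspace Y - U \<subseteq> \<Union>F" by blast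
    have sub: "?m ` F \<subseteq> C"
    proof (rule image_subsetI)
      fix U assume "U \<in> F"
      with F(2) have "U \<in> M" by (rule subsetD)
      then show "?m U \<in> C" by (simp add: M_def)
    qed
    \<comment> \<open>Intersecting with \<open>C\<close> discards \<open>?s U\<close> in the case
      \<open>U = {}\<close>, where it may fail to belong to the cover.\<close>
    define C' where "C' = ?m ` F \<union> ({?s U} \<inter> C)"
    have "L \<in> \<Union>C'" if L: "compactin Y L" "L \<noteq> {}" for L
    proof (cases "\<exists>V\<in>F. L \<inter> V \<noteq> {}")
      case True
      then obtain V where "V \<in> F" "L \<inter> V \<noteq> {}" by blast
      then have "?m V \<in> C'" "L \<in> ?m V" using L by (simp_all add: C'_def)
      then show ?thesis by (rule UnionI)
    next
      case False
      have LY: "L \<subseteq> topspace Y" using L compactin_subset_topspace by blast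
      then have LU: "L \<subseteq> U" using False F by blast
      then have "U \<noteq> {}" using L by blast
      then have "?s U \<in> C" using U by auto
      then have "?s U \<in> C'" "L \<in> ?s U" using LU L by (simp_all add: C'_def)
      then show ?thesis by (rule UnionI)
    qed
    then have "\<Union>?B \<subseteq> \<Union>C'" unfolding top by (simp add: subset_iff del: Union_iff)
    moreover have "C' \<subseteq> C" using sub unfolding C'_def by (simp only: Un_subset_iff Int_lower2)
    moreover have "finite C'" using F unfolding C'_def by simp
    ultimately show ?thesis using C(2) by (metis Union_mono subset_antisym)
  qed
qed

text \<open>The parameter \<open>t\<close> gives joint continuity, so an action on \<open>X\<close>
  lifts to \<open>vietoris X\<close> and, by a second application, to the double hyperspace. For an
  inclusion condition the whole compact set is controlled at once by Wallace's theorem; for a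
  meeting condition a single point is enough.\<close>

lemma continuous_map_vietoris_image:
  assumes F: "continuous_map (prod_topology T Y) Z F"
  shows "continuous_map (prod_topology T (vietoris Y)) (vietoris Z) (\<lambda>(t, K). (\<lambda>y. F (t, y)) ` K)"
proof -
  let ?f = "\<lambda>(t, K). (\<lambda>y. F (t, y)) ` K"
  have comp: "compactin Z ((\<lambda>y. F (t, y)) ` K)" if "t \<in> topspace T" "compactin Y K" for t K
  proof (rule image_compactin[OF that(2)])
    show "continuous_map Y Z (\<lambda>y. F (t, y))"
      using continuous_map_compose[OF _ F, of Y "\<lambda>y. (t, y)"] that(1)
      by (simp add: continuous_map_pairedI o_def)
  qed
  have oF: "openin (prod_topology T Y) {p \<in> topspace (prod_topology T Y). F p \<in> U}" if "openin Z U" for U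
    using F that by (rule openin_continuous_map_preimage)
  have s: "openin (prod_topology T (vietoris Y))
      (?f -` {L. compactin Z L \<and> L \<noteq> {} \<and> L \<subseteq> U} \<inter> topspace (prod_topology T (vietoris Y)))"
    (is "openin _ ?W") if U: "openin Z U" for U
  proof (subst openin_subopen, intro ballI)
    fix p assume p: "p \<in> ?W"
    obtain t K where [simp]: "p = (t, K)" by (cases p)
    have tK: "t \<in> topspace T" "compactin Y K" "K \<noteq> {}" "\<And>y. y \<in> K \<Longrightarrow> F (t, y) \<in> U"
      using p by (auto simp: topspace_vietoris)
    have "{t} \<times> K \<subseteq> {p \<in> topspace (prod_topology T Y). F p \<in> U}"
      using tK compactin_subset_topspace by fastforce
    then obtain N V where NV: "openin T N" "openin Y V" "{t} \<subseteq> N" "K \<subseteq> V"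
      "N \<times> V \<subseteq> {p \<in> topspace (prod_topology T Y). F p \<in> U}"
      using Wallace_theorem_prod_topology[OF _ tK(2) oF[OF U], of "{t}"] tK(1) by auto
    let ?N = "N \<times> {K. compactin Y K \<and> K \<noteq> {} \<and> K \<subseteq> V}"
    have "openin (prod_topology T (vietoris Y)) ?N"
      using NV openin_vietoris_subset[OF NV(2)] by (simp add: openin_prod_Times_iff)
    moreover have "p \<in> ?N" using NV tK by auto
    moreover have "?N \<subseteq> ?W"
    proof
      fix q assume "q \<in> ?N"
      then obtain s L where q: "q = (s, L)" "s \<in> N" "compactin Y L" "L \<noteq> {}" "L \<subseteq> V" by auto
      then have "(\<lambda>y. F (s, y)) ` L \<subseteq> U" using NV(5) by blast
      moreover have "s \<in> topspace T" using q(2) NV(1) openin_subset by blast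
      ultimately show "q \<in> ?W" using q comp by (simp add: topspace_vietoris)
    qed
    ultimately show "\<exists>N. openin (prod_topology T (vietoris Y)) N \<and> p \<in> N \<and> N \<subseteq> ?W" by blast
  qed
  have m: "openin (prod_topology T (vietoris Y))
      (?f -` {L. compactin Z L \<and> L \<noteq> {} \<and> L \<inter> U \<noteq> {}} \<inter> topspace (prod_topology T (vietoris Y)))"
    (is "openin _ ?W") if U: "openin Z U" for U
  proof (subst openin_subopen, intro ballI)
    fix p assume p: "p \<in> ?W"
    obtain t K where [simp]: "p = (t, K)" by (cases p)
    obtain y where tK: "t \<in> topspace T" "compactin Y K" "y \<in> K" "F (t, y) \<in> U"
      using p by (auto simp: topspace_vietoris)
    then have ty: "(t, y) \<in> {p \<in> topspace (prod_topology T Y). F p \<in> U}"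
      using compactin_subset_topspace[OF tK(2)] by auto
    obtain N V where NV: "openin T N" "openin Y V" "t \<in> N" "y \<in> V"
      "N \<times> V \<subseteq> {p \<in> topspace (prod_topology T Y). F p \<in> U}"
      using oF[OF U, unfolded openin_prod_topology_alt, rule_format, OF ty] by blast
    let ?N = "N \<times> {K. compactin Y K \<and> K \<noteq> {} \<and> K \<inter> V \<noteq> {}}"
    have "openin (prod_topology T (vietoris Y)) ?N"
      using NV openin_vietoris_meets[OF NV(2)] by (simp add: openin_prod_Times_iff)
    moreover have "p \<in> ?N" using NV tK by auto
    moreover have "?N \<subseteq> ?W"
    proof
      fix q assume "q \<in> ?N"
      then obtain s L z where q: "q = (s, L)" "s \<in> N" "compactin Y L" "z \<in> L" "z \<in> V" by auto
      then have "F (s, z) \<in> U" using NV(5) by blast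
      moreover have "s \<in> topspace T" using q(2) NV(1) openin_subset by blast
      moreover from this have "compactin Z ((\<lambda>y. F (s, y)) ` L)" using comp q(3) by blast
      moreover have "(\<lambda>y. F (s, y)) ` L \<inter> U \<noteq> {}" using q(4) \<open>F (s, z) \<in> U\<close> by blast
      ultimately show "q \<in> ?W" using q by (simp add: topspace_vietoris) blast
    qed
    ultimately show "\<exists>N. openin (prod_topology T (vietoris Y)) N \<and> p \<in> N \<and> N \<subseteq> ?W" by blast
  qed
  have im: "?f p \<in> topspace (vietoris Z)" if "p \<in> topspace (prod_topology T (vietoris Y))" for p
    using that comp by (auto simp: topspace_vietoris)
  show ?thesis
    unfolding vietoris_def[of Z] continuous_on_generated_topo_iff
  proof (intro conjI allI impI)
    show "?f ` topspace (prod_topology T (vietoris Y)) \<subseteq>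
      \<Union>({{K. compactin Z K \<and> K \<noteq> {} \<and> K \<subseteq> U} |U. openin Z U} \<union>
      {{K. compactin Z K \<and> K \<noteq> {} \<and> K \<inter> U \<noteq> {}} |U. openin Z U})"
      using im unfolding vietoris_def[of Z] topology_generated_by_topspace by (intro image_subsetI)
  qed (elim UnE CollectE exE conjE; simp only: s m)
qed

lemma continuous_map_vietoris:
  assumes "continuous_map Y Z f"
  shows "continuous_map (vietoris Y) (vietoris Z) (image f)"
proof -
  \<comment> \<open>The parameter space is \<open>Y\<close> itself and the parameter is ignored.
    Fixing it takes a point of \<open>Y\<close>, hence the case distinction.\<close>
  have "continuous_map (prod_topology Y Y) Z (f \<circ> snd)"
    using assms continuous_map_snd continuous_map_compose by blast
  show ?thesis
  proof (cases "topspace Y = {}")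
    case True
    then have "topspace (vietoris Y) = {}"
      unfolding topspace_vietoris using compactin_subset_topspace[of Y] by blast
    then show ?thesis
      by (simp add: continuous_map_def)
  next
    case False
    then obtain t where t: "t \<in> topspace Y" by blast
    have "continuous_map (vietoris Y) (prod_topology Y (vietoris Y)) (\<lambda>K. (t, K))"
      using t by (simp add: continuous_map_pairedI)
    from continuous_map_compose[OF this continuous_map_vietoris_image[OF \<open>continuous_map (prod_topology Y Y) Z (f \<circ> snd)\<close>]]
    show ?thesis by (simp add: o_def)
  qed
qed

section \<open>Closed conditions on compact sets\<close>

lemma closedin_vietoris_subset:
  assumes "closedin Y K"
  shows "closedin (vietoris Y) {L \<in> topspace (vietoris Y). L \<subseteq> K}"
proof -
  have "topspace (vietoris Y) - {L \<in> topspace (vietoris Y). L \<subseteq> K} =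
      {L. compactin Y L \<and> L \<noteq> {} \<and> L \<inter> (topspace Y - K) \<noteq> {}}"
    using compactin_subset_topspace by (auto simp: topspace_vietoris)
  then show ?thesis
    using openin_vietoris_meets[of Y "topspace Y - K"] assms by (auto simp: closedin_def)
qed

lemma closedin_vietoris_superset:
  assumes "t1_space Y" "K \<subseteq> topspace Y"
  shows "closedin (vietoris Y) {L \<in> topspace (vietoris Y). K \<subseteq> L}"
proof -
  have *: "closedin (vietoris Y) {L \<in> topspace (vietoris Y). y \<in> L}" if "y \<in> K" for y
  proof -
    have "topspace (vietoris Y) - {L \<in> topspace (vietoris Y). y \<in> L} =
      {L. compactin Y L \<and> L \<noteq> {} \<and> L \<subseteq> topspace Y - {y}}"
      using compactin_subset_topspace by (auto simp: topspace_vietoris)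
    moreover have "openin Y (topspace Y - {y})"
      using assms that by (auto simp: t1_space_closedin_singleton)
    ultimately show ?thesis
      using openin_vietoris_subset[of Y "topspace Y - {y}"] by (auto simp: closedin_def)
  qed
  show ?thesis
  proof (cases "K = {}")
    case False
    then have "{L \<in> topspace (vietoris Y). K \<subseteq> L} = (\<Inter>y\<in>K. {L \<in> topspace (vietoris Y). y \<in> L})"
      by auto
    then show ?thesis using False * by auto
  qed simp
qed

text \<open>The two halves of a disconnected compact set have disjoint open neighbourhoods
  \<open>P\<close> and \<open>Q\<close>, and these also disconnect every compact set in the box of
  \<open>P \<union> Q\<close> with meeting conditions \<open>P\<close> and \<open>Q\<close>.\<close>

lemma closedin_vietoris_connected:
  assumes H: "Hausdorff_space Y"
  shows "closedin (vietoris Y) {K \<in> topspace (vietoris Y). connectedin Y K}"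
proof -
  have "openin (vietoris Y) {K \<in> topspace (vietoris Y). \<not> connectedin Y K}" (is "openin _ ?W")
  proof (subst openin_subopen, intro ballI)
    fix K assume "K \<in> ?W"
    then have K: "compactin Y K" "\<not> connectedin Y K" by (auto simp: topspace_vietoris)
    then obtain E1 E2 where E: "closedin Y E1" "closedin Y E2" "K \<subseteq> E1 \<union> E2" "E1 \<inter> E2 \<inter> K = {}"
      "E1 \<inter> K \<noteq> {}" "E2 \<inter> K \<noteq> {}"
      unfolding connectedin_closedin using compactin_subset_topspace[OF K(1)] by blast
    have "compactin Y (E1 \<inter> K)" "compactin Y (E2 \<inter> K)" "disjnt (E1 \<inter> K) (E2 \<inter> K)"
      using closed_Int_compactin[OF E(1) K(1)] closed_Int_compactin[OF E(2) K(1)] E(4)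
      by (auto simp: disjnt_def)
    then obtain P Q where PQ: "openin Y P" "openin Y Q" "E1 \<inter> K \<subseteq> P" "E2 \<inter> K \<subseteq> Q" "disjnt P Q"
      using Hausdorff_space_compact_separation[OF H] by metis
    have "openin (vietoris Y) (vietoris_box Y (P \<union> Q) {P, Q})"
      using PQ by (intro openin_vietoris_box) auto
    moreover have "K \<in> vietoris_box Y (P \<union> Q) {P, Q}"
      using PQ E K by (auto simp: vietoris_box_def)
    moreover have "vietoris_box Y (P \<union> Q) {P, Q} \<subseteq> ?W"
    proof
      fix L assume L: "L \<in> vietoris_box Y (P \<union> Q) {P, Q}"
      then have "\<not> connectedin Y L"
        using PQ connectedinD[of Y L P Q] by (auto simp: vietoris_box_def disjnt_def)
      then show "L \<in> ?W" using L by (auto simp: vietoris_box_def topspace_vietoris)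
    qed
    ultimately show "\<exists>N. openin (vietoris Y) N \<and> K \<in> N \<and> N \<subseteq> ?W" by blast
  qed
  moreover have "topspace (vietoris Y) - {K \<in> topspace (vietoris Y). connectedin Y K} = ?W" by blast
  ultimately show ?thesis by (simp add: closedin_def)
qed

section \<open>Extremal members of compact chains\<close>

lemma topspace_connected_chains:
  "topspace (connected_chains X) = {c \<in> maximal_chains X. connectedin (vietoris X) c}"
  by (auto simp: connected_chains_def maximal_chains_def)

text \<open>Without a greatest member the open sets \<open>?O L\<close> cover \<open>P\<close>. The
  largest of the finitely many \<open>L\<close> in a subcover then lies in none of its sets.\<close>

lemma compact_chain_has_greatest:
  assumes t1: "t1_space Y" and P: "compactin (vietoris Y) P" "chain\<^sub>\<subseteq> P" "P \<noteq> {}"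
  shows "\<exists>A\<in>P. \<forall>L\<in>P. L \<subseteq> A"
proof (rule ccontr)
  assume no: "\<not> ?thesis"
  let ?O = "\<lambda>L. topspace (vietoris Y) - {M \<in> topspace (vietoris Y). L \<subseteq> M}"
  have PV: "P \<subseteq> topspace (vietoris Y)" using P compactin_subset_topspace by blast
  then have PY: "L \<subseteq> topspace Y" if "L \<in> P" for L
    using that compactin_subset_topspace by (auto simp: topspace_vietoris)
  have op: "openin (vietoris Y) U" if U: "U \<in> ?O ` P" for U
    using U closedin_vietoris_superset[OF t1 PY] by auto
  have cov: "P \<subseteq> \<Union>(?O ` P)"
  proof
    fix M assume M: "M \<in> P"
    then obtain L where "L \<in> P" "\<not> L \<subseteq> M" using no by blast
    then have "M \<in> ?O L" using M PV by blast
    then show "M \<in> \<Union>(?O ` P)" using \<open>L \<in> P\<close> by blast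
  qed
  have "\<exists>F. finite F \<and> F \<subseteq> ?O ` P \<and> P \<subseteq> \<Union>F"
    by (rule compactinD[OF P(1) op cov])
  then obtain F where F: "finite F" "F \<subseteq> P" "P \<subseteq> \<Union>(?O ` F)"
    by (metis (no_types, lifting) finite_subset_image)
  then have "F \<noteq> {}" using P(3) by auto
  then obtain m where m: "m \<in> F" "\<forall>b\<in>F. m \<subseteq> b \<longrightarrow> m = b"
    using finite_has_maximal[OF F(1)] by blast
  then have "\<forall>b\<in>F. b \<subseteq> m" using P(2) F(2) unfolding chain_subset_def by blast
  moreover have "m \<in> P" using m F by blast
  ultimately show False using F(3) by blast
qed

lemma compact_chain_has_least:
  assumes P: "compactin (vietoris Y) P" "chain\<^sub>\<subseteq> P" "P \<noteq> {}" and cl: "\<And>L. L \<in> P \<Longrightarrow> closedin Y L"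
  shows "\<exists>A\<in>P. \<forall>L\<in>P. A \<subseteq> L"
proof (rule ccontr)
  assume no: "\<not> ?thesis"
  let ?O = "\<lambda>L. topspace (vietoris Y) - {M \<in> topspace (vietoris Y). M \<subseteq> L}"
  have PV: "P \<subseteq> topspace (vietoris Y)" using P compactin_subset_topspace by blast
  have op: "openin (vietoris Y) U" if U: "U \<in> ?O ` P" for U
    using U closedin_vietoris_subset[OF cl] by auto
  have cov: "P \<subseteq> \<Union>(?O ` P)"
  proof
    fix M assume M: "M \<in> P"
    then obtain L where "L \<in> P" "\<not> M \<subseteq> L" using no by blast
    then have "M \<in> ?O L" using M PV by blast
    then show "M \<in> \<Union>(?O ` P)" using \<open>L \<in> P\<close> by blast
  qed
  have "\<exists>F. finite F \<and> F \<subseteq> ?O ` P \<and> P \<subseteq> \<Union>F"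
    by (rule compactinD[OF P(1) op cov])
  then obtain F where F: "finite F" "F \<subseteq> P" "P \<subseteq> \<Union>(?O ` F)"
    by (metis (no_types, lifting) finite_subset_image)
  then have "F \<noteq> {}" using P(3) by auto
  then obtain m where m: "m \<in> F" "\<forall>b\<in>F. b \<subseteq> m \<longrightarrow> m = b"
    using finite_has_minimal[OF F(1)] by blast
  then have "\<forall>b\<in>F. m \<subseteq> b" using P(2) F(2) unfolding chain_subset_def by blast
  moreover have "m \<in> P" using m F by blast
  ultimately show False using F(3) by blast
qed

section \<open>Connected maximal chains\<close>

locale compact_Hausdorff =
  fixes X :: "'a topology"
  assumes compact: "compact_space X" and Hausdorff: "Hausdorff_space X"
begin

lemma t1: "t1_space X" by (simp add: Hausdorff Hausdorff_imp_t1_space)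

lemma compactin_iff_closedin: "compactin X K \<longleftrightarrow> closedin X K"
  using Hausdorff compact closedin_compact_space compactin_imp_closedin by blast

text \<open>The members below \<open>K\<close> and those above \<open>K\<close> are two closed parts
  covering the connected set \<open>c\<close>; \<open>{x}\<close> lies in the first and the whole
  space in the second. A member common to both is \<open>K\<close>.\<close>

lemma compact_chain_maximal:
  assumes c: "compactin (vietoris X) c" "chain\<^sub>\<subseteq> c" "connectedin (vietoris X) c" "topspace X \<in> c" "{x} \<in> c"
    and K: "K \<in> topspace (vietoris X)" "chain\<^sub>\<subseteq> (c \<union> {K})"
  shows "K \<in> c"
proof -
  have KX: "closedin X K" "K \<subseteq> topspace X" "K \<noteq> {}"
    using K compactin_iff_closedin compactin_subset_topspace by (auto simp: topspace_vietoris)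
  have cV: "c \<subseteq> topspace (vietoris X)" using c compactin_subset_topspace by blast
  let ?P = "{L \<in> topspace (vietoris X). L \<subseteq> K}" and ?Q = "{L \<in> topspace (vietoris X). K \<subseteq> L}"
  have PQ: "closedin (vietoris X) ?P" "closedin (vietoris X) ?Q"
    using closedin_vietoris_subset KX closedin_vietoris_superset[OF t1] by auto
  have com: "L \<subseteq> K \<or> K \<subseteq> L" if "L \<in> c" for L
    using K(2) that by (auto simp: chain_subset_def)
  have cov: "c \<subseteq> ?P \<union> ?Q" using com cV by blast
  have meet: "?P \<inter> c \<noteq> {}" "?Q \<inter> c \<noteq> {}"
  proof -
    have "{x} \<subseteq> K" using com[OF c(5)] KX by auto
    then show "?P \<inter> c \<noteq> {}" using c cV by blast
    show "?Q \<inter> c \<noteq> {}" using c(4) cV KX by blast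
  qed
  have "?P \<inter> ?Q \<inter> c \<noteq> {}"
    using c(3) PQ cov meet unfolding connectedin_closedin by blast
  then show ?thesis by auto
qed

text \<open>Maximality quantifies over all compact sets; here it becomes the presence of the two end
  members. In this form the condition passes to limits and to images, as
  \<open>closedin_connected_chains\<close> and \<open>chain_action_closed\<close> exploit.\<close>

lemma connected_chains_iff:
  "c \<in> topspace (connected_chains X) \<longleftrightarrow>
     compactin (vietoris X) c \<and> chain\<^sub>\<subseteq> c \<and> connectedin (vietoris X) c \<and> topspace X \<in> c \<and> (\<exists>x. {x} \<in> c)"
  (is "?L \<longleftrightarrow> ?R")
proof
  assume L: ?L
  then have c: "compactin (vietoris X) c" "c \<noteq> {}" "chain\<^sub>\<subseteq> c" "connectedin (vietoris X) c"
    and max: "\<And>K. K \<in> topspace (vietoris X) \<Longrightarrow> chain\<^sub>\<subseteq> (c \<union> {K}) \<Longrightarrow> K \<in> c"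
    by (auto simp: topspace_connected_chains maximal_chains_def topspace_vietoris)
  have cV: "c \<subseteq> topspace (vietoris X)" using c compactin_subset_topspace by blast
  then have mem: "compactin X L" "L \<noteq> {}" "L \<subseteq> topspace X" "closedin X L" if "L \<in> c" for L
    using that compactin_subset_topspace compactin_iff_closedin by (auto simp: topspace_vietoris)
  have ne: "topspace X \<noteq> {}" using c(2) mem by blast
  have "topspace X \<in> c"
  proof (rule max)
    show "topspace X \<in> topspace (vietoris X)" using ne compact by (simp add: topspace_vietoris compact_space_def)
    show "chain\<^sub>\<subseteq> (c \<union> {topspace X})" using c(3) mem(3) by (auto simp: chain_subset_def)
  qed
  moreover obtain A where A: "A \<in> c" "\<forall>L\<in>c. A \<subseteq> L"
    using compact_chain_has_least[OF c(1,3,2) mem(4)] by blast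
  then obtain x where x: "x \<in> A" using mem(2) by blast
  then have "\<forall>L\<in>c. x \<in> L" "x \<in> topspace X" using A mem(3) by blast+
  then have "{x} \<in> c"
    using c(3) by (intro max) (auto simp: chain_subset_def topspace_vietoris)
  ultimately show ?R using c by blast
next
  assume R: ?R
  then show ?L using compact_chain_maximal
    by (auto simp: topspace_connected_chains maximal_chains_def topspace_vietoris[of "vietoris X"])
qed

lemma closedin_connected_chains: "closedin (vietoris (vietoris X)) (topspace (connected_chains X))"
proof -
  let ?V = "vietoris X"
  have HV: "Hausdorff_space ?V" by (rule Hausdorff_space_vietoris[OF Hausdorff])
  have 1: "closedin (vietoris ?V) {c \<in> topspace (vietoris ?V). connectedin ?V c}"
    by (rule closedin_vietoris_connected[OF HV])
  have t: "t1_space ?V" using HV Hausdorff_imp_t1_space by blast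
  have 2: "closedin (vietoris ?V) {c \<in> topspace (vietoris ?V). topspace X \<in> c}"
  proof (cases "topspace X \<in> topspace ?V")
    case True
    then show ?thesis using closedin_vietoris_superset[OF t, of "{topspace X}"] by simp
  next
    case False
    then have "{c \<in> topspace (vietoris ?V). topspace X \<in> c} = {}"
      using compactin_subset_topspace by (fastforce simp: topspace_vietoris[of ?V])
    then show ?thesis by (simp only: closedin_empty)
  qed
  \<comment> \<open>Two distinct points have disjoint neighbourhoods, so not being a singleton is an
    open condition on compact sets, and containing no singleton is an open condition on
    \<open>c\<close>.\<close>
  have 3: "closedin (vietoris ?V) {c \<in> topspace (vietoris ?V). \<exists>x. {x} \<in> c}"
  proof -
    let ?W = "{K \<in> topspace ?V. \<nexists>x. K = {x}}"
    have "openin ?V ?W"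
    proof (subst openin_subopen, intro ballI)
      fix K assume K: "K \<in> ?W"
      then obtain x where x: "x \<in> K" by (auto simp: topspace_vietoris)
      then have "K \<noteq> {x}" using K by blast
      then obtain y where y: "y \<in> K" "x \<noteq> y" using x by blast
      have "x \<in> topspace X" "y \<in> topspace X"
        using x y K compactin_subset_topspace by (auto simp: topspace_vietoris)
      then obtain U V where UV: "openin X U" "openin X V" "x \<in> U" "y \<in> V" "disjnt U V"
        using Hausdorff y by (meson Hausdorff_space_def)
      have "openin ?V (vietoris_box X (topspace X) {U, V})" using UV by (intro openin_vietoris_box) auto
      moreover have "K \<in> vietoris_box X (topspace X) {U, V}"
        using K x y UV compactin_subset_topspace by (auto simp: vietoris_box_def topspace_vietoris)
      moreover have "vietoris_box X (topspace X) {U, V} \<subseteq> ?W"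
        using UV by (auto simp: vietoris_box_def topspace_vietoris disjnt_iff)
      ultimately show "\<exists>N. openin ?V N \<and> K \<in> N \<and> N \<subseteq> ?W" by blast
    qed
    then have "openin (vietoris ?V) {c. compactin ?V c \<and> c \<noteq> {} \<and> c \<subseteq> ?W}"
      by (rule openin_vietoris_subset)
    moreover have "topspace (vietoris ?V) - {c \<in> topspace (vietoris ?V). \<exists>x. {x} \<in> c}
        = {c. compactin ?V c \<and> c \<noteq> {} \<and> c \<subseteq> ?W}"
      using compactin_subset_topspace by (fastforce simp: topspace_vietoris[of ?V])
    ultimately show ?thesis by (simp add: closedin_def)
  qed
  have 4: "closedin (vietoris ?V) {c \<in> topspace (vietoris ?V). chain\<^sub>\<subseteq> c}"
  proof -
    have "openin (vietoris ?V) {c \<in> topspace (vietoris ?V). \<not> chain\<^sub>\<subseteq> c}" (is "openin _ ?W")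
    proof (subst openin_subopen, intro ballI)
      fix c assume c: "c \<in> ?W"
      then obtain L M where LM: "L \<in> c" "M \<in> c" "\<not> L \<subseteq> M" "\<not> M \<subseteq> L"
        by (auto simp: chain_subset_def)
      have comp: "compactin X K" "K \<noteq> {}" "K \<subseteq> topspace X" if "K \<in> c" for K
        using c that compactin_subset_topspace[of ?V] compactin_subset_topspace[of X]
        by (auto simp: topspace_vietoris)
      have sep: "\<exists>U V. openin X U \<and> openin X V \<and> A \<inter> U \<noteq> {} \<and> B \<subseteq> V \<and> disjnt U V"
        if AB: "A \<in> c" "B \<in> c" "\<not> A \<subseteq> B" for A B
      proof -
        obtain x where "x \<in> A" "x \<notin> B" using AB by blast
        then have "compactin X {x}" "compactin X B" "disjnt {x} B" using comp AB by auto
        then obtain U V where "openin X U" "openin X V" "{x} \<subseteq> U" "B \<subseteq> V" "disjnt U V"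
          using Hausdorff_space_compact_separation[OF Hausdorff] by metis
        then show ?thesis using \<open>x \<in> A\<close> by blast
      qed
      \<comment> \<open>Each failed inclusion is witnessed by a point of one set and a neighbourhood
        of the other that are separated; both witnesses survive small changes of \<open>L\<close>
        and \<open>M\<close>.\<close>
      obtain U V where UV: "openin X U" "openin X V" "L \<inter> U \<noteq> {}" "M \<subseteq> V" "disjnt U V"
        using sep[OF LM(1,2,3)] by blast
      obtain U' V' where UV': "openin X U'" "openin X V'" "M \<inter> U' \<noteq> {}" "L \<subseteq> V'" "disjnt U' V'"
        using sep[OF LM(2,1,4)] by blast
      let ?A = "vietoris_box X V' {U}" and ?B = "vietoris_box X V {U'}"
      let ?N = "vietoris_box ?V (topspace ?V) {?A, ?B}"
      have op: "openin ?V ?A" "openin ?V ?B"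
        using UV UV' by (auto intro: openin_vietoris_box)
      then have "openin (vietoris ?V) ?N" by (intro openin_vietoris_box) auto
      moreover have "c \<in> ?N"
      proof -
        have "L \<in> ?A" "M \<in> ?B" using LM comp UV UV' by (auto simp: vietoris_box_def)
        moreover have "compactin ?V c" "c \<noteq> {}" using c by (auto simp: topspace_vietoris)
        ultimately show ?thesis
          using LM compactin_subset_topspace by (fastforce simp: vietoris_box_def[of ?V])
      qed
      moreover have "?N \<subseteq> ?W"
      proof
        fix d assume d: "d \<in> ?N"
        then obtain L' M' where "L' \<in> d" "L' \<in> ?A" "M' \<in> d" "M' \<in> ?B"
          by (auto simp: vietoris_box_def[of ?V])
        then have "\<not> L' \<subseteq> M'" "\<not> M' \<subseteq> L'" "L' \<in> d" "M' \<in> d"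
          using UV(5) UV'(5) by (auto simp: vietoris_box_def disjnt_def)
        then have "\<not> chain\<^sub>\<subseteq> d" by (auto simp: chain_subset_def)
        then show "d \<in> ?W" using d by (auto simp: vietoris_box_def[of ?V] topspace_vietoris[of ?V])
      qed
      ultimately show "\<exists>N. openin (vietoris ?V) N \<and> c \<in> N \<and> N \<subseteq> ?W" by blast
    qed
    moreover have "topspace (vietoris ?V) - {c \<in> topspace (vietoris ?V). chain\<^sub>\<subseteq> c} = ?W" by blast
    ultimately show ?thesis by (simp add: closedin_def)
  qed
  have "topspace (connected_chains X) =
     {c \<in> topspace (vietoris ?V). connectedin ?V c} \<inter> {c \<in> topspace (vietoris ?V). topspace X \<in> c} \<inter>
     {c \<in> topspace (vietoris ?V). \<exists>x. {x} \<in> c} \<inter> {c \<in> topspace (vietoris ?V). chain\<^sub>\<subseteq> c}"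
    by (auto simp: connected_chains_iff topspace_vietoris[of ?V])
  then show ?thesis using 1 2 3 4 by (simp add: closedin_Int)
qed

lemma connected_chains_eq_subtopology:
  "connected_chains X = subtopology (vietoris (vietoris X)) (topspace (connected_chains X))"
  by (subst topspace_connected_chains) (rule connected_chains_def)

lemma compact_space_connected_chains: "compact_space (connected_chains X)"
proof -
  have "compact_space (vietoris (vietoris X))"
    by (intro compact_space_vietoris compact)
  then have "compactin (vietoris (vietoris X)) (topspace (connected_chains X))"
    using closedin_connected_chains by (rule closedin_compact_space)
  then show ?thesis
    by (subst connected_chains_eq_subtopology) (rule compact_space_subtopology)
qed

lemma Hausdorff_space_connected_chains: "Hausdorff_space (connected_chains X)"
  unfolding connected_chains_def
  by (intro Hausdorff_space_subtopology Hausdorff_space_vietoris Hausdorff)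

end

section \<open>Members of connected chains and existence of order arcs\<close>

context compact_Hausdorff begin

lemma chain_memberD:
  assumes "c \<in> topspace (connected_chains X)" "K \<in> c"
  shows "compactin X K" "closedin X K" "K \<noteq> {}" "K \<subseteq> topspace X" "K \<in> topspace (vietoris X)"
proof -
  have "c \<subseteq> topspace (vietoris X)"
    using assms(1) compactin_subset_topspace unfolding connected_chains_iff by blast
  then show "K \<in> topspace (vietoris X)" using assms(2) by blast
  then show "compactin X K" "K \<noteq> {}" by (auto simp: topspace_vietoris)
  then show "closedin X K" "K \<subseteq> topspace X" using compactin_iff_closedin closedin_subset by auto
qed

lemma chain_comparable:
  assumes "c \<in> topspace (connected_chains X)" "K \<in> c" "L \<in> c"
  shows "K \<subseteq> L \<or> L \<subseteq> K"
  using assms unfolding connected_chains_iff chain_subset_def by blast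

lemma chain_root_subset:
  assumes "c \<in> topspace (connected_chains X)" "{x} \<in> c" "L \<in> c"
  shows "x \<in> L"
  using chain_comparable[OF assms] chain_memberD(3)[OF assms(1,3)] by auto

lemma chain_connected_split:
  assumes c: "c \<in> topspace (connected_chains X)"
    and P: "openin X P" and Q: "openin X Q"
    and cov: "\<And>L. L \<in> c \<Longrightarrow> L \<subseteq> P \<or> L \<inter> Q \<noteq> {}"
    and "K \<in> c" "K \<subseteq> P" "M \<in> c" "M \<inter> Q \<noteq> {}"
  shows "\<exists>L\<in>c. L \<subseteq> P \<and> L \<inter> Q \<noteq> {}"
proof (rule ccontr)
  assume no: "\<not> ?thesis"
  obtain \<P> where P': "openin (vietoris X) \<P>" "\<And>L. L \<in> c \<Longrightarrow> L \<in> \<P> \<longleftrightarrow> L \<subseteq> P"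
    by (rule that[OF openin_vietoris_subset[OF P]]) (simp add: chain_memberD(1,3)[OF c])
  obtain \<Q> where Q': "openin (vietoris X) \<Q>" "\<And>L. L \<in> c \<Longrightarrow> L \<in> \<Q> \<longleftrightarrow> L \<inter> Q \<noteq> {}"
    by (rule that[OF openin_vietoris_meets[OF Q]]) (simp add: chain_memberD(1,3)[OF c])
  show False
  proof (rule connectedinD[of "vietoris X" c \<P> \<Q>])
    show "connectedin (vietoris X) c" using c by (simp add: connected_chains_iff)
    show "c \<subseteq> \<P> \<union> \<Q>" using cov P'(2) Q'(2) by (metis UnCI subsetI)
    show "\<P> \<inter> \<Q> \<inter> c = {}" using no P'(2) Q'(2) by (metis (no_types, lifting) IntE equals0I)
    show "\<P> \<inter> c \<noteq> {}" using P'(2) assms(5,6) by (metis IntI empty_iff)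
    show "\<Q> \<inter> c \<noteq> {}" using Q'(2) assms(7,8) by (metis IntI empty_iff)
    show "openin (vietoris X) \<P>" "openin (vietoris X) \<Q>" by (fact P'(1) Q'(1))+
  qed
qed

text \<open>If \<open>K\<close> split, then while the chain grows from its root to \<open>K\<close>,
  some member would lie in a neighbourhood of the half containing the root and yet meet a disjoint
  neighbourhood of the other half.\<close>

lemma chain_member_connected:
  assumes c: "c \<in> topspace (connected_chains X)" and K: "K \<in> c"
  shows "connectedin X K"
proof (rule ccontr)
  assume "\<not> connectedin X K"
  note Kc = chain_memberD[OF c K]
  obtain x where x: "{x} \<in> c" using c by (auto simp: connected_chains_iff)
  have xK: "x \<in> K" by (rule chain_root_subset[OF c x K])
  obtain E1 E2 where E: "closedin X E1" "closedin X E2" "K \<subseteq> E1 \<union> E2" "E1 \<inter> E2 \<inter> K = {}"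
    "E1 \<inter> K \<noteq> {}" "E2 \<inter> K \<noteq> {}"
    using \<open>\<not> connectedin X K\<close> Kc(4) unfolding connectedin_closedin by blast
  have "compactin X (E1 \<inter> K)" "compactin X (E2 \<inter> K)" "disjnt (E1 \<inter> K) (E2 \<inter> K)"
    using closed_Int_compactin[OF E(1) Kc(1)] closed_Int_compactin[OF E(2) Kc(1)] E(4)
    by (auto simp: disjnt_def)
  then obtain P Q where PQ: "openin X P" "openin X Q" "E1 \<inter> K \<subseteq> P" "E2 \<inter> K \<subseteq> Q" "disjnt P Q"
    using Hausdorff_space_compact_separation[OF Hausdorff] by metis
  \<comment> \<open>Members below \<open>K\<close> satisfy the alternative because \<open>P\<close>
    and \<open>Q\<close> cover \<open>K\<close>; members above \<open>K\<close> inherit that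
    \<open>K\<close> meets \<open>Q\<close>. The root decides which half plays the role of
    \<open>P\<close>.\<close>
  have aux: False if PQ: "openin X P" "openin X Q" "K \<subseteq> P \<union> Q" "disjnt P Q" "K \<inter> Q \<noteq> {}" "x \<in> P" for P Q
  proof -
    have "\<exists>L\<in>c. L \<subseteq> P \<and> L \<inter> Q \<noteq> {}"
    proof (rule chain_connected_split[OF c PQ(1,2) _ x _ K PQ(5)])
      fix L assume "L \<in> c"
      then show "L \<subseteq> P \<or> L \<inter> Q \<noteq> {}"
        using chain_comparable[OF c K] PQ by blast
    qed (use PQ in blast)
    then show False using PQ(4) by (auto simp: disjnt_def)
  qed
  have "K \<subseteq> P \<union> Q" "K \<inter> Q \<noteq> {}" "K \<inter> P \<noteq> {}" using PQ E by blast+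
  then show False
    using aux[OF PQ(1,2)] aux[OF PQ(2,1)] PQ(5) xK by (metis UnE disjnt_sym subsetD sup_commute)
qed

lemma continuum_between:
  assumes A: "compactin X A" "connectedin X A" "A \<noteq> {}" and B: "compactin X B" "connectedin X B" "A \<subset> B"
  obtains E where "compactin X E" "connectedin X E" "A \<subset> E" "E \<subset> B"
proof -
  let ?Y = "subtopology X B"
  have top: "topspace ?Y = B" using B compactin_subset_topspace by auto
  have "connected_space ?Y" using B(2) by (simp add: connectedin_def)
  moreover have "locally_compact_space ?Y"
    by (simp add: B(1) compact_imp_locally_compact_space compact_space_subtopology)
  moreover have "Hausdorff_space ?Y" by (simp add: Hausdorff Hausdorff_space_subtopology)
  moreover have "compactin ?Y A" "connectedin ?Y A" "A \<noteq> topspace ?Y"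
    using A B top by (auto simp: compactin_subtopology connectedin_subtopology)
  ultimately obtain D where "compactin ?Y D" "connectedin ?Y D" "A \<subset> D" "D \<subset> B"
    using intermediate_continuum_exists[of ?Y A "topspace ?Y"] A(3) B(3) top
    by (metis openin_topspace psubset_imp_subset)
  then show thesis using that by (auto simp: compactin_subtopology connectedin_subtopology)
qed

text \<open>Zorn's lemma gives a maximal linearly ordered family of continua through
  \<open>{x}\<close>, \<open>J\<close> and the whole space. It is closed because comparability with
  a fixed member passes to limits, and connected because a jump would be filled by
  \<open>continuum_between\<close>. In \<open>tube_chains_nonempty\<close> the prescribed
  \<open>J\<close> is a union of links.\<close>

lemma order_arc_exists:
  assumes conn: "connected_space X"
    and J: "compactin X J" "connectedin X J" "x \<in> J"
  obtains c where "c \<in> topspace (connected_chains X)" "{x} \<in> c" "J \<in> c"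
proof -
  let ?V = "vietoris X"
  define \<K> where "\<K> = {K \<in> topspace ?V. connectedin X K}"
  have Kcl: "closedin ?V \<K>" unfolding \<K>_def by (rule closedin_vietoris_connected[OF Hausdorff])
  have JX: "J \<subseteq> topspace X" "x \<in> topspace X" using J compactin_subset_topspace by blast+
  have three: "{{x}, J, topspace X} \<subseteq> \<K>"
    using J JX conn compact by (auto simp: \<K>_def topspace_vietoris compact_space_def connectedin_topspace)
  define \<A> where "\<A> = {c. c \<subseteq> \<K> \<and> chain\<^sub>\<subseteq> c \<and> {{x}, J, topspace X} \<subseteq> c}"
  have "{{x}, J, topspace X} \<in> \<A>" using three J JX by (auto simp: \<A>_def chain_subset_def)
  then have "\<exists>M\<in>\<A>. \<forall>c\<in>\<A>. M \<subseteq> c \<longrightarrow> c = M"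
  proof (intro subset_Zorn_nonempty)
    fix \<C> assume C: "\<C> \<noteq> {}" "subset.chain \<A> \<C>"
    have sub: "\<C> \<subseteq> \<A>" and lin: "\<And>c d. c \<in> \<C> \<Longrightarrow> d \<in> \<C> \<Longrightarrow> c \<subseteq> d \<or> d \<subseteq> c"
      using C(2) unfolding subset.chain_def by blast+
    have "chain\<^sub>\<subseteq> (\<Union>\<C>)"
      unfolding chain_subset_def
    proof (intro ballI)
      fix A B assume "A \<in> \<Union>\<C>" "B \<in> \<Union>\<C>"
      then obtain c d where cd: "c \<in> \<C>" "A \<in> c" "d \<in> \<C>" "B \<in> d" by blast
      then have "chain\<^sub>\<subseteq> c" "chain\<^sub>\<subseteq> d" using sub by (auto simp: \<A>_def)
      then show "A \<subseteq> B \<or> B \<subseteq> A"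
        using lin[OF cd(1,3)] cd unfolding chain_subset_def by blast
    qed
    moreover have "\<Union>\<C> \<subseteq> \<K>" "{{x}, J, topspace X} \<subseteq> \<Union>\<C>"
      using sub C(1) unfolding \<A>_def by blast+
    ultimately show "\<Union>\<C> \<in> \<A>" by (simp add: \<A>_def)
  qed auto
  then obtain c where c: "c \<in> \<A>" and max: "\<And>d. d \<in> \<A> \<Longrightarrow> c \<subseteq> d \<Longrightarrow> d = c" by blast
  have cK: "c \<subseteq> \<K>" and ch: "chain\<^sub>\<subseteq> c" and mem: "{x} \<in> c" "J \<in> c" "topspace X \<in> c"
    using c by (auto simp: \<A>_def)
  have KD: "compactin X K" "closedin X K" "connectedin X K" "K \<noteq> {}" "K \<subseteq> topspace X" "K \<in> topspace ?V"
    if "K \<in> \<K>" for K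
    using that compactin_iff_closedin closedin_subset by (auto simp: \<K>_def topspace_vietoris)
  have add: "E \<in> c" if "E \<in> \<K>" "\<And>K. K \<in> c \<Longrightarrow> K \<subseteq> E \<or> E \<subseteq> K" for E
  proof -
    have "chain\<^sub>\<subseteq> (insert E c)"
      using that(2) ch unfolding chain_subset_def by (simp only: ball_simps) blast
    then have "insert E c \<in> \<A>" using that(1) cK mem by (simp add: \<A>_def)
    then show ?thesis using max by blast
  qed
  have "closedin ?V c"
  proof -
    have "?V closure_of c \<subseteq> c"
    proof
      fix L assume L: "L \<in> ?V closure_of c"
      show "L \<in> c"
      proof (rule add)
        show "L \<in> \<K>" using L closure_of_minimal[OF cK Kcl] by blast
        fix K assume K: "K \<in> c"
        let ?D = "{L \<in> topspace ?V. L \<subseteq> K} \<union> {L \<in> topspace ?V. K \<subseteq> L}"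
        have "closedin ?V ?D"
          using closedin_vietoris_subset[of X K] closedin_vietoris_superset[OF t1, of K] KD cK K
          by (intro closedin_Un) auto
        moreover have "c \<subseteq> ?D"
        proof
          fix M assume M: "M \<in> c"
          then have "M \<subseteq> K \<or> K \<subseteq> M" using ch K by (simp add: chain_subset_def)
          then show "M \<in> ?D" using KD(6)[of M] cK M by auto
        qed
        ultimately show "K \<subseteq> L \<or> L \<subseteq> K" using L closure_of_minimal by blast
      qed
    qed
    moreover have "c \<subseteq> topspace ?V" using cK KD(6) by blast
    ultimately show ?thesis using closure_of_subset_eq by blast
  qed
  then have comp: "compactin ?V c"
    using compact_space_vietoris[OF compact] closedin_compact_space by blast
  have "connectedin ?V c"
  proof (rule ccontr)
    assume "\<not> connectedin ?V c"
    then obtain E1 E2 where E: "closedin ?V E1" "closedin ?V E2" "c \<subseteq> E1 \<union> E2" "E1 \<inter> E2 \<inter> c = {}"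
      "E1 \<inter> c \<noteq> {}" "E2 \<inter> c \<noteq> {}"
      unfolding connectedin_closedin using compactin_subset_topspace[OF comp] by blast
    \<comment> \<open>A separation of \<open>c\<close> produces a jump: \<open>A\<close> is the
      greatest member of the part without the whole space, \<open>B\<close> the least member of the
      other part above \<open>A\<close>. A continuum strictly between them is comparable with all
      members, yet fits into neither part.\<close>
    have aux: False if E: "closedin ?V P" "closedin ?V Q" "c \<subseteq> P \<union> Q" "P \<inter> Q \<inter> c = {}"
      "P \<inter> c \<noteq> {}" "topspace X \<in> Q" for P Q
    proof -
      have "compactin ?V (P \<inter> c)" "chain\<^sub>\<subseteq> (P \<inter> c)"
        using closed_Int_compactin[OF E(1) comp] ch by (auto simp: chain_subset_def)
      then obtain A where A: "A \<in> P" "A \<in> c" "\<And>L. L \<in> P \<Longrightarrow> L \<in> c \<Longrightarrow> L \<subseteq> A"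
        using compact_chain_has_greatest[OF t1 _ _ E(5)] by blast
      have AK: "A \<in> \<K>" using A cK by blast
      let ?Q = "Q \<inter> {L \<in> topspace ?V. A \<subseteq> L} \<inter> c"
      have "closedin ?V (Q \<inter> {L \<in> topspace ?V. A \<subseteq> L})"
        using E(2) closedin_vietoris_superset[OF t1] KD[OF AK] by auto
      then have "compactin ?V ?Q" "chain\<^sub>\<subseteq> ?Q"
        using closed_Int_compactin[OF _ comp] ch by (auto simp: chain_subset_def)
      moreover have "topspace X \<in> ?Q" using mem E(6) KD cK AK by blast
      then have "?Q \<noteq> {}" by blast
      moreover have "\<And>L. L \<in> ?Q \<Longrightarrow> closedin X L" using KD(2) cK by blast
      ultimately have "\<exists>B\<in>?Q. \<forall>L\<in>?Q. B \<subseteq> L" by (rule compact_chain_has_least)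
      then obtain B where B: "B \<in> ?Q" "\<And>L. L \<in> ?Q \<Longrightarrow> B \<subseteq> L" by (elim bexE) simp
      have BK: "B \<in> \<K>" using B cK by blast
      have "A \<noteq> B" using A B E(4) by blast
      then have "A \<subset> B" using B by blast
      then obtain F where F: "compactin X F" "connectedin X F" "A \<subset> F" "F \<subset> B"
        using continuum_between KD[OF AK] KD[OF BK] by metis
      have "F \<in> \<K>" using F KD(4)[OF AK] by (auto simp: \<K>_def topspace_vietoris)
      moreover have "K \<subseteq> F \<or> F \<subseteq> K" if K: "K \<in> c" for K
      proof -
        have "K \<subseteq> A \<or> A \<subseteq> K" using K A(2) ch unfolding chain_subset_def by blast
        moreover have "B \<subseteq> K" if "A \<subseteq> K" "K \<notin> P" using that K E(3) KD(6) cK by (intro B(2)) blast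
        ultimately show ?thesis using F A(3)[OF _ K] by blast
      qed
      ultimately have Fc: "F \<in> c" using add by blast
      have "F \<notin> P" using A(3) Fc F by blast
      then have "F \<in> ?Q" using Fc E(3) F KD(6)[OF \<open>F \<in> \<K>\<close>] by blast
      then show False using B(2) F by blast
    qed
    show False
      using aux[of E1 E2] aux[of E2 E1] E mem(3) by blast
  qed
  then have "c \<in> topspace (connected_chains X)"
    using comp ch mem unfolding connected_chains_iff by blast
  then show thesis using that mem by blast
qed

lemma chain_connected_in_vietoris:
  "c \<in> topspace (connected_chains X) \<Longrightarrow> connectedin (vietoris X) c"
  by (simp add: connected_chains_iff)

end

section \<open>The action of homeomorphisms on connected chains\<close>

lemma carrier_homeo_group:
  "carrier (homeo_group X) = {f \<in> Bij (topspace X). homeomorphic_map X X f}"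
  by (simp add: homeo_group_def)

lemma homeo_groupD:
  assumes "g \<in> carrier (homeo_group X)"
  shows "continuous_map X X g" "g ` topspace X = topspace X" "inj_on g (topspace X)"
    "\<And>x. x \<in> topspace X \<Longrightarrow> g x \<in> topspace X"
proof -
  have "homeomorphic_map X X g" using assms by (simp add: carrier_homeo_group)
  then show "continuous_map X X g" "g ` topspace X = topspace X" "inj_on g (topspace X)"
    by (simp_all add: homeomorphic_imp_continuous_map homeomorphic_imp_surjective_map homeomorphic_imp_injective_map)
  then show "\<And>x. x \<in> topspace X \<Longrightarrow> g x \<in> topspace X" by blast
qed

lemma mult_homeo_group:
  assumes "g \<in> carrier (homeo_group X)" "h \<in> carrier (homeo_group X)"
  shows "g \<otimes>\<^bsub>homeo_group X\<^esub> h = compose (topspace X) g h"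
  using assms by (simp add: homeo_group_def BijGroup_def)

lemma mult_homeo_apply:
  assumes "g \<in> carrier (homeo_group X)" "h \<in> carrier (homeo_group X)" "x \<in> topspace X"
  shows "(g \<otimes>\<^bsub>homeo_group X\<^esub> h) x = g (h x)"
  using assms by (simp add: mult_homeo_group compose_def)

context compact_Hausdorff begin

lemma chain_action_apply:
  "c \<in> topspace (connected_chains X) \<Longrightarrow> chain_action X g c = (image g) ` c"
  by (simp add: chain_action_def)

lemma chain_action_closed:
  assumes g: "g \<in> carrier (homeo_group X)" and c: "c \<in> topspace (connected_chains X)"
  shows "(image g) ` c \<in> topspace (connected_chains X)"
proof -
  note G = homeo_groupD[OF g]
  have cm: "continuous_map (vietoris X) (vietoris X) (image g)"
    by (rule continuous_map_vietoris[OF G(1)])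
  from c have c': "compactin (vietoris X) c" "chain\<^sub>\<subseteq> c" "connectedin (vietoris X) c" "topspace X \<in> c"
    and x: "\<exists>x. {x} \<in> c"
    by (auto simp: connected_chains_iff)
  then obtain x where "{x} \<in> c" by blast
  then have "{g x} \<in> (image g) ` c" by (metis image_eqI image_empty image_insert)
  moreover have "topspace X \<in> (image g) ` c" using c'(4) G(2) by (metis image_eqI)
  moreover have "chain\<^sub>\<subseteq> ((image g) ` c)"
    using c'(2) unfolding chain_subset_def by (simp only: ball_simps) (meson image_mono)
  ultimately show ?thesis
    unfolding connected_chains_iff
    using image_compactin[OF c'(1) cm] connectedin_continuous_map_image[OF cm c'(3)] by blast
qed

lemma chain_action_mult:
  assumes g: "g \<in> carrier (homeo_group X)" "h \<in> carrier (homeo_group X)"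
    and c: "c \<in> topspace (connected_chains X)"
  shows "(image (g \<otimes>\<^bsub>homeo_group X\<^esub> h)) ` c = (image g) ` ((image h) ` c)"
proof -
  have "(g \<otimes>\<^bsub>homeo_group X\<^esub> h) ` K = g ` (h ` K)" if "K \<in> c" for K
    using chain_memberD(4)[OF c that] mult_homeo_apply[OF g]
    unfolding image_image by (intro image_cong) auto
  then have "(image (g \<otimes>\<^bsub>homeo_group X\<^esub> h)) ` c = (\<lambda>K. g ` (h ` K)) ` c"
    by (rule image_cong[OF refl])
  then show ?thesis by (simp only: image_image)
qed

lemma closure_shrink:
  assumes "closedin X K" "openin X U" "K \<subseteq> U"
  obtains N where "openin X N" "K \<subseteq> N" "X closure_of N \<subseteq> U"
proof -
  have "normal_space X"
    using compact Hausdorff compact_Hausdorff_or_regular_imp_normal_space by blast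
  moreover have "closedin X (topspace X - U)" "disjnt K (topspace X - U)"
    using assms by (auto simp: disjnt_def)
  ultimately obtain N where "openin X N" "K \<subseteq> N" "disjnt (topspace X - U) (X closure_of N)"
    unfolding normal_space using assms(1) by blast
  moreover from this have "X closure_of N \<subseteq> U"
    using closure_of_subset_topspace[of X N] by (auto simp: disjnt_def)
  ultimately show thesis using that by blast
qed

text \<open>A point has a neighbourhood \<open>N\<close> whose closure is compact and still mapped
  into \<open>U\<close>; this closure defines a subbasic set of the compact-open topology.\<close>

lemma evaluation_continuous:
  "continuous_map (prod_topology (homeo_topology X) X) X (\<lambda>(g, x). g x)"
  unfolding continuous_map
proof (intro conjI allI impI)
  show "(\<lambda>(g, x). g x) ` topspace (prod_topology (homeo_topology X) X) \<subseteq> topspace X"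
    using homeo_groupD(4) by (auto simp: topspace_homeo_topology)
  fix U assume U: "openin X U"
  show "openin (prod_topology (homeo_topology X) X)
     {p \<in> topspace (prod_topology (homeo_topology X) X). (case p of (g, x) \<Rightarrow> g x) \<in> U}" (is "openin _ ?W")
  proof (subst openin_subopen, intro ballI)
    fix p assume p: "p \<in> ?W"
    obtain g x where [simp]: "p = (g, x)" by (cases p)
    have g: "g \<in> carrier (homeo_group X)" and x: "x \<in> topspace X" and gx: "g x \<in> U"
      using p by (auto simp: topspace_homeo_topology)
    have 1: "openin X {y \<in> topspace X. g y \<in> U}"
      using openin_continuous_map_preimage[OF homeo_groupD(1)[OF g] U] .
    have 2: "{x} \<subseteq> {y \<in> topspace X. g y \<in> U}" using x gx by simp
    have 3: "closedin X {x}" using x t1 by (simp add: t1_space_closedin_singleton)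
    obtain N where N: "openin X N" "x \<in> N" "X closure_of N \<subseteq> {y \<in> topspace X. g y \<in> U}"
      by (rule closure_shrink[OF 3 1 2], rule that) simp_all
    let ?N = "{f \<in> carrier (homeo_group X). f ` (X closure_of N) \<subseteq> U}"
    have "compactin X (X closure_of N)" by (simp add: compactin_iff_closedin)
    then have "openin (homeo_topology X) ?N"
      unfolding homeo_topology_def using U by (intro topology_generated_by_Basis) blast
    then have "openin (prod_topology (homeo_topology X) X) (?N \<times> N)"
      using N(1) by (simp add: openin_prod_Times_iff)
    moreover have "p \<in> ?N \<times> N" using g N by auto
    moreover have "?N \<times> N \<subseteq> ?W"
    proof
      fix q assume q: "q \<in> ?N \<times> N"
      then obtain f y where fy: "q = (f, y)" "f \<in> ?N" "y \<in> N" by blast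
      have "y \<in> topspace X" "y \<in> X closure_of N"
        using fy(3) openin_subset[OF N(1)] closure_of_subset[OF openin_subset[OF N(1)]] by blast+
      then show "q \<in> ?W" using fy by (auto simp: topspace_homeo_topology)
    qed
    ultimately show "\<exists>T. openin (prod_topology (homeo_topology X) X) T \<and> p \<in> T \<and> T \<subseteq> ?W" by blast
  qed
qed

text \<open>Continuity of evaluation is lifted twice by
  \<open>continuous_map_vietoris_image\<close>, first to compact sets and then to compact families
  of them; what remains is restriction to subspaces.\<close>

lemma chain_action_continuous:
  "continuous_map (prod_topology (subtopology (homeo_topology X) G) (connected_chains X)) (connected_chains X)
     (\<lambda>(g, c). chain_action X g c)"
proof -
  let ?T = "subtopology (homeo_topology X) G"
  have 0: "continuous_map (prod_topology ?T X) X (\<lambda>(g, x). g x)"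
    using continuous_map_from_subtopology[OF evaluation_continuous, of "G \<times> UNIV"]
    by (simp add: subtopology_Times)
  have 1: "continuous_map (prod_topology ?T (vietoris X)) (vietoris X) (\<lambda>(g, K). (\<lambda>x. g x) ` K)"
    using continuous_map_vietoris_image[OF 0] by simp
  let ?F = "\<lambda>(g, c). (\<lambda>K. (\<lambda>x. g x) ` K) ` c"
  have 3: "continuous_map (prod_topology ?T (vietoris (vietoris X))) (vietoris (vietoris X)) ?F"
    using continuous_map_vietoris_image[OF 1] by simp
  have "continuous_map (prod_topology ?T (connected_chains X)) (vietoris (vietoris X)) ?F"
    using continuous_map_from_subtopology[OF 3, of "topspace ?T \<times> topspace (connected_chains X)"]
    by (subst connected_chains_eq_subtopology) (simp only: prod_topology_subtopology(2))
  then have "continuous_map (prod_topology ?T (connected_chains X)) (vietoris (vietoris X)) (\<lambda>(g, c). chain_action X g c)"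
    by (rule continuous_map_eq) (auto simp: chain_action_apply)
  then show ?thesis
    apply (subst (2) connected_chains_eq_subtopology)
    apply (rule continuous_map_into_subtopology)
     apply (auto simp: topspace_homeo_topology chain_action_apply intro: chain_action_closed)
    done
qed

lemma group_action_chains:
  assumes G: "subgroup G (homeo_group X)"
  shows "group_action (homeo_group X \<lparr>carrier := G\<rparr>) (topspace (connected_chains X)) (chain_action X)"
proof -
  interpret H: group "homeo_group X" by (rule group_homeo)
  let ?C = "topspace (connected_chains X)"
  have GH: "g \<in> carrier (homeo_group X)" if "g \<in> G" for g
    using that G subgroup.subset by blast
  have comp: "chain_action X (g \<otimes>\<^bsub>homeo_group X\<^esub> h) = compose ?C (chain_action X g) (chain_action X h)"
    if "g \<in> carrier (homeo_group X)" "h \<in> carrier (homeo_group X)" for g h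
  proof
    fix c
    show "chain_action X (g \<otimes>\<^bsub>homeo_group X\<^esub> h) c = compose ?C (chain_action X g) (chain_action X h) c"
      using that chain_action_mult[OF that] chain_action_closed[OF that(2)]
      by (cases "c \<in> ?C") (simp_all add: chain_action_apply compose_def, simp add: chain_action_def)
  qed
  have one: "chain_action X \<one>\<^bsub>homeo_group X\<^esub> c = c" if c: "c \<in> ?C" for c
  proof -
    have "\<one>\<^bsub>homeo_group X\<^esub> = (\<lambda>x\<in>topspace X. x)" by (simp add: homeo_group_def BijGroup_def)
    then have "\<one>\<^bsub>homeo_group X\<^esub> ` K = K" if "K \<in> c" for K
      using chain_memberD(4)[OF c that] by (auto simp: image_iff)
    then have "(image \<one>\<^bsub>homeo_group X\<^esub>) ` c = c" by (simp add: image_cong[of c c _ id, simplified])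
    then show ?thesis using c by (simp add: chain_action_apply)
  qed
  have Bij: "chain_action X g \<in> Bij ?C" if g: "g \<in> carrier (homeo_group X)" for g
  proof -
    have inv: "inv\<^bsub>homeo_group X\<^esub> g \<in> carrier (homeo_group X)" using g by simp
    have "bij_betw (chain_action X g) ?C ?C"
    proof (rule bij_betw_byWitness[where f' = "chain_action X (inv\<^bsub>homeo_group X\<^esub> g)"])
      show "\<forall>c\<in>?C. chain_action X (inv\<^bsub>homeo_group X\<^esub> g) (chain_action X g c) = c"
        using comp[OF inv g] one g by (metis H.l_inv compose_eq)
      show "\<forall>c\<in>?C. chain_action X g (chain_action X (inv\<^bsub>homeo_group X\<^esub> g) c) = c"
        using comp[OF g inv] one g by (metis H.r_inv compose_eq)
    qed (use chain_action_closed[OF g] chain_action_closed[OF inv] in \<open>auto simp: chain_action_apply\<close>)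
    then show ?thesis by (simp add: Bij_def chain_action_def)
  qed
  have "group_hom (homeo_group X \<lparr>carrier := G\<rparr>) (BijGroup ?C) (chain_action X)"
  proof (intro group_hom.intro group_hom_axioms.intro homI)
    show "group (homeo_group X \<lparr>carrier := G\<rparr>)"
      by (rule subgroup.subgroup_is_group[OF G H.is_group])
    show "group (BijGroup ?C)" by (rule group_BijGroup)
  qed (use GH Bij comp in \<open>auto simp: BijGroup_def\<close>)
  then show ?thesis by (simp add: group_action_def)
qed

lemma flow_connected_chains:
  assumes "subgroup G (homeo_group X)"
  shows "flow (homeo_group X \<lparr>carrier := G\<rparr>) (subtopology (homeo_topology X) G) (connected_chains X) (chain_action X)"
  unfolding flow_def
  using compact_space_connected_chains Hausdorff_space_connected_chains group_action_chains[OF assms]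
    chain_action_continuous by blast

end

section \<open>Chains of nonseparating links\<close>

text \<open>The condition concerns every connected open \<open>U\<close>, not just the whole space:
  \<open>U - F\<close> is then again open and connected, so such sets can be removed one after the
  other.\<close>

definition nonseparating :: "'a topology \<Rightarrow> 'a set \<Rightarrow> bool" where
  "nonseparating X F \<longleftrightarrow> closedin X F \<and>
     (\<forall>U. openin X U \<and> connectedin X U \<and> U \<noteq> {} \<longrightarrow> connectedin X (U - F) \<and> U - F \<noteq> {})"

lemma nonseparating_empty: "nonseparating X {}"
  by (simp add: nonseparating_def)

lemma nonseparating_Un:
  assumes "nonseparating X F" "nonseparating X F'"
  shows "nonseparating X (F \<union> F')"
  unfolding nonseparating_def
proof (intro conjI allI impI)
  show "closedin X (F \<union> F')" using assms by (simp add: nonseparating_def closedin_Un)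
  fix U assume U: "openin X U \<and> connectedin X U \<and> U \<noteq> {}"
  then have "openin X (U - F) \<and> connectedin X (U - F) \<and> U - F \<noteq> {}"
    using assms(1) by (auto simp: nonseparating_def)
  then have "connectedin X (U - F - F') \<and> U - F - F' \<noteq> {}"
    using assms(2) unfolding nonseparating_def by blast
  then show "connectedin X (U - (F \<union> F'))" "U - (F \<union> F') \<noteq> {}" by (simp_all add: Diff_eq Int_assoc)
qed

lemma nonseparating_UN:
  "finite I \<Longrightarrow> (\<And>i. i \<in> I \<Longrightarrow> nonseparating X (F i)) \<Longrightarrow> nonseparating X (\<Union>i\<in>I. F i)"
  by (induction rule: finite_induct) (simp_all add: nonseparating_empty nonseparating_Un)

text \<open>The last axiom stands in for dimension at least 3. In the models \<open>S\<close> is the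
  image of a straight segment under the inverse of a chart.\<close>

locale tame_space = compact_Hausdorff +
  assumes connected: "connected_space X" and nonempty: "topspace X \<noteq> {}"
    and nonseparating_base: "\<And>U x. openin X U \<Longrightarrow> x \<in> U \<Longrightarrow> \<exists>N. openin X N \<and> x \<in> N \<and> N \<subseteq> U \<and>
      (\<forall>p\<in>N. \<forall>q\<in>N. \<exists>S. nonseparating X S \<and> connectedin X S \<and> p \<in> S \<and> q \<in> S \<and> S \<subseteq> N)"
begin

lemma connected_base:
  assumes "openin X U" "x \<in> U"
  obtains N where "openin X N" "connectedin X N" "x \<in> N" "N \<subseteq> U"
proof -
  obtain N where N': "openin X N" "x \<in> N" "N \<subseteq> U"
    "\<forall>p\<in>N. \<forall>q\<in>N. \<exists>S. nonseparating X S \<and> connectedin X S \<and> p \<in> S \<and> q \<in> S \<and> S \<subseteq> N"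
    using nonseparating_base[OF assms] by (elim exE conjE)
  have N4: "\<exists>S. connectedin X S \<and> x \<in> S \<and> q \<in> S \<and> S \<subseteq> N" if "q \<in> N" for q
    using N'(4)[rule_format, OF N'(2) that] by (elim exE conjE) (intro exI conjI)
  note N = N'(1-3) N4
  let ?\<S> = "{S. connectedin X S \<and> x \<in> S \<and> S \<subseteq> N}"
  have "connectedin X (\<Union>?\<S>)" using N(2,4) by (intro connectedin_Union) auto
  moreover have "\<Union>?\<S> = N" using N(4) by blast
  ultimately show thesis using that N by metis
qed

lemma open_diff_nonseparating:
  assumes "openin X U" "U \<noteq> {}" "nonseparating X F"
  shows "U - F \<noteq> {}"
proof -
  obtain x where "x \<in> U" using assms by blast
  then obtain N where "openin X N" "connectedin X N" "x \<in> N" "N \<subseteq> U" using connected_base assms(1) by metis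
  then have "N - F \<noteq> {}" using assms(3) unfolding nonseparating_def by blast
  then show ?thesis using \<open>N \<subseteq> U\<close> by blast
qed

text \<open>Nonempty open sets are never contained in \<open>F\<close>, so the connected set
  \<open>U - F\<close> is dense in \<open>U - F'\<close>, which is therefore connected too.\<close>

lemma nonseparating_subset:
  assumes F: "nonseparating X F" and "closedin X F'" "F' \<subseteq> F"
  shows "nonseparating X F'"
  unfolding nonseparating_def
proof (intro conjI allI impI)
  fix U assume U: "openin X U \<and> connectedin X U \<and> U \<noteq> {}"
  then have UF: "connectedin X (U - F)" "U - F \<noteq> {}" using F unfolding nonseparating_def by blast+
  then show "U - F' \<noteq> {}" using assms(3) by blast
  show "connectedin X (U - F')"
  proof (rule connectedin_intermediate_closure_of[OF UF(1)])
    show "U - F' \<subseteq> X closure_of (U - F)"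
    proof
      fix y assume y: "y \<in> U - F'"
      have "y \<in> topspace X" using y U openin_subset[of X U] by blast
      moreover have "\<exists>z. z \<in> U - F \<and> z \<in> T" if "y \<in> T" "openin X T" for T
        using open_diff_nonseparating[of "U \<inter> T" F] y U that F by blast
      ultimately show "y \<in> X closure_of (U - F)" by (auto simp: in_closure_of)
    qed
  qed (use assms(3) in blast)
qed (fact assms)

lemma nonseparating_singleton:
  assumes "x \<in> topspace X"
  shows "nonseparating X {x}"
proof -
  obtain S where "nonseparating X S" "x \<in> S"
    using nonseparating_base[OF openin_topspace assms] by blast
  moreover have "closedin X {x}" using assms t1 by (simp add: t1_space_closedin_singleton)
  ultimately show ?thesis using nonseparating_subset by auto
qed

lemma connected_nbhd:
  assumes J: "connectedin X J" "J \<noteq> {}" "J \<subseteq> V" and V: "openin X V"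
  obtains W where "openin X W" "connectedin X W" "J \<subseteq> W" "W \<subseteq> V"
proof -
  let ?\<S> = "{N. openin X N \<and> connectedin X N \<and> N \<inter> J \<noteq> {} \<and> N \<subseteq> V}"
  have cov: "J \<subseteq> \<Union>?\<S>"
  proof
    fix x assume x: "x \<in> J"
    then obtain N where "openin X N" "connectedin X N" "x \<in> N" "N \<subseteq> V"
      using connected_base[OF V] J(3) by (metis subsetD)
    then show "x \<in> \<Union>?\<S>" using x by blast
  qed
  have "connectedin X (\<Union>((\<union>) J ` ?\<S>))"
  proof (rule connectedin_Union)
    show "connectedin X S" if "S \<in> (\<union>) J ` ?\<S>" for S
      using that by (auto intro!: connectedin_Un[OF J(1)])
  qed (use J in auto)
  moreover have "\<Union>((\<union>) J ` ?\<S>) = \<Union>?\<S>" using cov J(2) by blast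
  ultimately have "connectedin X (\<Union>?\<S>)" by simp
  moreover have "openin X (\<Union>?\<S>)" by (rule openin_Union) simp
  ultimately show thesis using that cov by blast
qed

section \<open>Short chains of nonseparating pieces and their prolongation\<close>

definition small_pieces :: "'a set \<Rightarrow> 'a set set \<Rightarrow> 'a set set" where
  "small_pieces U \<A> = {S. nonseparating X S \<and> connectedin X S \<and>
     (\<exists>N. openin X N \<and> S \<subseteq> N \<and> N \<subseteq> U \<and> (\<exists>A\<in>\<A>. N \<subseteq> A))}"

text \<open>The points reachable through finitely many pieces and the unreachable ones both form
  open sets, so connectedness of \<open>U\<close> leaves one class. The open room \<open>N\<close>
  around a piece is recorded because it becomes the host of a link.\<close>

lemma linked_by_small_pieces:
  assumes U: "openin X U" "connectedin X U" and \<A>: "\<And>A. A \<in> \<A> \<Longrightarrow> openin X A" "U \<subseteq> \<Union>\<A>"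
    and xy: "x \<in> U" "y \<in> U"
  shows "(x, y) \<in> {(u, v). \<exists>S\<in>small_pieces U \<A>. u \<in> S \<and> v \<in> S}\<^sup>*"
proof -
  let ?r = "{(u, v). \<exists>S\<in>small_pieces U \<A>. u \<in> S \<and> v \<in> S}"
  have symr: "sym (?r\<^sup>*)" by (intro sym_rtrancl) (auto simp: sym_def)
  have loc: "\<exists>N. openin X N \<and> u \<in> N \<and> N \<subseteq> U \<and> (\<forall>p\<in>N. \<forall>q\<in>N. (p, q) \<in> ?r)" if u: "u \<in> U" for u
  proof -
    obtain A where A: "A \<in> \<A>" "u \<in> A" using \<A>(2) u by blast
    then have "openin X (U \<inter> A)" "u \<in> U \<inter> A" using U(1) \<A>(1) u by auto
    from nonseparating_base[OF this]
    obtain N where N: "openin X N" "u \<in> N" "N \<subseteq> U \<inter> A"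
      "\<forall>p\<in>N. \<forall>q\<in>N. \<exists>S. nonseparating X S \<and> connectedin X S \<and> p \<in> S \<and> q \<in> S \<and> S \<subseteq> N"
      by (elim exE conjE)
    have "(p, q) \<in> ?r" if pq: "p \<in> N" "q \<in> N" for p q
    proof -
      obtain S where "nonseparating X S" "connectedin X S" "p \<in> S" "q \<in> S" "S \<subseteq> N"
        using N(4)[rule_format, OF pq] by (elim exE conjE)
      then have "S \<in> small_pieces U \<A>" using N A unfolding small_pieces_def by blast
      then show ?thesis using \<open>p \<in> S\<close> \<open>q \<in> S\<close> by blast
    qed
    then show ?thesis using N by (intro exI[of _ N]) auto
  qed
  define P where "P = {z \<in> U. (x, z) \<in> ?r\<^sup>*}"
  have oP: "openin X P"
  proof (subst openin_subopen, intro ballI)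
    fix z assume z: "z \<in> P"
    then obtain N where N: "openin X N" "z \<in> N" "N \<subseteq> U" "\<forall>p\<in>N. \<forall>q\<in>N. (p, q) \<in> ?r"
      using loc[of z] by (auto simp only: P_def)
    then have "N \<subseteq> P" using z unfolding P_def by (auto intro: rtrancl_into_rtrancl)
    then show "\<exists>T. openin X T \<and> z \<in> T \<and> T \<subseteq> P" using N by blast
  qed
  have oQ: "openin X (U - P)"
  proof (subst openin_subopen, intro ballI)
    fix z assume z: "z \<in> U - P"
    then obtain N where N: "openin X N" "z \<in> N" "N \<subseteq> U" "\<forall>p\<in>N. \<forall>q\<in>N. (p, q) \<in> ?r"
      using loc[of z] by auto
    have "w \<notin> P" if w: "w \<in> N" for w
    proof
      assume "w \<in> P"
      then have "(x, w) \<in> ?r\<^sup>*" by (simp add: P_def)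
      moreover have "(w, z) \<in> ?r" using N w by blast
      ultimately have "(x, z) \<in> ?r\<^sup>*" by (rule rtrancl_into_rtrancl)
      then show False using z by (simp add: P_def)
    qed
    then have "N \<subseteq> U - P" using N by blast
    then show "\<exists>T. openin X T \<and> z \<in> T \<and> T \<subseteq> U - P" using N by blast
  qed
  have "x \<in> P" using xy by (simp add: P_def)
  have "U - P = {}"
  proof (rule ccontr)
    assume "U - P \<noteq> {}"
    then show False
      using connectedinD[OF U(2) oP oQ] \<open>x \<in> P\<close> xy by (auto simp: P_def)
  qed
  then show ?thesis using xy by (auto simp: P_def)
qed

text \<open>A chain of minimal length has no shortcuts, which makes nonconsecutive pieces disjoint
  and keeps \<open>x\<close> out of all pieces but the last.\<close>

lemma shortest_link:
  assumes y: "y \<in> S0" and "(y, x) \<in> {(u, v). \<exists>S\<in>E. u \<in> S \<and> v \<in> S}\<^sup>*"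
  obtains n and S :: "nat \<Rightarrow> 'a set"
  where "S 0 = S0" "\<And>i. 1 \<le> i \<Longrightarrow> i \<le> n \<Longrightarrow> S i \<in> E" "\<And>i. i < n \<Longrightarrow> S i \<inter> S (Suc i) \<noteq> {}"
    "x \<in> S n" "\<And>i. i < n \<Longrightarrow> x \<notin> S i" "\<And>i j. j \<le> n \<Longrightarrow> Suc i < j \<Longrightarrow> S i \<inter> S j = {}"
proof -
  define good where "good n S x \<longleftrightarrow> S 0 = S0 \<and> (\<forall>i. 1 \<le> i \<longrightarrow> i \<le> n \<longrightarrow> S i \<in> E) \<and>
    (\<forall>i<n. S i \<inter> S (Suc i) \<noteq> {}) \<and> x \<in> S n" for n and S :: "nat \<Rightarrow> 'a set" and x
  have "\<exists>n S. good n S x"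
    using assms(2)
  proof (induction rule: rtrancl_induct)
    case base
    then show ?case using y by (intro exI[of _ 0] exI[of _ "\<lambda>_. S0"]) (auto simp: good_def)
  next
    case (step u v)
    then obtain n S T where nS: "good n S u" and T: "T \<in> E" "u \<in> T" "v \<in> T" by blast
    have "good (Suc n) (S(Suc n := T)) v"
      using nS T unfolding good_def by (auto simp: less_Suc_eq le_Suc_eq)
    then show ?case by blast
  qed
  define n where "n = (LEAST n. \<exists>S. good n S x)"
  then obtain S where S: "good n S x" using LeastI_ex[of "\<lambda>n. \<exists>S. good n S x"] \<open>\<exists>n S. good n S x\<close> by blast
  have min: "n \<le> k" if "good k T x" for k T
    using that unfolding n_def by (intro Least_le) blast
  show thesis
  proof (rule that[of S n])
    fix i assume "i < n"
    show "x \<notin> S i"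
    proof
      assume "x \<in> S i"
      then have "good i S x" using S \<open>i < n\<close> by (auto simp: good_def)
      then show False using min \<open>i < n\<close> by fastforce
    qed
  next
    fix i j assume ij: "j \<le> n" "Suc i < j"
    show "S i \<inter> S j = {}"
    proof (rule ccontr)
      assume ne: "S i \<inter> S j \<noteq> {}"
      \<comment> \<open>If pieces \<open>i\<close> and \<open>j\<close> meet, the \<open>d\<close>
        pieces strictly between them can be cut out: \<open>T\<close> agrees with \<open>S\<close>
        up to \<open>i\<close> and continues with \<open>S j\<close>.\<close>
      define d where "d = j - Suc i"
      define T where "T k = (if k \<le> i then S k else S (k + d))" for k
      have "good (n - d) T x"
        unfolding good_def
      proof (intro conjI allI impI)
        show "T 0 = S0" using S by (simp add: T_def good_def)
        show "T k \<in> E" if "1 \<le> k" "k \<le> n - d" for k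
          using S that ij by (auto simp: T_def good_def d_def)
        show "T k \<inter> T (Suc k) \<noteq> {}" if "k < n - d" for k
        proof -
          consider "k < i" | "k = i" | "i < k" by linarith
          then show ?thesis
          proof cases
            case 2
            then have "T k = S i" "T (Suc k) = S j" using ij by (auto simp: T_def d_def)
            then show ?thesis using ne by simp
          qed (use S that ij in \<open>auto simp: T_def good_def d_def\<close>)
        qed
        have "n - d + d = n" "i < n - d" using ij by (auto simp: d_def)
        then show "x \<in> T (n - d)" using S by (simp add: T_def good_def)
      qed
      then show False using min[of "n - d" T] ij by (auto simp: d_def)
    qed
  qed (use S in \<open>auto simp: good_def\<close>)
qed

text \<open>The last clause ensures that the last link can be left without meeting the earlier ones.\<close>

definition links :: "nat \<Rightarrow> (nat \<Rightarrow> 'a set) \<Rightarrow> bool" where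
  "links m J \<longleftrightarrow> (\<forall>i\<le>m. nonseparating X (J i) \<and> connectedin X (J i) \<and> J i \<noteq> {}) \<and>
     (\<forall>i<m. J i \<inter> J (Suc i) \<noteq> {}) \<and> (\<forall>i j. j \<le> m \<and> Suc i < j \<longrightarrow> J i \<inter> J j = {}) \<and>
     (\<forall>i. m = Suc i \<longrightarrow> \<not> J m \<subseteq> J i)"

text \<open>\<open>H i\<close> is a neighbourhood of the link \<open>J i\<close> in which tubes around the links are later confined.\<close>

definition hosted :: "'a set set \<Rightarrow> nat \<Rightarrow> (nat \<Rightarrow> 'a set) \<Rightarrow> (nat \<Rightarrow> 'a set) \<Rightarrow> bool" where
  "hosted \<A> m J H \<longleftrightarrow> links m J \<and> (\<forall>i\<le>m. openin X (H i) \<and> J i \<subseteq> H i \<and> (\<exists>A\<in>\<A>. H i \<subseteq> A))"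

definition extends :: "nat \<Rightarrow> (nat \<Rightarrow> 'a set) \<Rightarrow> (nat \<Rightarrow> 'a set) \<Rightarrow> nat \<Rightarrow> (nat \<Rightarrow> 'a set) \<Rightarrow> (nat \<Rightarrow> 'a set) \<Rightarrow> bool" where
  "extends m J H n J' H' \<longleftrightarrow> m \<le> n \<and> (\<forall>i\<le>m. J' i = J i \<and> H' i = H i)"

lemma extends_trans:
  "extends m J H n J' H' \<Longrightarrow> extends n J' H' p J'' H'' \<Longrightarrow> extends m J H p J'' H''"
  unfolding extends_def by auto

text \<open>Removing the earlier links from \<open>U\<close> leaves a connected open set, in which
  the last link is joined to a point \<open>x\<close> of \<open>G\<close> by a shortest chain of
  small pieces. New pieces are disjoint from the earlier links by the removal, and from
  nonconsecutive new ones by shortness.\<close>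

lemma hosted_extend:
  assumes h: "hosted \<A> m J H" and \<A>: "\<And>A. A \<in> \<A> \<Longrightarrow> openin X A" "topspace X \<subseteq> \<Union>\<A>"
    and U: "openin X U" "connectedin X U" "J m \<subseteq> U" and G: "openin X G" "G \<inter> U \<noteq> {}"
  obtains n J' H' where "m < n" "hosted \<A> n J' H'" "extends m J H n J' H'"
    "\<And>i. m < i \<Longrightarrow> i \<le> n \<Longrightarrow> H' i \<subseteq> U" "H' n \<subseteq> G"
proof -
  have L: "links m J" using h by (simp add: hosted_def)
  define F where "F = (\<Union>i\<in>{..<m}. J i)"
  have F: "nonseparating X F" using L unfolding F_def by (intro nonseparating_UN) (auto simp: links_def)
  have Jm: "nonseparating X (J m)" using L by (simp add: links_def)
  define U' where "U' = U - F"
  have U': "openin X U'" "connectedin X U'" "U' \<subseteq> U"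
    using U G F unfolding U'_def nonseparating_def by auto
  have "G \<inter> U - (F \<union> J m) \<noteq> {}"
    using G U by (intro open_diff_nonseparating nonseparating_Un F Jm) auto
  then obtain x where x: "x \<in> G" "x \<in> U'" "x \<notin> J m" by (auto simp: U'_def)
  \<comment> \<open>The last clause of \<open>links\<close> provides a point of \<open>J m\<close>
    outside its predecessor; still earlier links are disjoint from \<open>J m\<close>.\<close>
  obtain y where y: "y \<in> J m" "y \<notin> F"
  proof (cases m)
    case 0
    then show ?thesis using L that by (auto simp: links_def F_def)
  next
    case (Suc k)
    then obtain y where y: "y \<in> J m" "y \<notin> J k" using L unfolding links_def by blast
    have "y \<notin> J i" if "i < m" for i
    proof (cases "i = k")
      case False
      then have "J i \<inter> J m = {}" using L that Suc by (auto simp: links_def)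
      then show ?thesis using y by blast
    qed (use y in simp)
    then show ?thesis using that y by (auto simp: F_def)
  qed
  have yU: "y \<in> U'" using y U by (auto simp: U'_def)
  \<comment> \<open>Each member of this cover lies in \<open>G\<close> or omits \<open>x\<close>.
    The final piece contains \<open>x\<close>, so its host lies in \<open>G\<close>.\<close>
  define \<B> where "\<B> = (\<lambda>A. A \<inter> G) ` \<A> \<union> (\<lambda>A. A - {x}) ` \<A>"
  have xX: "x \<in> topspace X" using x(2) openin_subset[OF U'(1)] by blast
  then have cx: "closedin X {x}" using t1 by (simp add: t1_space_closedin_singleton)
  have oB: "openin X B" if "B \<in> \<B>" for B
    using that \<A>(1) G(1) cx by (auto simp: \<B>_def)
  have "U' \<subseteq> \<Union>\<A>" using openin_subset[OF U'(1)] \<A>(2) by blast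
  have cB: "U' \<subseteq> \<Union>\<B>"
  proof
    fix u assume "u \<in> U'"
    then obtain A where A: "A \<in> \<A>" "u \<in> A" using \<open>U' \<subseteq> \<Union>\<A>\<close> by blast
    have "A \<inter> G \<in> \<B>" "A - {x} \<in> \<B>" using A(1) by (auto simp: \<B>_def)
    moreover have "u \<in> A \<inter> G \<or> u \<in> A - {x}" using A(2) x(1) by blast
    ultimately show "u \<in> \<Union>\<B>" by (meson UnionI)
  qed
  \<comment> \<open>The whole link \<open>J m\<close> is piece \<open>0\<close> of the chain, so the
    new pieces after the first are disjoint from \<open>J m\<close> as well.\<close>
  obtain n S where S: "S 0 = J m" "\<And>i. 1 \<le> i \<Longrightarrow> i \<le> n \<Longrightarrow> S i \<in> small_pieces U' \<B>"
    "\<And>i. i < n \<Longrightarrow> S i \<inter> S (Suc i) \<noteq> {}" "x \<in> S n" "\<And>i. i < n \<Longrightarrow> x \<notin> S i"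
    "\<And>i j. j \<le> n \<Longrightarrow> Suc i < j \<Longrightarrow> S i \<inter> S j = {}"
    using shortest_link[OF y(1) linked_by_small_pieces[OF U'(1,2) oB cB yU x(2)]] by metis
  have n: "1 \<le> n" using S x(3) by (cases n) auto
  have "\<exists>N. openin X N \<and> S i \<subseteq> N \<and> N \<subseteq> U' \<and> (\<exists>B\<in>\<B>. N \<subseteq> B)" if "1 \<le> i" "i \<le> n" for i
    using S(2)[OF that] by (simp add: small_pieces_def)
  then obtain N where N: "\<And>i. 1 \<le> i \<Longrightarrow> i \<le> n \<Longrightarrow> openin X (N i) \<and> S i \<subseteq> N i \<and> N i \<subseteq> U' \<and> (\<exists>B\<in>\<B>. N i \<subseteq> B)"
    by metis
  have SE: "nonseparating X (S i)" "connectedin X (S i)" "S i \<subseteq> U'" if "1 \<le> i" "i \<le> n" for i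
    using S(2)[OF that] by (auto simp: small_pieces_def)
  define J' where "J' i = (if i \<le> m then J i else S (i - m))" for i
  define H' where "H' i = (if i \<le> m then H i else N (i - m))" for i
  have J'S: "J' i = S (i - m)" if "m \<le> i" for i using that S(1) by (auto simp: J'_def)
  have neS: "S i \<noteq> {}" if "1 \<le> i" "i \<le> n" for i
    using S(3)[of i] S(4) that by (cases "i = n") auto
  have "links (m + n) J'"
    unfolding links_def
  proof (intro conjI allI impI)
    fix i assume i: "i \<le> m + n"
    have "nonseparating X (J' i) \<and> connectedin X (J' i) \<and> J' i \<noteq> {}"
      using L SE[of "i - m"] neS[of "i - m"] i by (cases "i \<le> m") (auto simp: J'_def links_def)
    then show "nonseparating X (J' i)" "connectedin X (J' i)" "J' i \<noteq> {}" by auto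
  next
    fix i assume i: "i < m + n"
    show "J' i \<inter> J' (Suc i) \<noteq> {}"
    proof (cases "i < m")
      case True then show ?thesis using L by (auto simp: J'_def links_def)
    next
      case False
      then show ?thesis using S(3)[of "i - m"] i by (simp add: J'S Suc_diff_le)
    qed
  next
    fix i j assume ij: "j \<le> m + n \<and> Suc i < j"
    consider "j \<le> m" | "i < m" "m < j" | "m \<le> i" by linarith
    then show "J' i \<inter> J' j = {}"
    proof cases
      case 1 then show ?thesis using L ij by (auto simp: J'_def links_def)
    next
      case 2
      then have "J' j \<subseteq> U'" "J' i = J i" using SE(3)[of "j - m"] ij by (auto simp: J'_def)
      then show ?thesis using 2 by (auto simp: U'_def F_def)
    next
      case 3
      then have "j - m \<le> n" "Suc (i - m) < j - m" using ij by arith+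
      then show ?thesis using S(6) 3 ij by (simp add: J'S)
    qed
  next
    \<comment> \<open>Minimality puts \<open>x\<close> into the last link only, which renews the
      last clause of \<open>links\<close>.\<close>
    fix i assume i: "m + n = Suc i"
    then have "m \<le> i" "i - m < n" using n by auto
    then have "x \<notin> J' i" using S(5) by (simp add: J'S)
    moreover have "x \<in> J' (m + n)" using S(4) by (simp add: J'S)
    ultimately show "\<not> J' (m + n) \<subseteq> J' i" by blast
  qed
  moreover have "openin X (H' i) \<and> J' i \<subseteq> H' i \<and> (\<exists>A\<in>\<A>. H' i \<subseteq> A)" if i: "i \<le> m + n" for i
  proof (cases "i \<le> m")
    case True then show ?thesis using h by (simp add: hosted_def J'_def H'_def)
  next
    case False
    then have im: "1 \<le> i - m" "i - m \<le> n" using i by auto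
    obtain B where "B \<in> \<B>" "N (i - m) \<subseteq> B" using N[OF im] by blast
    then have "\<exists>A\<in>\<A>. N (i - m) \<subseteq> A" by (auto simp: \<B>_def)
    then show ?thesis using N[OF im] False by (simp add: J'_def H'_def)
  qed
  ultimately have h': "hosted \<A> (m + n) J' H'" by (simp add: hosted_def)
  show thesis
  proof (rule that[OF _ h'])
    show "m < m + n" using n by simp
    show "extends m J H (m + n) J' H'" by (auto simp: extends_def J'_def H'_def)
    show "H' i \<subseteq> U" if "m < i" "i \<le> m + n" for i
    proof -
      have "1 \<le> i - m" "i - m \<le> n" using that by auto
      then show ?thesis using N U'(3) that by (simp add: H'_def) blast
    qed
    obtain B where B: "B \<in> \<B>" "N n \<subseteq> B" using N[of n] n by blast
    moreover have "x \<in> N n" using N[of n] n S(4) by blast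
    ultimately have "N n \<subseteq> G" by (auto simp: \<B>_def)
    then show "H' (m + n) \<subseteq> G" using n by (simp add: H'_def)
  qed
qed

text \<open>A whole host, not only a link, ends up in each \<open>G\<close>. Every chain following
  the new links then has a member that meets all \<open>G\<close>, as the meeting conditions of a
  Vietoris box require.\<close>

lemma hosted_extend_finite:
  assumes fin: "finite \<G>" and h: "hosted \<A> m J H"
    and \<A>: "\<And>A. A \<in> \<A> \<Longrightarrow> openin X A" "topspace X \<subseteq> \<Union>\<A>"
    and U: "openin X U" "connectedin X U" "J m \<subseteq> U"
    and G: "\<And>G. G \<in> \<G> \<Longrightarrow> openin X G" "\<And>G. G \<in> \<G> \<Longrightarrow> G \<inter> U \<noteq> {}"
  shows "\<exists>n J' H'. hosted \<A> n J' H' \<and> extends m J H n J' H' \<and>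
    (\<forall>i. m < i \<and> i \<le> n \<longrightarrow> H' i \<subseteq> U) \<and> (\<forall>G\<in>\<G>. \<exists>i\<le>n. H' i \<subseteq> G)"
  using fin G
proof (induction rule: finite_induct)
  case empty
  show ?case using h by (intro exI[of _ m] exI[of _ J] exI[of _ H]) (auto simp: extends_def)
next
  case (insert G \<G>)
  then obtain n J' H' where n: "hosted \<A> n J' H'" "extends m J H n J' H'"
    "\<And>i. m < i \<Longrightarrow> i \<le> n \<Longrightarrow> H' i \<subseteq> U" "\<And>G. G \<in> \<G> \<Longrightarrow> \<exists>i\<le>n. H' i \<subseteq> G"
    by (metis insertCI)
  have "m \<le> n" "J' n \<subseteq> H' n" "J' m = J m" using n(1,2) by (auto simp: extends_def hosted_def)
  then have "J' n \<subseteq> U"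
    using n(3)[of n] U(3) by (cases "n = m") auto
  then obtain p J'' H'' where p: "n < p" "hosted \<A> p J'' H''" "extends n J' H' p J'' H''"
    "\<And>i. n < i \<Longrightarrow> i \<le> p \<Longrightarrow> H'' i \<subseteq> U" "H'' p \<subseteq> G"
    using hosted_extend[OF n(1) \<A> U(1,2) _ insert.prems(1)[of G] insert.prems(2)[of G]] by blast
  have "H'' i \<subseteq> U" if "m < i" "i \<le> p" for i
    using n(3)[of i] p(3,4) that by (cases "i \<le> n") (auto simp: extends_def)
  moreover have "\<exists>i\<le>p. H'' i \<subseteq> G'" if G': "G' \<in> \<G>" for G'
  proof -
    obtain i where "i \<le> n" "H' i \<subseteq> G'" using n(4)[OF G'] by blast
    then show ?thesis using p(1,3) by (intro exI[of _ i]) (auto simp: extends_def)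
  qed
  ultimately show ?case using p extends_trans[OF n(2) p(3)]
    by (intro exI[of _ p] exI[of _ J''] exI[of _ H'']) auto
qed

section \<open>Tubes and the chains that follow them\<close>

definition tube :: "nat \<Rightarrow> (nat \<Rightarrow> 'a set) \<Rightarrow> bool" where
  "tube m W \<longleftrightarrow> (\<forall>i\<le>m. openin X (W i) \<and> connectedin X (W i) \<and> W i \<noteq> {}) \<and>
     (\<forall>i<m. W i \<inter> W (Suc i) \<noteq> {}) \<and> (\<forall>i j. j \<le> m \<and> Suc i < j \<longrightarrow> W i \<inter> W j = {})"

text \<open>All initial stretches \<open>k\<close> are included, so that a chain following prolonged
  links also follows the original ones.\<close>

definition follows :: "nat \<Rightarrow> (nat \<Rightarrow> 'a set) \<Rightarrow> 'a set set \<Rightarrow> bool" where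
  "follows m H c \<longleftrightarrow> (\<forall>k\<le>m. \<exists>L\<in>c. L \<subseteq> (\<Union>i\<le>k. H i) \<and> (\<forall>i\<le>k. L \<inter> H i \<noteq> {}))"

text \<open>Only two members are constrained, both by open conditions, so the set is open; the
  behaviour in between is forced by connectedness, see \<open>tube_chains_follow\<close>.\<close>

definition tube_chains :: "nat \<Rightarrow> (nat \<Rightarrow> 'a set) \<Rightarrow> 'a set set set" where
  "tube_chains m W = {c \<in> topspace (connected_chains X).
     (\<exists>L\<in>c. L \<subseteq> W 0) \<and> (\<exists>L\<in>c. L \<subseteq> (\<Union>i\<le>m. W i) \<and> L \<inter> W m \<noteq> {})}"

lemma tube_disjoint:
  assumes "tube m W" "i \<le> m" "j \<le> m" "W i \<inter> W j \<noteq> {}"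
  shows "i \<le> Suc j" "j \<le> Suc i"
  using assms unfolding tube_def by (metis Int_commute leI)+

text \<open>Nonconsecutive links are disjoint compact sets and have disjoint neighbourhoods. Each
  link occurs in finitely many such pairs, so an open \<open>V i\<close> inside its host remains,
  and in it a connected neighbourhood.\<close>

lemma hosted_tube:
  assumes h: "hosted \<A> m J H"
  obtains W where "tube m W" "\<And>i. i \<le> m \<Longrightarrow> J i \<subseteq> W i" "\<And>i. i \<le> m \<Longrightarrow> W i \<subseteq> H i"
proof -
  have L: "links m J" and H: "\<And>i. i \<le> m \<Longrightarrow> openin X (H i) \<and> J i \<subseteq> H i" using h by (auto simp: hosted_def)
  have JD: "closedin X (J i)" "connectedin X (J i)" "J i \<noteq> {}" if "i \<le> m" for i
    using L that by (auto simp: links_def nonseparating_def)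
  define p where "p i j = (SOME p. openin X (fst p) \<and> openin X (snd p) \<and> J i \<subseteq> fst p \<and> J j \<subseteq> snd p \<and>
    fst p \<inter> snd p = {})" for i j
  have ex: "\<exists>p. openin X (fst p) \<and> openin X (snd p) \<and> J i \<subseteq> fst p \<and> J j \<subseteq> snd p \<and> fst p \<inter> snd p = {}"
    if ij: "j \<le> m" "Suc i < j" for i j
  proof -
    have "compactin X (J i)" "compactin X (J j)" "disjnt (J i) (J j)"
      using JD[of i] JD[of j] ij L by (auto simp: compactin_iff_closedin links_def disjnt_def)
    then obtain P Q where "openin X P" "openin X Q" "J i \<subseteq> P" "J j \<subseteq> Q" "disjnt P Q"
      using Hausdorff_space_compact_separation[OF Hausdorff] by metis
    then show ?thesis by (intro exI[of _ "(P, Q)"]) (simp add: disjnt_def)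
  qed
  have p: "openin X (fst (p i j)) \<and> openin X (snd (p i j)) \<and>
      J i \<subseteq> fst (p i j) \<and> J j \<subseteq> snd (p i j) \<and> fst (p i j) \<inter> snd (p i j) = {}"
    if "j \<le> m" "Suc i < j" for i j
    unfolding p_def by (rule someI_ex[OF ex[OF that]])
  define P Q where "P i j = fst (p i j)" and "Q i j = snd (p i j)" for i j
  note PQ = p[folded P_def Q_def]
  define V where "V i = \<Inter>(insert (H i) ((\<lambda>j. P i j) ` {j. j \<le> m \<and> Suc i < j} \<union> (\<lambda>k. Q k i) ` {k. Suc k < i}))" for i
  have V: "openin X (V i)" "J i \<subseteq> V i" "V i \<subseteq> H i" if i: "i \<le> m" for i
  proof -
    have fin: "finite {k. Suc k < i}" by (rule finite_subset[of _ "{..i}"]) auto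
    have fin': "finite {j. j \<le> m \<and> Suc i < j}" by simp
    show "openin X (V i)"
      unfolding V_def
    proof (rule openin_Inter)
      fix S assume "S \<in> insert (H i) ((\<lambda>j. P i j) ` {j. j \<le> m \<and> Suc i < j} \<union> (\<lambda>k. Q k i) ` {k. Suc k < i})"
      then show "openin X S" using H[OF i] PQ i by auto
    qed (use fin fin' in auto)
    have "J i \<subseteq> Q k i" if "Suc k < i" for k using PQ[OF i that] by blast
    moreover have "J i \<subseteq> P i j" if "j \<le> m" "Suc i < j" for j using PQ[OF that] by blast
    ultimately show "J i \<subseteq> V i" using H[OF i] unfolding V_def by (intro Inter_greatest) auto
    show "V i \<subseteq> H i" unfolding V_def by blast
  qed
  have Vd: "V i \<inter> V j = {}" if ij: "j \<le> m" "Suc i < j" for i j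
  proof -
    have "V i \<subseteq> P i j" unfolding V_def using ij by (intro Inter_lower) auto
    moreover have "V j \<subseteq> Q i j" unfolding V_def using ij by (intro Inter_lower) auto
    ultimately show ?thesis using PQ[OF ij] by blast
  qed
  have "\<exists>W. openin X W \<and> connectedin X W \<and> J i \<subseteq> W \<and> W \<subseteq> V i" if i: "i \<le> m" for i
    using connected_nbhd[OF JD(2,3)[OF i] V(2,1)[OF i]] by metis
  then obtain W where W: "\<And>i. i \<le> m \<Longrightarrow> openin X (W i) \<and> connectedin X (W i) \<and> J i \<subseteq> W i \<and> W i \<subseteq> V i"
    by metis
  show thesis
  proof (rule that[of W])
    have "W i \<inter> W (Suc i) \<noteq> {}" if "i < m" for i
    proof -
      have "J i \<inter> J (Suc i) \<noteq> {}" using L that by (simp add: links_def)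
      then show ?thesis using W[of i] W[of "Suc i"] that by (meson Suc_leI disjoint_iff less_imp_le subsetD)
    qed
    moreover have "W i \<inter> W j = {}" if "j \<le> m" "Suc i < j" for i j
      using Vd[OF that] W[of i] W[of j] that by auto
    moreover have "W i \<noteq> {}" if "i \<le> m" for i using W[OF that] JD(3)[OF that] by blast
    ultimately show "tube m W" using W by (simp add: tube_def)
    show "J i \<subseteq> W i" "W i \<subseteq> H i" if "i \<le> m" for i using W[OF that] V(3)[OF that] by blast+
  qed
qed

lemma openin_tube_chains:
  assumes "tube m W"
  shows "openin (connected_chains X) (tube_chains m W)"
proof -
  let ?V = "vietoris X" and ?U = "\<Union>i\<le>m. W i"
  have W: "openin X (W i)" if "i \<le> m" for i using assms that by (simp add: tube_def)
  have U: "openin X ?U" using W by (intro openin_Union) auto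
  let ?A = "vietoris_box X (W 0) {}" and ?B = "vietoris_box X ?U {W m}"
  have A: "openin ?V ?A" by (intro openin_vietoris_box W) auto
  have B: "openin ?V ?B" by (intro openin_vietoris_box U) (auto intro: W)
  have "openin (vietoris ?V) (vietoris_box ?V (topspace ?V) {?A, ?B})"
    using A B by (intro openin_vietoris_box) auto
  moreover have "tube_chains m W = vietoris_box ?V (topspace ?V) {?A, ?B} \<inter> topspace (connected_chains X)"
  proof (rule Set.set_eqI)
    fix c
    show "c \<in> tube_chains m W \<longleftrightarrow> c \<in> vietoris_box ?V (topspace ?V) {?A, ?B} \<inter> topspace (connected_chains X)"
    proof (cases "c \<in> topspace (connected_chains X)")
      case True
      note m = chain_memberD[OF True]
      have "compactin ?V c" "c \<noteq> {}" using True by (auto simp: connected_chains_iff)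
      moreover have "c \<subseteq> topspace ?V" using m(5) by blast
      moreover have "c \<inter> ?A \<noteq> {} \<longleftrightarrow> (\<exists>L\<in>c. L \<subseteq> W 0)"
        using m(1,3) by (auto simp: vietoris_box_def)
      moreover have "c \<inter> ?B \<noteq> {} \<longleftrightarrow> (\<exists>L\<in>c. L \<subseteq> ?U \<and> L \<inter> W m \<noteq> {})"
        using m(1,3) by (auto simp: vietoris_box_def)
      ultimately show ?thesis
        using True unfolding tube_chains_def vietoris_box_def[of ?V] by simp
    qed (simp add: tube_chains_def)
  qed
  ultimately show ?thesis
    by (subst connected_chains_eq_subtopology) (auto simp: openin_subtopology)
qed

text \<open>A connected set avoiding \<open>W j\<close> would be split by the part of the tube
  before \<open>j\<close> and the part after it, which are disjoint.\<close>

lemma connected_meets_tube: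
  assumes t: "tube m W" and k: "k \<le> m" and L: "connectedin X L" "L \<subseteq> (\<Union>i\<le>k. W i)" "L \<inter> W 0 \<noteq> {}" "L \<inter> W k \<noteq> {}"
    and j: "j \<le> k"
  shows "L \<inter> W j \<noteq> {}"
proof
  assume no: "L \<inter> W j = {}"
  have jk: "0 < j" "j < k" using no L j by (metis gr0I, metis le_neq_implies_less)
  have W: "openin X (W i)" if "i \<le> k" for i using t k that by (simp add: tube_def)
  let ?A = "\<Union>i\<in>{..<j}. W i" and ?B = "\<Union>i\<in>{j<..k}. W i"
  show False
  proof (rule connectedinD[OF L(1)])
    show "openin X ?A" "openin X ?B" using W jk by (auto intro!: openin_Union)
    show "L \<subseteq> ?A \<union> ?B"
    proof
      fix x assume x: "x \<in> L"
      then obtain i where i: "i \<le> k" "x \<in> W i" using L(2) by blast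
      then have "i \<noteq> j" using no x by blast
      then show "x \<in> ?A \<union> ?B" using i by (cases "i < j") auto
    qed
    have "?A \<inter> ?B = {}"
    proof -
      have "W a \<inter> W b = {}" if "a < j" "j < b" "b \<le> k" for a b using t that k by (simp add: tube_def)
      then show ?thesis by (simp add: Int_UN_distrib2)
    qed
    then show "?A \<inter> ?B \<inter> L = {}" by simp
    have "W 0 \<subseteq> ?A" "W k \<subseteq> ?B" using jk by (auto intro!: UN_upper)
    then show "?A \<inter> L \<noteq> {}" "?B \<inter> L \<noteq> {}" using L by blast+
  qed
qed

text \<open>While the chain grows from inside \<open>W 0\<close> until it reaches
  \<open>W m\<close>, some member lies in the part up to \<open>k\<close> and meets the part from
  \<open>k\<close> on, by \<open>chain_connected_split\<close>.\<close>

lemma tube_chains_follow: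
  assumes t: "tube m W" and c: "c \<in> tube_chains m W"
  shows "follows m W c"
  unfolding follows_def
proof (intro allI impI)
  fix k assume k: "k \<le> m"
  have cC: "c \<in> topspace (connected_chains X)" using c by (simp add: tube_chains_def)
  obtain L0 M where L0: "L0 \<in> c" "L0 \<subseteq> W 0" and M: "M \<in> c" "M \<subseteq> (\<Union>i\<le>m. W i)" "M \<inter> W m \<noteq> {}"
    using c by (auto simp: tube_chains_def)
  have W: "openin X (W i)" if "i \<le> m" for i using t that by (simp add: tube_def)
  let ?P = "\<Union>i\<in>{..k}. W i" and ?Q = "\<Union>i\<in>{k..m}. W i"
  have "\<exists>L\<in>c. L \<subseteq> ?P \<and> L \<inter> ?Q \<noteq> {}"
  proof (rule chain_connected_split[OF cC _ _ _ L0(1) _ M(1)])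
    show "openin X ?P" "openin X ?Q" using W k by (auto intro!: openin_Union)
    show "L0 \<subseteq> ?P" using L0(2) by auto
    have WmQ: "W m \<subseteq> ?Q" using k by (intro UN_upper) simp
    then show MQ: "M \<inter> ?Q \<noteq> {}" using M(3) by blast
    fix L assume L: "L \<in> c"
    have "L \<inter> ?Q \<noteq> {}" if "L \<subseteq> M" "\<not> L \<subseteq> ?P"
    proof -
      obtain x where x: "x \<in> L" "x \<notin> ?P" using \<open>\<not> L \<subseteq> ?P\<close> by blast
      then obtain i where "i \<le> m" "x \<in> W i" using M(2) \<open>L \<subseteq> M\<close> by blast
      then show ?thesis using x by (intro notI) (force simp: not_le)
    qed
    then show "L \<subseteq> ?P \<or> L \<inter> ?Q \<noteq> {}"
      using chain_comparable[OF cC L M(1)] MQ by blast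
  qed
  then obtain L where L: "L \<in> c" "L \<subseteq> ?P" "L \<inter> ?Q \<noteq> {}" by blast
  have Lk: "L \<inter> W k \<noteq> {}"
  proof -
    \<comment> \<open>The point \<open>y\<close> lies in \<open>W i\<close> with
      \<open>k \<le> i\<close> and in \<open>W l\<close> with \<open>l \<le> k\<close>. Indices of
      overlapping parts differ by at most one, so one of the two is \<open>k\<close>.\<close>
    obtain y i where yi: "y \<in> L" "y \<in> W i" "k \<le> i" "i \<le> m" using L(3) by auto
    moreover obtain l where "l \<le> k" "y \<in> W l" using L(2) yi(1) by auto
    ultimately have y: "y \<in> L" "y \<in> W i" "k \<le> i" "i \<le> m" "l \<le> k" "y \<in> W l" by blast+
    have "l \<le> m" "W i \<inter> W l \<noteq> {}" using y k by auto
    then have "i \<le> Suc l" using tube_disjoint(1)[OF t y(4)] by blast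
    then have "i = k \<or> l = k" using y by linarith
    then show ?thesis using y by blast
  qed
  have "L \<inter> W 0 \<noteq> {}"
    using chain_comparable[OF cC L(1) L0(1)] L0(2) chain_memberD(3)[OF cC L(1)] chain_memberD(3)[OF cC L0(1)]
    by blast
  then have "\<forall>i\<le>k. L \<inter> W i \<noteq> {}"
    using connected_meets_tube[OF t k chain_member_connected[OF cC L(1)] L(2) _ Lk] by blast
  then show "\<exists>L\<in>c. L \<subseteq> (\<Union>i\<le>k. W i) \<and> (\<forall>i\<le>k. L \<inter> W i \<noteq> {})" using L by blast
qed

lemma follows_mono:
  assumes "follows m W c" "\<And>i. i \<le> m \<Longrightarrow> W i \<subseteq> H i"
  shows "follows m H c"
  unfolding follows_def
proof (intro allI impI)
  fix k assume k: "k \<le> m"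
  then obtain L where L: "L \<in> c" "L \<subseteq> (\<Union>i\<le>k. W i)" "\<forall>i\<le>k. L \<inter> W i \<noteq> {}"
    using assms(1) by (auto simp: follows_def)
  have "W i \<subseteq> H i" if "i \<le> k" for i using assms(2) that k by simp
  then have "L \<subseteq> (\<Union>i\<le>k. H i)" "\<forall>i\<le>k. L \<inter> H i \<noteq> {}" using L(2,3) by fastforce+
  then show "\<exists>L\<in>c. L \<subseteq> (\<Union>i\<le>k. H i) \<and> (\<forall>i\<le>k. L \<inter> H i \<noteq> {})" using L(1) by blast
qed

lemma follows_extends:
  assumes "follows n H' c" "extends m J H n J' H'"
  shows "follows m H c"
  unfolding follows_def
proof (intro allI impI)
  fix k assume k: "k \<le> m"
  then have "k \<le> n" and H: "\<And>i. i \<le> k \<Longrightarrow> H' i = H i" using assms(2) by (auto simp: extends_def)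
  then obtain L where "L \<in> c" "L \<subseteq> (\<Union>i\<le>k. H' i)" "\<forall>i\<le>k. L \<inter> H' i \<noteq> {}"
    using assms(1) by (auto simp: follows_def)
  then show "\<exists>L\<in>c. L \<subseteq> (\<Union>i\<le>k. H i) \<and> (\<forall>i\<le>k. L \<inter> H i \<noteq> {})"
    using H by (intro bexI[of _ L]) auto
qed

lemma tube_chains_nonempty:
  assumes h: "hosted \<A> m J H" and t: "tube m W" and JW: "\<And>i. i \<le> m \<Longrightarrow> J i \<subseteq> W i"
  shows "tube_chains m W \<noteq> {}"
proof -
  have L: "links m J" using h by (simp add: hosted_def)
  have con: "k \<le> m \<Longrightarrow> connectedin X (\<Union>i\<le>k. J i)" for k
  proof (induction k)
    case 0 then show ?case using L by (simp add: links_def)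
  next
    case (Suc k)
    have "(\<Union>i\<le>k. J i) \<inter> J (Suc k) \<noteq> {}"
      using L Suc.prems unfolding links_def by (metis (no_types, lifting) IntI UN_I atMost_iff disjoint_iff less_eq_Suc_le order_refl)
    then show ?case
      using connectedin_Un[OF Suc.IH] L Suc.prems by (simp add: links_def atMost_Suc Un_commute)
  qed
  let ?J = "\<Union>i\<le>m. J i"
  have "closedin X ?J" using L by (intro closedin_Union) (auto simp: links_def nonseparating_def)
  moreover have "J 0 \<noteq> {}" using L by (simp add: links_def)
  then obtain x where x: "x \<in> J 0" by blast
  ultimately obtain c where c: "c \<in> topspace (connected_chains X)" "{x} \<in> c" "?J \<in> c"
    using order_arc_exists[OF connected, of ?J x] con[of m] by (auto simp: compactin_iff_closedin)
  have "{x} \<subseteq> W 0" using x JW[of 0] by auto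
  moreover have "?J \<subseteq> (\<Union>i\<le>m. W i)" using JW by auto
  moreover have "?J \<inter> W m \<noteq> {}"
  proof -
    have "J m \<noteq> {}" using L by (simp add: links_def)
    moreover have "J m \<subseteq> ?J" by (intro UN_upper) simp
    ultimately show ?thesis using JW[of m] by blast
  qed
  ultimately have "c \<in> tube_chains m W" using c unfolding tube_chains_def by blast
  then show ?thesis by blast
qed

text \<open>The given chain is traversed in finitely many steps \<open>K \<subseteq> K'\<close>, each inside a Vietoris box, and the
  links are prolonged at each step. A box is convex for inclusion, so it also contains the members of
  a following chain that lie between two consecutive approximations.\<close>

lemma open_contains_followers:
  assumes O: "openin (connected_chains X) \<O>" "c0 \<in> \<O>"
    and \<A>: "\<And>A. A \<in> \<A> \<Longrightarrow> openin X A" "topspace X \<subseteq> \<Union>\<A>"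
  obtains m J H where "hosted \<A> m J H"
    "\<And>c. c \<in> topspace (connected_chains X) \<Longrightarrow> follows m H c \<Longrightarrow> c \<in> \<O>"
proof -
  let ?V = "vietoris X" and ?C = "topspace (connected_chains X)"
  have c0: "c0 \<in> ?C" using O openin_subset[OF O(1)] by blast
  note D0 = chain_memberD[OF c0]
  have HV: "t1_space ?V" using Hausdorff_space_vietoris[OF Hausdorff] Hausdorff_imp_t1_space by blast
  obtain \<O>' where O': "openin (vietoris ?V) \<O>'" "\<O> = \<O>' \<inter> ?C"
    using O(1) by (subst (asm) connected_chains_eq_subtopology) (auto simp: openin_subtopology)
  obtain \<U> \<V>s where U: "openin ?V \<U>" "finite \<V>s" "\<And>\<V>. \<V> \<in> \<V>s \<Longrightarrow> openin ?V \<V>"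
    "c0 \<in> vietoris_box ?V \<U> \<V>s" "vietoris_box ?V \<U> \<V>s \<subseteq> \<O>'"
    using openin_vietoris_obtain_box[OF O'(1)] O(2) O'(2) by (metis IntD1)
  have c0U: "c0 \<subseteq> \<U>" and "\<And>\<V>. \<V> \<in> \<V>s \<Longrightarrow> \<exists>K. K \<in> c0 \<and> K \<in> \<V>"
    using U(4) by (auto simp: vietoris_box_def)
  then obtain \<kappa> where \<kappa>: "\<And>\<V>. \<V> \<in> \<V>s \<Longrightarrow> \<kappa> \<V> \<in> c0 \<and> \<kappa> \<V> \<in> \<V>" by metis
  \<comment> \<open>A box that contains the chosen witness \<open>\<kappa> \<V>\<close> must lie in
    \<open>\<V>\<close>. Any set found in such a box is then a new witness for
    \<open>\<V>\<close>.\<close>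
  define \<B> where "\<B> = {(B, \<G>). openin X B \<and> finite \<G> \<and> (\<forall>G\<in>\<G>. openin X G) \<and> vietoris_box X B \<G> \<subseteq> \<U> \<and>
     (\<forall>\<V>\<in>\<V>s. \<kappa> \<V> \<in> vietoris_box X B \<G> \<longrightarrow> vietoris_box X B \<G> \<subseteq> \<V>)}"
  have cov: "\<exists>B \<G>. (B, \<G>) \<in> \<B> \<and> K \<in> vietoris_box X B \<G>" if K: "K \<in> c0" for K
  proof -
    \<comment> \<open>Witnesses other than \<open>K\<close> are cut out. A box inside this set
      contains \<open>\<kappa> \<V>\<close> only if it equals \<open>K\<close>, and then
      \<open>\<V>\<close> is among the intersected sets.\<close>
    let ?W = "\<Inter>(insert \<U> ((\<lambda>\<V>. if \<kappa> \<V> = K then \<V> else topspace ?V - {\<kappa> \<V>}) ` \<V>s))"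
    have "openin ?V ?W"
    proof (rule openin_Inter)
      fix S assume "S \<in> insert \<U> ((\<lambda>\<V>. if \<kappa> \<V> = K then \<V> else topspace ?V - {\<kappa> \<V>}) ` \<V>s)"
      moreover have "openin ?V (topspace ?V - {\<kappa> \<V>})" if "\<V> \<in> \<V>s" for \<V>
        using HV D0(5) \<kappa>[OF that] by (auto simp: t1_space_closedin_singleton)
      ultimately show "openin ?V S" using U(1,3) by auto
    qed (use U(2) in auto)
    moreover have "K \<in> ?W"
      using c0U K D0(5)[OF K] \<kappa> by auto
    ultimately obtain B \<G> where B: "openin X B" "finite \<G>" "\<And>G. G \<in> \<G> \<Longrightarrow> openin X G"
      "K \<in> vietoris_box X B \<G>" "vietoris_box X B \<G> \<subseteq> ?W"
      using openin_vietoris_obtain_box by (metis (no_types, lifting))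
    have "vietoris_box X B \<G> \<subseteq> \<V>" if v: "\<V> \<in> \<V>s" "\<kappa> \<V> \<in> vietoris_box X B \<G>" for \<V>
    proof -
      have "vietoris_box X B \<G> \<subseteq> (if \<kappa> \<V> = K then \<V> else topspace ?V - {\<kappa> \<V>})"
        using B(5) v(1) by blast
      then show ?thesis using v(2) by (auto split: if_splits)
    qed
    moreover have "vietoris_box X B \<G> \<subseteq> \<U>" using B(5) by blast
    ultimately show ?thesis using B(1-4) unfolding \<B>_def by blast
  qed
  define r where "r = {(K, K'). K \<in> c0 \<and> K' \<in> c0 \<and> K \<subseteq> K' \<and>
     (\<exists>B \<G>. (B, \<G>) \<in> \<B> \<and> K \<in> vietoris_box X B \<G> \<and> K' \<in> vietoris_box X B \<G>)}"
  obtain x0 where x0: "{x0} \<in> c0" using c0 by (auto simp: connected_chains_iff)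
  have convex: "M \<in> vietoris_box X B \<G>"
    if "K \<in> vietoris_box X B \<G>" "K' \<in> vietoris_box X B \<G>" "K \<subseteq> M" "M \<subseteq> K'" "compactin X M" for K K' M B \<G>
    using that unfolding vietoris_box_def by blast
  \<comment> \<open>A step of \<open>r\<close> only ascends, so reachability of smaller members
    needs an argument: a member between two sets of a common box lies in that box.\<close>
  have down: "({x0}, K') \<in> r\<^sup>*" if "({x0}, K) \<in> r\<^sup>*" "K' \<in> c0" "K' \<subseteq> K" for K K'
    using that
  proof (induction rule: rtrancl_induct)
    case base
    then have "K' = {x0}" using D0(3) by blast
    then show ?case by simp
  next
    case (step K1 K2)
    show ?case
    proof (cases "K' \<subseteq> K1")
      case False
      then have "K1 \<subseteq> K'" using chain_comparable[OF c0] step by (auto simp: r_def)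
      obtain B \<G> where "(B, \<G>) \<in> \<B>" "K1 \<in> vietoris_box X B \<G>" "K2 \<in> vietoris_box X B \<G>"
        using step(2) by (auto simp: r_def)
      then have "(K1, K') \<in> r"
        using \<open>K1 \<subseteq> K'\<close> step convex[OF _ _ \<open>K1 \<subseteq> K'\<close> step(5)] D0(1)[OF step(4)] unfolding r_def by blast
      then show ?thesis using step(1) by simp
    qed (use step in blast)
  qed
  \<comment> \<open>Members of \<open>c0\<close> sharing a box are reachable together or not at all.
    The boxes of reachable and of unreachable members thus split \<open>c0\<close>, unless all
    members are reachable.\<close>
  have reach: "({x0}, topspace X) \<in> r\<^sup>*"
  proof (rule ccontr)
    assume no: "({x0}, topspace X) \<notin> r\<^sup>*"
    let ?box = "\<lambda>p. vietoris_box X (fst p) (snd p)"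
    let ?P = "\<Union>(?box ` {p \<in> \<B>. \<exists>K\<in>c0. ({x0}, K) \<in> r\<^sup>* \<and> K \<in> ?box p})"
    let ?Q = "\<Union>(?box ` {p \<in> \<B>. \<exists>K\<in>c0. ({x0}, K) \<notin> r\<^sup>* \<and> K \<in> ?box p})"
    have opB: "openin ?V (?box p)" if "p \<in> \<B>" for p
      using that unfolding \<B>_def by (auto intro: openin_vietoris_box)
    have key: "({x0}, K) \<in> r\<^sup>* \<longleftrightarrow> ({x0}, K') \<in> r\<^sup>*"
      if p: "p \<in> \<B>" "K \<in> ?box p" "K' \<in> ?box p" "K \<in> c0" "K' \<in> c0" for p K K'
    proof -
      have *: "({x0}, K') \<in> r\<^sup>*" if "({x0}, K) \<in> r\<^sup>*" "K \<in> ?box p" "K' \<in> ?box p" "K \<in> c0" "K' \<in> c0" for K K'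
      proof (cases "K \<subseteq> K'")
        case True
        then have "(K, K') \<in> r" using p(1) that unfolding r_def by (cases p) auto
        then show ?thesis using that(1) by simp
      next
        case False
        then show ?thesis using down[OF that(1,5)] chain_comparable[OF c0 that(4,5)] by blast
      qed
      show ?thesis using *[of K K'] *[of K' K] p by blast
    qed
    show False
    proof (rule connectedinD[OF chain_connected_in_vietoris[OF c0], of ?P ?Q])
      show "openin ?V ?P" "openin ?V ?Q" using opB by (auto intro!: openin_Union)
      show "c0 \<subseteq> ?P \<union> ?Q"
      proof
        fix K assume K: "K \<in> c0"
        obtain B \<G> where "(B, \<G>) \<in> \<B>" "K \<in> vietoris_box X B \<G>" using cov[OF K] by blast
        then show "K \<in> ?P \<union> ?Q" using K by (cases "({x0}, K) \<in> r\<^sup>*") force+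
      qed
      have inP: "({x0}, K) \<in> r\<^sup>*" if "K \<in> ?P" "K \<in> c0" for K using that key by blast
      have inQ: "({x0}, K) \<notin> r\<^sup>*" if "K \<in> ?Q" "K \<in> c0" for K using that key by blast
      show "?P \<inter> ?Q \<inter> c0 = {}" using inP inQ by blast
      obtain B \<G> where "(B, \<G>) \<in> \<B>" "{x0} \<in> vietoris_box X B \<G>" using cov[OF x0] by blast
      then have "{x0} \<in> ?P" using x0 by (intro UN_I[of "(B, \<G>)"]) auto
      then show "?P \<inter> c0 \<noteq> {}" using x0 by blast
      have X: "topspace X \<in> c0" using c0 by (simp add: connected_chains_iff)
      obtain B \<G> where "(B, \<G>) \<in> \<B>" "topspace X \<in> vietoris_box X B \<G>" using cov[OF X] by blast
      then have "topspace X \<in> ?Q" using X no by (intro UN_I[of "(B, \<G>)"]) auto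
      then show "?Q \<inter> c0 \<noteq> {}" using X by blast
    qed
  qed
  \<comment> \<open>\<open>D\<close> and \<open>\<G>\<close> are arbitrary because the step from
    \<open>K\<close> to \<open>K'\<close> needs links for \<open>K\<close> that stay in a
    neighbourhood of \<open>K'\<close> and enter every lower set of the box shared by
    \<open>K\<close> and \<open>K'\<close>.\<close>
  have approx: "\<exists>m J H. hosted \<A> m J H \<and> (\<forall>i\<le>m. H i \<subseteq> D) \<and> (\<forall>G\<in>\<G>. \<exists>i\<le>m. H i \<subseteq> G) \<and>
      (\<forall>c\<in>?C. follows m H c \<longrightarrow> (\<forall>L\<in>c. L \<subseteq> (\<Union>i\<le>m. H i) \<longrightarrow> L \<in> \<U>) \<and>
         (\<forall>\<V>\<in>\<V>s. \<kappa> \<V> \<subseteq> K \<longrightarrow> (\<exists>L\<in>c. L \<in> \<V>)))"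
    if "({x0}, K) \<in> r\<^sup>*" "openin X D" "K \<subseteq> D" "finite \<G>" "\<forall>G\<in>\<G>. openin X G \<and> K \<inter> G \<noteq> {}" for K D \<G>
    using that
  proof (induction arbitrary: D \<G> rule: rtrancl_induct)
    case base
    have x0X: "x0 \<in> topspace X" using D0(4)[OF x0] by blast
    obtain B \<H> where B: "(B, \<H>) \<in> \<B>" "{x0} \<in> vietoris_box X B \<H>" using cov[OF x0] by blast
    have B': "openin X B" "finite \<H>" "\<And>G. G \<in> \<H> \<Longrightarrow> openin X G" "vietoris_box X B \<H> \<subseteq> \<U>"
      using B(1) by (auto simp: \<B>_def)
    obtain A where A: "A \<in> \<A>" "x0 \<in> A" using \<A>(2) x0X by blast
    \<comment> \<open>At the root one link suffices: its host lies in every set of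
      \<open>\<H>\<close>, so each chain member inside the host satisfies all meeting conditions of
      the box.\<close>
    define N where "N = \<Inter>({A, D, B} \<union> \<G> \<union> \<H>)"
    have N: "openin X N" "x0 \<in> N"
    proof -
      show "openin X N" unfolding N_def
        using \<A>(1)[OF A(1)] base B' by (intro openin_Inter) auto
      show "x0 \<in> N" using A(2) base B(2) by (auto simp: N_def vietoris_box_def)
    qed
    have ND: "N \<subseteq> D" "N \<subseteq> A" "N \<subseteq> B" "\<And>G. G \<in> \<G> \<Longrightarrow> N \<subseteq> G" "\<And>G. G \<in> \<H> \<Longrightarrow> N \<subseteq> G"
      by (auto simp: N_def)
    have "hosted \<A> 0 (\<lambda>_. {x0}) (\<lambda>_. N)"
      using N ND(2) A(1) nonseparating_singleton[OF x0X] x0X by (auto simp: hosted_def links_def)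
    moreover have "L \<in> vietoris_box X B \<H>" if c: "c \<in> ?C" and L: "L \<in> c" "L \<subseteq> N" for c L
    proof -
      have "L \<inter> G \<noteq> {}" if "G \<in> \<H>" for G using ND(5)[OF that] L(2) chain_memberD(3)[OF c L(1)] by blast
      then show ?thesis
        using chain_memberD(1,3)[OF c L(1)] L(2) ND(3) unfolding vietoris_box_def by blast
    qed
    moreover have "\<exists>L\<in>c. L \<in> \<V>"
      if c: "c \<in> ?C" "follows 0 (\<lambda>_. N) c" and v: "\<V> \<in> \<V>s" "\<kappa> \<V> \<subseteq> {x0}" for c \<V>
    proof -
      have "\<kappa> \<V> = {x0}" using v \<kappa>[OF v(1)] D0(3) by blast
      then have sub: "vietoris_box X B \<H> \<subseteq> \<V>" using B v(1) by (auto simp: \<B>_def)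
      obtain L where "L \<in> c" "L \<subseteq> N" using c(2) by (auto simp: follows_def)
      then show ?thesis using calculation(2)[OF c(1)] sub by blast
    qed
    ultimately show ?case
      using ND(1,4) B'(4) by (intro exI[of _ 0] exI[of _ "\<lambda>_. {x0}"] exI[of _ "\<lambda>_. N"]) auto
  next
    case (step K K')
    obtain B \<H> where B: "(B, \<H>) \<in> \<B>" "K \<in> vietoris_box X B \<H>" "K' \<in> vietoris_box X B \<H>"
      and KK: "K \<in> c0" "K' \<in> c0" "K \<subseteq> K'"
      using step(2) by (auto simp: r_def)
    have B': "openin X B" "finite \<H>" "\<And>G. G \<in> \<H> \<Longrightarrow> openin X G" "vietoris_box X B \<H> \<subseteq> \<U>"
      using B(1) by (auto simp: \<B>_def)
    have "K' \<subseteq> D \<inter> B" using step.prems(2) B(3) by (auto simp: vietoris_box_def)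
    moreover have "openin X (D \<inter> B)" using step.prems(1) B'(1) by blast
    ultimately obtain E where E: "openin X E" "connectedin X E" "K' \<subseteq> E" "E \<subseteq> D \<inter> B"
      using connected_nbhd[OF chain_member_connected[OF c0 KK(2)] D0(3)[OF KK(2)]] by metis
    have "K \<subseteq> E" "\<forall>G\<in>\<H>. openin X G \<and> K \<inter> G \<noteq> {}"
      using KK(3) E(3) B(2) B'(3) by (auto simp: vietoris_box_def)
    from step.IH[OF E(1) this(1) B'(2) this(2)]
    obtain m J H where m: "hosted \<A> m J H" "\<And>i. i \<le> m \<Longrightarrow> H i \<subseteq> E" "\<And>G. G \<in> \<H> \<Longrightarrow> \<exists>i\<le>m. H i \<subseteq> G"
      and m4: "\<And>c. c \<in> ?C \<Longrightarrow> follows m H c \<Longrightarrow> (\<forall>L\<in>c. L \<subseteq> (\<Union>i\<le>m. H i) \<longrightarrow> L \<in> \<U>) \<and>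
         (\<forall>\<V>\<in>\<V>s. \<kappa> \<V> \<subseteq> K \<longrightarrow> (\<exists>L\<in>c. L \<in> \<V>))"
      by (elim exE conjE) blast
    have JE: "J m \<subseteq> E" using m(1) m(2)[of m] by (auto simp: hosted_def)
    have GE: "\<And>G. G \<in> \<G> \<Longrightarrow> openin X G" "\<And>G. G \<in> \<G> \<Longrightarrow> G \<inter> E \<noteq> {}"
      using step.prems(4) E(3) by blast+
    obtain n J' H' where n: "hosted \<A> n J' H'" "extends m J H n J' H'"
      "\<And>i. m < i \<Longrightarrow> i \<le> n \<Longrightarrow> H' i \<subseteq> E" "\<And>G. G \<in> \<G> \<Longrightarrow> \<exists>i\<le>n. H' i \<subseteq> G"
      using hosted_extend_finite[OF step.prems(3) m(1) \<A> E(1,2) JE GE] by blast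
    have H'E: "H' i \<subseteq> E" if "i \<le> n" for i
      using n(2,3) m(2) that by (cases "i \<le> m") (auto simp: extends_def)
    have main: "(\<forall>L\<in>c. L \<subseteq> (\<Union>i\<le>n. H' i) \<longrightarrow> L \<in> \<U>) \<and> (\<forall>\<V>\<in>\<V>s. \<kappa> \<V> \<subseteq> K' \<longrightarrow> (\<exists>L\<in>c. L \<in> \<V>))"
      if c: "c \<in> ?C" and f: "follows n H' c" for c
    proof -
      have fm: "follows m H c" by (rule follows_extends[OF f n(2)])
      \<comment> \<open>\<open>M\<close> follows the old links and so meets all lower sets of the
        box. Members of \<open>c\<close> above \<open>M\<close> and inside the new hosts lie in the
        same box; members below \<open>M\<close> are left to the induction hypothesis.\<close>
      then obtain M where M: "M \<in> c" "M \<subseteq> (\<Union>i\<le>m. H i)" "\<And>i. i \<le> m \<Longrightarrow> M \<inter> H i \<noteq> {}"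
        by (auto simp: follows_def)
      have MH: "M \<inter> G \<noteq> {}" if "G \<in> \<H>" for G using m(3)[OF that] M(3) by blast
      have boxI: "L \<in> vietoris_box X B \<H>" if L: "L \<in> c" "L \<subseteq> (\<Union>i\<le>n. H' i)" "M \<subseteq> L" for L
      proof -
        have "L \<subseteq> B" using L(2) H'E E(4) by blast
        then show ?thesis
          using chain_memberD(1,3)[OF c L(1)] MH L(3) unfolding vietoris_box_def by blast
      qed
      have MB: "M \<in> vietoris_box X B \<H>"
      proof (rule boxI[OF M(1)])
        show "M \<subseteq> (\<Union>i\<le>n. H' i)" using M(2) n(2) by (fastforce simp: extends_def)
      qed simp
      show ?thesis
      proof (intro conjI ballI impI)
        fix L assume L: "L \<in> c" "L \<subseteq> (\<Union>i\<le>n. H' i)"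
        show "L \<in> \<U>"
          using chain_comparable[OF c L(1) M(1)]
        proof
          assume "L \<subseteq> M"
          then show ?thesis using m4[OF c fm] L(1) M(2) by (meson order_trans)
        qed (use boxI[OF L] B'(4) in blast)
      next
        fix \<V> assume v: "\<V> \<in> \<V>s" "\<kappa> \<V> \<subseteq> K'"
        have kc: "\<kappa> \<V> \<in> c0" using \<kappa>[OF v(1)] by blast
        show "\<exists>L\<in>c. L \<in> \<V>"
        proof (cases "\<kappa> \<V> \<subseteq> K")
          case True then show ?thesis using m4[OF c fm] v(1) by blast
        next
          case False
          then have "K \<subseteq> \<kappa> \<V>" using chain_comparable[OF c0 kc KK(1)] by blast
          then have "\<kappa> \<V> \<in> vietoris_box X B \<H>" using convex[OF B(2,3) _ v(2)] D0(1)[OF kc] by blast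
          then have "vietoris_box X B \<H> \<subseteq> \<V>" using B(1) v(1) by (auto simp: \<B>_def)
          then show ?thesis using MB M(1) by blast
        qed
      qed
    qed
    have "H' i \<subseteq> D" if "i \<le> n" for i using H'E[OF that] E(4) by blast
    then show ?case using n(1,4) main by (intro exI[of _ n] exI[of _ J'] exI[of _ H']) blast
  qed
  have X: "topspace X \<in> c0" using c0 by (simp add: connected_chains_iff)
  obtain B \<H> where B: "(B, \<H>) \<in> \<B>" "topspace X \<in> vietoris_box X B \<H>" using cov[OF X] by blast
  have B': "openin X B" "finite \<H>" "\<And>G. G \<in> \<H> \<Longrightarrow> openin X G" "vietoris_box X B \<H> \<subseteq> \<U>"
    using B(1) by (auto simp: \<B>_def)
  have XB: "topspace X \<subseteq> B" "\<forall>G\<in>\<H>. openin X G \<and> topspace X \<inter> G \<noteq> {}"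
    using B(2) B'(3) by (auto simp: vietoris_box_def)
  from approx[OF reach B'(1) XB(1) B'(2) XB(2)]
  obtain m J H where m: "hosted \<A> m J H" "\<And>G. G \<in> \<H> \<Longrightarrow> \<exists>i\<le>m. H i \<subseteq> G"
    and m4: "\<And>c. c \<in> ?C \<Longrightarrow> follows m H c \<Longrightarrow> (\<forall>L\<in>c. L \<subseteq> (\<Union>i\<le>m. H i) \<longrightarrow> L \<in> \<U>) \<and>
         (\<forall>\<V>\<in>\<V>s. \<kappa> \<V> \<subseteq> topspace X \<longrightarrow> (\<exists>L\<in>c. L \<in> \<V>))"
    by (elim exE conjE) blast
  show thesis
  proof (rule that[OF m(1)])
    fix c assume c: "c \<in> ?C" and f: "follows m H c"
    obtain M where M: "M \<in> c" "M \<subseteq> (\<Union>i\<le>m. H i)" "\<And>i. i \<le> m \<Longrightarrow> M \<inter> H i \<noteq> {}"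
      using f by (auto simp: follows_def)
    have MH: "M \<inter> G \<noteq> {}" if "G \<in> \<H>" for G using m(2)[OF that] M(3) by blast
    have "L \<in> \<U>" if L: "L \<in> c" for L
      using chain_comparable[OF c L M(1)]
    proof
      assume "L \<subseteq> M"
      then show ?thesis using m4[OF c f] L M(2) by (meson order_trans)
    next
      \<comment> \<open>From \<open>M\<close> upwards all members lie in the last box: its upper set
        is the whole space, and \<open>M\<close> already meets its lower sets.\<close>
      assume "M \<subseteq> L"
      then have "L \<in> vietoris_box X B \<H>"
        using chain_memberD(1,3,4)[OF c L] MH \<open>topspace X \<subseteq> B\<close> unfolding vietoris_box_def by blast
      then show ?thesis using B'(4) by blast
    qed
    moreover have "c \<inter> \<V> \<noteq> {}" if v: "\<V> \<in> \<V>s" for \<V>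
      using m4[OF c f] v \<kappa>[OF v] D0(4) by blast
    moreover have "compactin ?V c" "c \<noteq> {}" using c by (auto simp: connected_chains_iff)
    ultimately have "c \<in> vietoris_box ?V \<U> \<V>s" unfolding vietoris_box_def by blast
    then show "c \<in> \<O>" using U(5) O'(2) c by blast
  qed
qed

end

section \<open>Words read along tubes\<close>

text \<open>Letters are residues modulo 3. A word over them is a walk on a triangle; \<open>lift_word\<close> is the lift of
  this walk to the universal cover, the line of integers.\<close>

primrec lift_word :: "(nat \<Rightarrow> int \<Rightarrow> bool) \<Rightarrow> nat \<Rightarrow> int" where
  "lift_word C 0 = (if C 0 0 then 0 else if C 0 1 then 1 else if C 0 (-1) then -1 else 0)"
| "lift_word C (Suc b) = (let v = lift_word C b in
     if C (Suc b) v then v else if C (Suc b) (v + 1) then v + 1 else if C (Suc b) (v - 1) then v - 1 else v)"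

text \<open>\<open>C b j\<close> says that the letter \<open>j mod 3\<close> is read at position
  \<open>b\<close>. A position may carry no letter; the lift then keeps its value.\<close>

locale partial_word =
  fixes C :: "nat \<Rightarrow> int \<Rightarrow> bool"
  assumes cong: "\<And>b i j. i mod 3 = j mod 3 \<Longrightarrow> C b i \<Longrightarrow> C b j"
    and unique: "\<And>b i j. C b i \<Longrightarrow> C b j \<Longrightarrow> i mod 3 = j mod 3"
begin

text \<open>On a triangle any two letters are equal or adjacent, so changing the lift by at most one
  always reaches the residue of the letter being read.\<close>

lemma lift_word_mod:
  assumes "C b j"
  shows "lift_word C b mod 3 = j mod 3"
proof -
  have *: "C b v \<or> C b (v + 1) \<or> C b (v - 1)" for v
  proof -
    have "v mod 3 = 0 \<or> v mod 3 = 1 \<or> v mod 3 = 2" "j mod 3 = 0 \<or> j mod 3 = 1 \<or> j mod 3 = 2"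
      by presburger+
    moreover have "(v + 1) mod 3 = (v mod 3 + 1) mod 3" "(v - 1) mod 3 = (v mod 3 - 1) mod 3"
      by (simp_all add: mod_add_left_eq mod_diff_left_eq)
    ultimately have "j mod 3 = v mod 3 \<or> j mod 3 = (v + 1) mod 3 \<or> j mod 3 = (v - 1) mod 3"
      by auto
    then show ?thesis using cong[OF _ assms] by blast
  qed
  have "C b (lift_word C b)"
    using *[of 0] *[of "lift_word C (b - 1)"] by (cases b) (auto simp: Let_def)
  then show ?thesis using unique assms by blast
qed

lemma lift_word_Suc_cases: "\<bar>lift_word C (Suc b) - lift_word C b\<bar> \<le> 1"
  by (simp add: Let_def)

lemma lift_word_le: "\<bar>lift_word C b\<bar> \<le> int b + 1"
proof (induction b)
  case (Suc b) then show ?case using lift_word_Suc_cases[of b] by linarith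
qed simp

text \<open>Both exits from the pair \<open>{v, v + 1}\<close> need the same letter, as
  \<open>v - 1\<close> and \<open>v + 2\<close> agree modulo 3.\<close>

lemma lift_word_stays:
  assumes "b \<le> b'" "lift_word C b \<in> {v, v + 1}" "\<And>x. b < x \<Longrightarrow> x \<le> b' \<Longrightarrow> \<not> C x (v + 2)"
  shows "lift_word C b' \<in> {v, v + 1}"
  using assms
proof (induction b' rule: dec_induct)
  case base then show ?case by simp
next
  case (step n)
  then have IH: "lift_word C n \<in> {v, v + 1}" and no: "\<not> C (Suc n) (v + 2)" by auto
  moreover have "\<not> C (Suc n) (v - 1)"
  proof
    assume "C (Suc n) (v - 1)"
    moreover have "(v - 1) mod 3 = (v + 2) mod 3" by presburger
    ultimately show False using cong no by blast
  qed
  ultimately show ?case by (auto simp: Let_def add.commute)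
qed

text \<open>The lift is defined from left to right, but this works in both directions. For
  \<open>c < b\<close> the letter at \<open>c\<close> places the lift in a pair
  \<open>{w, w + 1}\<close> with \<open>w\<close> congruent to \<open>v\<close>; the walk from
  \<open>c\<close> to \<open>b\<close> keeps it there, and two such pairs that meet
  coincide.\<close>

lemma lift_word_letter:
  assumes b: "lift_word C b \<in> {v, v + 1}" and c: "C c v \<or> C c (v + 1)"
    and no: "\<And>x. min b c \<le> x \<Longrightarrow> x \<le> max b c \<Longrightarrow> \<not> C x (v + 2)"
  shows "lift_word C c \<in> {v, v + 1}"
proof (cases "b \<le> c")
  case True
  then show ?thesis using lift_word_stays[OF True b] no by simp
next
  case False
  have "lift_word C c mod 3 = v mod 3 \<or> lift_word C c mod 3 = (v + 1) mod 3"
    using c lift_word_mod by blast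
  then obtain w where w: "w mod 3 = v mod 3" "lift_word C c \<in> {w, w + 1}"
  proof
    assume "lift_word C c mod 3 = (v + 1) mod 3"
    then have "(lift_word C c - 1) mod 3 = v mod 3" by presburger
    then show ?thesis using that[of "lift_word C c - 1"] by simp
  qed auto
  have "\<not> C x (w + 2)" if "c < x" "x \<le> b" for x
  proof -
    have "(w + 2) mod 3 = (v + 2) mod 3" using w(1) by presburger
    then show ?thesis using no[of x] cong[of "w + 2" "v + 2"] that False by auto
  qed
  then have "lift_word C b \<in> {w, w + 1}"
    using lift_word_stays[of c b w] w(2) False by simp
  then have "w \<in> {v - 1, v, v + 1}" using b by auto
  moreover have "(v - 1) mod 3 \<noteq> v mod 3" "(v + 1) mod 3 \<noteq> v mod 3" by presburger+
  ultimately have "w = v" using w(1) by auto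
  then show ?thesis using w(2) by simp
qed

text \<open>After position \<open>r\<close> at most two letters occur, which confines the lift to a
  pair of neighbouring integers. The bound adds \<open>r + 1\<close> for the first positions and
  \<open>2\<close> for entering that pair.\<close>

lemma lift_word_bounded:
  assumes no: "\<And>b. r < b \<Longrightarrow> \<not> C b 2"
  shows "\<bar>lift_word C b\<bar> \<le> int r + 3"
proof (cases "b \<le> r")
  case True
  then show ?thesis using lift_word_le[of b] by linarith
next
  case False
  let ?u = "lift_word C r"
  \<comment> \<open>The lift may rest on residue \<open>2\<close> until a letter is read after
    \<open>r\<close>. The first move then enters the pair directly above or below, whose farther
    element is at distance 2.\<close>
  have "lift_word C b = ?u \<or> (\<exists>v. v mod 3 = 0 \<and> \<bar>v - ?u\<bar> \<le> 2 \<and> \<bar>v + 1 - ?u\<bar> \<le> 2 \<and> lift_word C b \<in> {v, v + 1})"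
    if "r \<le> b" for b
    using that
  proof (induction b rule: dec_induct)
    case (step n)
    have n2: "\<not> C (Suc n) j" if "j mod 3 = 2" for j
      using no[of "Suc n"] step(1) cong[of j 2 "Suc n"] that by auto
    show ?case
    proof (cases "\<exists>v. v mod 3 = 0 \<and> \<bar>v - ?u\<bar> \<le> 2 \<and> \<bar>v + 1 - ?u\<bar> \<le> 2 \<and> lift_word C n \<in> {v, v + 1}")
      case True
      then obtain v where v: "v mod 3 = 0" "\<bar>v - ?u\<bar> \<le> 2" "\<bar>v + 1 - ?u\<bar> \<le> 2" "lift_word C n \<in> {v, v + 1}"
        by (elim exE conjE)
      have "(v + 2) mod 3 = 2" using v(1) by presburger
      then have "lift_word C (Suc n) \<in> {v, v + 1}"
        using lift_word_stays[of n "Suc n" v] v(4) n2 by (metis Suc_leI le_SucI le_antisym nat_less_le order_refl)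
      then show ?thesis using v(1-3) by (intro disjI2 exI[of _ v] conjI)
    next
      case False
      then have u: "lift_word C n = ?u" using step by blast
      have "?u mod 3 = 2"
      proof (rule ccontr)
        assume "?u mod 3 \<noteq> 2"
        moreover have "u mod 3 = 2 \<or> u mod 3 = 0 \<or> (u - 1) mod 3 = 0" for u :: int by presburger
        ultimately have "?u mod 3 = 0 \<or> (?u - 1) mod 3 = 0" by blast
        moreover have "\<not> (v mod 3 = 0 \<and> \<bar>v - ?u\<bar> \<le> 2 \<and> \<bar>v + 1 - ?u\<bar> \<le> 2 \<and> ?u \<in> {v, v + 1})" for v
          using False unfolding u by (rule contrapos_nn) (rule exI)
        from this[of ?u] this[of "?u - 1"] have "?u mod 3 \<noteq> 0" "(?u - 1) mod 3 \<noteq> 0" by simp_all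
        ultimately show False by blast
      qed
      moreover have "u mod 3 = 2 \<Longrightarrow> (u + 1) mod 3 = 0 \<and> (u - 2) mod 3 = 0" for u :: int by presburger
      ultimately have "(?u + 1) mod 3 = 0" "(?u - 2) mod 3 = 0" by blast+
      moreover have "lift_word C (Suc n) \<in> {?u - 1, ?u, ?u + 1}"
        using lift_word_Suc_cases[of n] u by auto
      ultimately show ?thesis
        by (elim insertE) (auto intro: exI[of _ "?u + 1"] exI[of _ "?u - 2"])
    qed
  qed simp
  from this[of b] have "\<bar>lift_word C b - ?u\<bar> \<le> 2" using False by auto
  then show ?thesis using lift_word_le[of r] by linarith
qed

end

context tame_space begin

text \<open>The positions of \<open>\<phi> x\<close> in the tube \<open>W\<close> form a word, which records the regions visited by \<open>\<psi> x\<close>.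
  Moving along the tube \<open>Z\<close> changes the lift of this word monotonically, whereas the lift is bounded
  because \<open>W\<close> eventually avoids one of the regions.\<close>

lemma no_common_word:
  assumes L: "connectedin X L" and \<phi>: "continuous_map X X \<phi>" and \<psi>: "continuous_map X X \<psi>"
    and W: "tube m W" and Z: "tube q Z"
    and \<phi>L: "\<And>x. x \<in> L \<Longrightarrow> \<phi> x \<in> (\<Union>i\<le>m. W i)" and \<psi>L: "\<And>x. x \<in> L \<Longrightarrow> \<psi> x \<in> (\<Union>i\<le>q. Z i)"
    and meets: "\<And>i. i \<le> q \<Longrightarrow> \<exists>x\<in>L. \<psi> x \<in> Z i"
    and AB: "\<And>j. A j \<subseteq> B j" "\<And>i j. i < 3 \<Longrightarrow> j < 3 \<Longrightarrow> i \<noteq> j \<Longrightarrow> A i \<inter> B j = {}"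
    and close: "\<And>b x y j. b \<le> m \<Longrightarrow> x \<in> L \<Longrightarrow> y \<in> L \<Longrightarrow> \<phi> x \<in> W b \<Longrightarrow> \<phi> y \<in> W b \<Longrightarrow> j < 3 \<Longrightarrow> \<psi> x \<in> A j \<Longrightarrow> \<psi> y \<in> B j"
    and close': "\<And>x j. x \<in> L \<Longrightarrow> j < 3 \<Longrightarrow> \<psi> x \<in> A j \<Longrightarrow> \<phi> x \<in> B j"
    and avoid: "\<And>b. r < b \<Longrightarrow> b \<le> m \<Longrightarrow> W b \<inter> B 2 = {}"
    and s: "\<And>k. k < M \<Longrightarrow> s k < s (Suc k)" "s M = q"
    and sA: "\<And>k. k \<le> M \<Longrightarrow> Z (s k) \<subseteq> A (k mod 3)"
    and sB: "\<And>k i. k < M \<Longrightarrow> s k \<le> i \<Longrightarrow> i \<le> s (Suc k) \<Longrightarrow> Z i \<inter> B ((k + 2) mod 3) = {}"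
    and M: "2 * r + 10 < M"
  shows False
proof -
  define C where "C b j \<longleftrightarrow> b \<le> m \<and> (\<exists>x\<in>L. \<phi> x \<in> W b \<and> \<psi> x \<in> A (nat (j mod 3)))" for b and j :: int
  have n3: "nat (j mod 3) < 3" for j :: int by (simp add: nat_less_iff)
  have nk: "nat (int k mod 3) = k mod 3" for k by (simp add: nat_mod_distrib)
  interpret partial_word C
  proof
    show "C b j" if "i mod 3 = j mod 3" "C b i" for b i j using that by (simp add: C_def)
    show "i mod 3 = j mod 3" if "C b i" "C b j" for b i j
    proof (rule ccontr)
      assume "i mod 3 \<noteq> j mod 3"
      then have ne: "nat (j mod 3) \<noteq> nat (i mod 3)" by (simp add: eq_nat_nat_iff)
      obtain x y where xy: "x \<in> L" "y \<in> L" "\<phi> x \<in> W b" "\<phi> y \<in> W b" "\<psi> x \<in> A (nat (i mod 3))" "\<psi> y \<in> A (nat (j mod 3))"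
        and "b \<le> m"
        using \<open>C b i\<close> \<open>C b j\<close> by (auto simp: C_def)
      then have "\<psi> y \<in> B (nat (i mod 3))" using close n3 by blast
      then show False using AB(2)[OF n3 n3 ne] xy(6) by blast
    qed
  qed
  let ?l = "lift_word C"
  \<comment> \<open>A letter \<open>2\<close> at a position beyond \<open>r\<close> would place
    \<open>\<phi> x\<close> in \<open>B 2\<close> by \<open>close'\<close>, whereas the tube
    \<open>W\<close> avoids \<open>B 2\<close> there.\<close>
  have no2: "\<not> C b 2" if "r < b" for b
    using avoid[OF that] close' by (fastforce simp: C_def)
  have bound: "\<bar>?l b\<bar> \<le> int r + 3" for b by (rule lift_word_bounded[OF no2])
  have smono: "s k + (k' - k) \<le> s k'" if "k \<le> k'" "k' \<le> M" for k k'
    using that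
  proof (induction k' rule: dec_induct)
    case (step n) then show ?case using s(1)[of n] by simp
  qed simp
  \<comment> \<open>A node combines a lap \<open>k\<close> of \<open>Z\<close>, leading from one
    region to the next, with a position \<open>b\<close> in \<open>W\<close>. During the lap the
    third region is avoided, so by closeness the letter \<open>k + 2\<close> is not read at
    \<open>b\<close>.\<close>
  define node where "node k b x \<longleftrightarrow> k < M \<and> b \<le> m \<and> (\<exists>i. s k \<le> i \<and> i \<le> s (Suc k) \<and> \<psi> x \<in> Z i) \<and> \<phi> x \<in> W b" for k b x
  have node_avoid: "\<not> C b (int k + 2)" if "node k b x" "x \<in> L" for k b x
  proof
    assume "C b (int k + 2)"
    moreover have "nat ((int k + 2) mod 3) = (k + 2) mod 3" using nk[of "k + 2"] by (simp add: add.commute)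
    ultimately obtain y where y: "y \<in> L" "\<phi> y \<in> W b" "\<psi> y \<in> A ((k + 2) mod 3)" by (auto simp: C_def)
    have "\<psi> x \<in> B ((k + 2) mod 3)"
      using close[OF _ y(1) that(2) y(2) _ _ y(3)] that(1) by (simp add: node_def)
    then show False using sB that(1) unfolding node_def by blast
  qed
  have Zq: "i \<le> q" if "i \<le> s (Suc k)" "k < M" for i k
    using smono[of "Suc k" M] that s(2) by simp
  have "\<exists>x\<in>L. \<psi> x \<in> Z q" using meets by blast
  then obtain x1 where x1: "x1 \<in> L" "\<psi> x1 \<in> Z q" by blast
  obtain b1 where b1: "b1 \<le> m" "\<phi> x1 \<in> W b1" using \<phi>L[OF x1(1)] by blast
  \<comment> \<open>The offset between lift and lap number is calibrated at \<open>x1\<close>, the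
    point over the far end of \<open>Z\<close>. It is a multiple of 3, so adding it changes no
    letter.\<close>
  define D where "D = ?l b1 - int M"
  have Cb1: "C b1 (int M)" using x1 b1 sA[of M] s(2) nk by (auto simp: C_def)
  then have D3: "D mod 3 = 0" using lift_word_mod by (metis D_def mod_eq_dvd_iff dvd_imp_mod_0)
  \<comment> \<open>The node is in phase: the lift has the value expected in lap \<open>k\<close>.
    It is tested at a position \<open>c\<close>, joined to \<open>b\<close> by a stretch without the
    letter \<open>k + 2\<close>, since the lift at \<open>b\<close> itself may still show a letter
    read earlier.\<close>
  define Inv where "Inv k b \<longleftrightarrow> (\<exists>c. ?l c \<in> {int k + D, int k + D + 1} \<and>
     (\<forall>x. min b c \<le> x \<longrightarrow> x \<le> max b c \<longrightarrow> \<not> C x (int k + 2)))" for k b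
  have Ccong: "C b (j + D) \<longleftrightarrow> C b j" for b j
  proof -
    have "(j + D) mod 3 = j mod 3" using D3 by presburger
    then show ?thesis using cong by metis
  qed
  have stepb: "Inv k b'" if "Inv k b" "node k b' x" "x \<in> L" "b \<le> Suc b'" "b' \<le> Suc b" for k b b' x
  proof -
    obtain c where c: "?l c \<in> {int k + D, int k + D + 1}"
      "\<And>x. min b c \<le> x \<Longrightarrow> x \<le> max b c \<Longrightarrow> \<not> C x (int k + 2)"
      using \<open>Inv k b\<close> by (auto simp: Inv_def)
    have "\<not> C z (int k + 2)" if "min b' c \<le> z" "z \<le> max b' c" for z
    proof (cases "z = b'")
      case False
      then have "min b c \<le> z" "z \<le> max b c" using that \<open>b \<le> Suc b'\<close> \<open>b' \<le> Suc b\<close> by auto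
      then show ?thesis by (rule c(2))
    qed (use node_avoid \<open>node k b' x\<close> \<open>x \<in> L\<close> in blast)
    then show ?thesis using c(1) by (auto simp: Inv_def)
  qed
  have letter: "?l b = int (Suc k) + D" if "Inv k b" "C b (int (Suc k))" for k b
  proof -
    obtain c where c: "?l c \<in> {int k + D, int k + D + 1}"
      "\<And>x. min b c \<le> x \<Longrightarrow> x \<le> max b c \<Longrightarrow> \<not> C x (int k + 2)"
      using \<open>Inv k b\<close> by (auto simp: Inv_def)
    have "?l b \<in> {int k + D, int k + D + 1}"
    proof (rule lift_word_letter[OF c(1)])
      show "C b (int k + D) \<or> C b (int k + D + 1)"
        using that(2) Ccong[of b "int k + 1"] by (simp add: algebra_simps)
      show "\<not> C x (int k + D + 2)" if "min c b \<le> x" "x \<le> max c b" for x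
        using c(2)[of x] that Ccong[of x "int k + 2"] by (simp add: algebra_simps min.commute max.commute)
    qed
    moreover have "?l b mod 3 = int (Suc k) mod 3" using lift_word_mod[OF that(2)] .
    moreover have "(int k + D) mod 3 \<noteq> int (Suc k) mod 3" using D3 by simp presburger
    ultimately show ?thesis by auto
  qed
  have Ccross: "C b (int (Suc k))" if "b \<le> m" "x \<in> L" "\<phi> x \<in> W b" "\<psi> x \<in> Z (s (Suc k))" "Suc k \<le> M" for b k x
    using that sA[of "Suc k"] nk[of "Suc k"] by (auto simp: C_def)
  have other: "\<not> C b j" if "C b i" "i mod 3 \<noteq> j mod 3" for b i j using unique that by blast
  \<comment> \<open>Being in phase passes between nodes that share a point. If the laps differ, they
    are consecutive and the letter of their common region is read at \<open>b'\<close>; the lift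
    there is then known exactly and fits both laps.\<close>
  have step: "Inv k' b'" if st: "Inv k b" "node k b x" "node k' b' x" "x \<in> L" for k b k' b' x
  proof -
    have bb: "b \<le> Suc b'" "b' \<le> Suc b"
      using tube_disjoint[OF W, of b b'] that(2,3) unfolding node_def by blast+
    obtain i i' where i: "s k \<le> i" "i \<le> s (Suc k)" "\<psi> x \<in> Z i" and i': "s k' \<le> i'" "i' \<le> s (Suc k')" "\<psi> x \<in> Z i'"
      using st by (auto simp: node_def)
    have kM: "k < M" "k' < M" using that by (auto simp: node_def)
    have bm: "b \<le> m" "b' \<le> m" "\<phi> x \<in> W b" "\<phi> x \<in> W b'" using that by (auto simp: node_def)
    have ii: "i \<le> Suc i'" "i' \<le> Suc i"
      using tube_disjoint[OF Z, of i i'] Zq[OF i(2) kM(1)] Zq[OF i'(2) kM(2)] i(3) i'(3) by blast+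
    \<comment> \<open>Adjacent indices of \<open>Z\<close> in different laps force the point into
      the milestone between the laps. Skipping a whole lap would put it into two regions
      \<open>A\<close> at once.\<close>
    have cross: "\<psi> x \<in> Z (s (Suc a)) \<and> c = Suc a"
      if ac: "a < c" "c < M" "i \<le> s (Suc a)" "s c \<le> i'" "i' \<le> Suc i" "\<psi> x \<in> Z i" "\<psi> x \<in> Z i'" for a c i i'
    proof -
      have "s (Suc a) + (c - Suc a) \<le> s c" using smono[of "Suc a" c] ac by simp
      then consider "c = Suc a" "i = s (Suc a) \<or> i' = s (Suc a)" | "c = Suc (Suc a)" "i = s (Suc a)" "i' = s c"
        using ac by linarith
      then show ?thesis
      proof cases
        case 1 then show ?thesis using ac by auto
      next
        case 2
        then have "\<psi> x \<in> A (Suc a mod 3)" "\<psi> x \<in> A (Suc (Suc a) mod 3)"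
          using ac sA[of "Suc a"] sA[of "Suc (Suc a)"] by auto
        moreover have "Suc a mod 3 \<noteq> Suc (Suc a) mod 3" by presburger
        ultimately show ?thesis using AB(1) AB(2)[of "Suc a mod 3" "Suc (Suc a) mod 3"] by force
      qed
    qed
    consider "k = k'" | "k < k'" | "k' < k" by linarith
    then show ?thesis
    proof cases
      case 1 then show ?thesis using stepb[OF that(1) _ that(4) bb] that(3) by blast
    next
      case 2
      then have *: "\<psi> x \<in> Z (s (Suc k))" "k' = Suc k" using cross[of k k' i i'] kM i i' ii by auto
      then have Cb: "C b (int k')" "C b' (int k')" using Ccross bm that(4) kM by auto
      have "node k b' x" using that(2) bm by (simp add: node_def)
      then have "Inv k b'" using stepb[OF that(1) _ that(4) bb] by blast
      then have "?l b' = int k' + D" using letter Cb(2) *(2) by blast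
      moreover have "\<not> C b' (int k' + 2)" by (rule other[OF Cb(2)]) presburger
      ultimately show ?thesis by (auto simp: Inv_def intro!: exI[of _ b'])
    next
      case 3
      then have *: "\<psi> x \<in> Z (s (Suc k'))" "k = Suc k'" using cross[of k' k i' i] kM i i' ii by auto
      then have Cb: "C b (int k)" "C b' (int k)" using Ccross[OF bm(1) that(4) bm(3)] Ccross[OF bm(2) that(4) bm(4)] kM by auto
      have "node k b' x" using that(2) bm by (simp add: node_def)
      then have "Inv k b'" using stepb[OF that(1) _ that(4) bb] by blast
      then obtain c where c: "?l c \<in> {int k + D, int k + D + 1}"
        "\<And>x. min b' c \<le> x \<Longrightarrow> x \<le> max b' c \<Longrightarrow> \<not> C x (int k + 2)"
        by (auto simp: Inv_def)
      have "?l b' \<in> {int k + D, int k + D + 1}"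
      proof (rule lift_word_letter[OF c(1)])
        show "C b' (int k + D) \<or> C b' (int k + D + 1)" using Cb(2) Ccong by blast
        show "\<not> C x (int k + D + 2)" if "min c b' \<le> x" "x \<le> max c b'" for x
          using c(2)[of x] that Ccong[of x "int k + 2"] by (simp add: algebra_simps min.commute max.commute)
      qed
      moreover have "?l b' mod 3 = int k mod 3" using lift_word_mod[OF Cb(2)] .
      moreover have "(int k + D + 1) mod 3 \<noteq> int k mod 3" using D3 by presburger
      ultimately have "?l b' = int k' + D + 1" using *(2) by auto
      moreover have "\<not> C b' (int k' + 2)" by (rule other[OF Cb(2)]) (simp add: *(2), presburger)
      ultimately show ?thesis by (auto simp: Inv_def intro!: exI[of _ b'])
    qed
  qed
  have oW: "openin X (W b)" if "b \<le> m" for b using W that by (simp add: tube_def)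
  have oZ: "openin X (Z i)" if "i \<le> q" for i using Z that by (simp add: tube_def)
  define E where "E p = (\<Union>i\<in>{s (fst p)..s (Suc (fst p))}. {x \<in> topspace X. \<psi> x \<in> Z i}) \<inter> {x \<in> topspace X. \<phi> x \<in> W (snd p)}" for p
  have oE: "openin X (E p)" if "fst p < M" "snd p \<le> m" for p
    unfolding E_def
  proof (intro openin_Int openin_Union)
    show "openin X {x \<in> topspace X. \<phi> x \<in> W (snd p)}" using openin_continuous_map_preimage[OF \<phi> oW] that by blast
    fix S assume "S \<in> (\<lambda>i. {x \<in> topspace X. \<psi> x \<in> Z i}) ` {s (fst p)..s (Suc (fst p))}"
    then show "openin X S" using openin_continuous_map_preimage[OF \<psi> oZ] Zq that(1) by auto
  qed
  have LX: "L \<subseteq> topspace X" using L connectedin_subset_topspace by blast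
  have nodeE: "node k b x \<longleftrightarrow> x \<in> E (k, b)" if "x \<in> L" "k < M" "b \<le> m" for k b x
    using that LX by (auto simp: node_def E_def)
  \<comment> \<open>The points at nodes in phase, and those at nodes out of phase or over the
    stretch up to \<open>s 0\<close>, form open sets covering \<open>L\<close>. The far end belongs
    to the first, a point over \<open>Z 0\<close> to the second, so some point lies in both; by
    \<open>step\<close> it is over the stretch up to \<open>s 0\<close>, which leaves
    \<open>k \<le> 1\<close>.\<close>
  let ?P = "\<Union>(E ` {p. fst p < M \<and> snd p \<le> m \<and> Inv (fst p) (snd p)})"
  let ?N = "\<Union>(E ` {p. fst p < M \<and> snd p \<le> m \<and> \<not> Inv (fst p) (snd p)}) \<union> (\<Union>i\<in>{..s 0}. {x \<in> topspace X. \<psi> x \<in> Z i})"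
  have s0q: "s 0 \<le> q" using smono[of 0 M] s(2) by simp
  have "?P \<inter> ?N \<inter> L \<noteq> {}"
  proof
    assume empty: "?P \<inter> ?N \<inter> L = {}"
    show False
    proof (rule connectedinD[OF L _ _ _ empty])
      show "openin X ?P" using oE by (intro openin_Union) auto
      show "openin X ?N" using oE openin_continuous_map_preimage[OF \<psi> oZ] s0q by (intro openin_Un openin_Union) auto
      show "L \<subseteq> ?P \<union> ?N"
      proof
        fix x assume x: "x \<in> L"
        obtain i where i: "i \<le> q" "\<psi> x \<in> Z i" using \<psi>L[OF x] by blast
        obtain b where b: "b \<le> m" "\<phi> x \<in> W b" using \<phi>L[OF x] by blast
        show "x \<in> ?P \<union> ?N"
        proof (cases "i \<le> s 0")
          case True then show ?thesis using i x LX by auto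
        next
          case False
          define k where "k = (LEAST k. i \<le> s (Suc k))"
          have "i \<le> s (Suc (M - 1))" using i s(2) M by simp
          then have k: "i \<le> s (Suc k)" "k \<le> M - 1" unfolding k_def by (rule LeastI, rule Least_le)
          have "s k \<le> i"
          proof (cases k)
            case 0 then show ?thesis using False by simp
          next
            case (Suc j)
            then have "\<not> i \<le> s (Suc j)" unfolding k_def using not_less_Least by (metis lessI)
            then show ?thesis using Suc by simp
          qed
          then have "node k b x" using k b i M by (auto simp: node_def)
          moreover have "k < M" using k(2) M by linarith
          ultimately have "x \<in> E (k, b)" using nodeE x b(1) by blast
          then show ?thesis using \<open>k < M\<close> b(1) by (cases "Inv k b") force+
        qed
      qed
      have "Suc (M - 1) = M" using M by simp
      have "node (M - 1) b1 x1" using x1 b1 M s(2) s(1)[of "M - 1"] unfolding node_def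
        by (auto intro!: exI[of _ q])
      then have x1E: "x1 \<in> E (M - 1, b1)" using nodeE x1 b1 M by simp
      have "Inv (M - 1) b1"
        unfolding Inv_def
      proof (intro exI[of _ b1] conjI allI impI)
        show "?l b1 \<in> {int (M - 1) + D, int (M - 1) + D + 1}" using M by (simp add: D_def of_nat_diff)
        fix x assume "min b1 b1 \<le> x" "x \<le> max b1 b1"
        moreover have "\<not> C b1 (int (M - 1) + 2)" by (rule other[OF Cb1]) (use M in \<open>simp add: of_nat_diff, presburger\<close>)
        ultimately show "\<not> C x (int (M - 1) + 2)" by simp
      qed
      then have "x1 \<in> ?P" using x1E b1(1) M by (intro UN_I[of "(M - 1, b1)"]) auto
      then show "?P \<inter> L \<noteq> {}" using x1 by blast
      obtain x where "x \<in> L" "\<psi> x \<in> Z 0" using meets[of 0] by blast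
      then show "?N \<inter> L \<noteq> {}" using LX by auto
    qed
  qed
  then obtain x where x: "x \<in> L" "x \<in> ?N" and xP: "x \<in> ?P" by (meson IntE ex_in_conv)
  from xP obtain k b where kb: "x \<in> E (k, b)" "k < M" "b \<le> m" "Inv k b" by auto
  have nd: "node k b x" using nodeE kb x(1) by blast
  have "k \<le> 1"
  proof -
    consider k' b' where "x \<in> E (k', b')" "k' < M" "b' \<le> m" "\<not> Inv k' b'"
      | i where "i \<le> s 0" "\<psi> x \<in> Z i"
      using x(2) by auto
    then show ?thesis
    proof cases
      case 1 then show ?thesis using step[OF kb(4) nd _ x(1)] nodeE x(1) by blast
    next
      case (2 i)
      obtain i' where i': "s k \<le> i'" "i' \<le> s (Suc k)" "\<psi> x \<in> Z i'" using nd by (auto simp: node_def)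
      then have "i' \<le> Suc i"
        using tube_disjoint(2)[OF Z, of i i'] Zq[OF i'(2) kb(2)] 2 s0q by auto
      then have "s k \<le> Suc (s 0)" using i' 2 by simp
      then show ?thesis using smono[of 0 k] kb(2) by simp
    qed
  qed
  moreover obtain c where "?l c \<in> {int k + D, int k + D + 1}" using kb(4) by (auto simp: Inv_def)
  \<comment> \<open>So the lift changes by at least \<open>M - 2\<close> between \<open>c\<close>
    and \<open>b1\<close>, whereas two of its values differ by at most
    \<open>2 * r + 6\<close>.\<close>
  ultimately have "?l c \<le> D + 2" by auto
  then have "?l c \<le> ?l b1 - int M + 2" by (simp add: D_def)
  then show False using bound[of c] bound[of b1] M by linarith
qed

section \<open>Meager orbits\<close>

text \<open>A uniform scale without a metric. Two buffers \<open>P j\<close> and \<open>Q j\<close>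
  are inserted between \<open>K j\<close> and \<open>B j\<close>; a member of the cover meeting one
  closed set of the nest lies in the next open one. Three members occur because
  \<open>zigzag_incompatible\<close> passes from \<open>\<psi> x\<close> to \<open>\<phi> x\<close>,
  \<open>\<phi> y\<close> and \<open>\<psi> y\<close>.\<close>

lemma scale_cover:
  assumes fin: "finite I" and KB': "\<forall>j\<in>I. closedin X (K j) \<and> openin X (B j) \<and> K j \<subseteq> B j"
  shows "\<exists>\<A>. (\<forall>A\<in>\<A>. openin X A) \<and> topspace X \<subseteq> \<Union>\<A> \<and>
    (\<forall>A1\<in>\<A>. \<forall>A2\<in>\<A>. \<forall>A3\<in>\<A>. \<forall>j\<in>I. A1 \<inter> K j \<noteq> {} \<longrightarrow> A1 \<inter> A2 \<noteq> {} \<longrightarrow> A2 \<inter> A3 \<noteq> {} \<longrightarrow> A3 \<subseteq> B j)"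
proof -
  have K: "closedin X (K j)" and B: "openin X (B j)" and KB: "K j \<subseteq> B j" if "j \<in> I" for j
    using KB' that by blast+
  have "\<exists>P. openin X P \<and> K j \<subseteq> P \<and> X closure_of P \<subseteq> B j" if "j \<in> I" for j
    using closure_shrink[OF K[OF that] B[OF that] KB[OF that]] by metis
  then obtain P where P: "\<And>j. j \<in> I \<Longrightarrow> openin X (P j) \<and> K j \<subseteq> P j \<and> X closure_of (P j) \<subseteq> B j" by metis
  have "\<exists>Q. openin X Q \<and> X closure_of (P j) \<subseteq> Q \<and> X closure_of Q \<subseteq> B j" if "j \<in> I" for j
    using closure_shrink[OF closedin_closure_of B[OF that], of "P j"] P[OF that] by metis
  then obtain Q where Q: "\<And>j. j \<in> I \<Longrightarrow> openin X (Q j) \<and> X closure_of (P j) \<subseteq> Q j \<and> X closure_of (Q j) \<subseteq> B j" by metis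
  define \<P> where "\<P> = (\<Union>j\<in>I. {(K j, P j), (X closure_of (P j), Q j), (X closure_of (Q j), B j)})"
  have \<P>: "closedin X (fst p)" "openin X (snd p)" "fst p \<subseteq> snd p" if "p \<in> \<P>" for p
  proof -
    obtain j where j: "j \<in> I" and "p \<in> {(K j, P j), (X closure_of (P j), Q j), (X closure_of (Q j), B j)}"
      using \<open>p \<in> \<P>\<close> by (auto simp: \<P>_def)
    then have "closedin X (fst p) \<and> openin X (snd p) \<and> fst p \<subseteq> snd p"
      using K[OF j] B[OF j] P[OF j] Q[OF j] by auto
    then show "closedin X (fst p)" "openin X (snd p)" "fst p \<subseteq> snd p" by auto
  qed
  have fP: "finite \<P>" using fin by (simp add: \<P>_def)
  define \<A> where "\<A> = {A. openin X A \<and> (\<forall>p\<in>\<P>. A \<inter> fst p = {} \<or> A \<subseteq> snd p)}"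
  show ?thesis
  proof (intro exI[of _ \<A>] conjI ballI impI)
    show "openin X A" if "A \<in> \<A>" for A using that by (simp add: \<A>_def)
    show "topspace X \<subseteq> \<Union>\<A>"
    proof
      fix x assume x: "x \<in> topspace X"
      let ?A = "\<Inter>(insert (topspace X) ((\<lambda>p. if x \<in> snd p then snd p else topspace X - fst p) ` \<P>))"
      have "openin X ?A" using fP \<P>(1,2) by (intro openin_Inter) auto
      moreover have "?A \<inter> fst p = {} \<or> ?A \<subseteq> snd p" if "p \<in> \<P>" for p
      proof -
        have "?A \<subseteq> (if x \<in> snd p then snd p else topspace X - fst p)" using that by blast
        then show ?thesis by (auto split: if_splits)
      qed
      moreover have "x \<in> ?A" using x \<P>(3) by auto
      ultimately show "x \<in> \<Union>\<A>" unfolding \<A>_def by blast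
    qed
    fix A1 A2 A3 j assume A: "A1 \<in> \<A>" "A2 \<in> \<A>" "A3 \<in> \<A>" and j: "j \<in> I" and meet: "A1 \<inter> K j \<noteq> {}" "A1 \<inter> A2 \<noteq> {}" "A2 \<inter> A3 \<noteq> {}"
    have mem: "(K j, P j) \<in> \<P>" "(X closure_of (P j), Q j) \<in> \<P>" "(X closure_of (Q j), B j) \<in> \<P>"
      using j by (auto simp: \<P>_def)
    have cl: "P j \<subseteq> X closure_of (P j)" "Q j \<subseteq> X closure_of (Q j)"
      using P[OF j] Q[OF j] by (simp_all add: closure_of_subset openin_subset)
    have rule: "A \<inter> fst p = {} \<or> A \<subseteq> snd p" if "A \<in> \<A>" "p \<in> \<P>" for A p using that by (simp add: \<A>_def)
    have "A1 \<subseteq> P j" using rule[OF A(1) mem(1)] meet(1) by simp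
    then have "A2 \<subseteq> Q j" using rule[OF A(2) mem(2)] meet(2) cl by auto
    then show "A3 \<subseteq> B j" using rule[OF A(3) mem(3)] meet(3) cl by auto
  qed
qed

lemma continuum_in_open:
  assumes U: "openin X U" "connectedin X U" and xy: "x \<in> U" "y \<in> U"
  obtains E where "closedin X E" "connectedin X E" "x \<in> E" "y \<in> E" "E \<subseteq> U"
proof -
  have "(x, y) \<in> {(u, v). \<exists>S\<in>small_pieces U {topspace X}. u \<in> S \<and> v \<in> S}\<^sup>*"
    using linked_by_small_pieces[OF U _ _ xy, of "{topspace X}"] openin_subset[OF U(1)] by auto
  then have "\<exists>E. closedin X E \<and> connectedin X E \<and> x \<in> E \<and> y \<in> E \<and> E \<subseteq> U"
  proof (induction rule: rtrancl_induct)
    case base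
    have "x \<in> topspace X" using xy openin_subset[OF U(1)] by blast
    then show ?case using xy t1 by (intro exI[of _ "{x}"]) (auto simp: t1_space_closedin_singleton)
  next
    case (step u v)
    then obtain E S where E: "closedin X E" "connectedin X E" "x \<in> E" "u \<in> E" "E \<subseteq> U"
      and S: "S \<in> small_pieces U {topspace X}" "u \<in> S" "v \<in> S" by blast
    have S': "closedin X S" "connectedin X S" "S \<subseteq> U"
      using S(1) by (auto simp: small_pieces_def nonseparating_def)
    have "connectedin X (E \<union> S)" using E S S' by (intro connectedin_Un) auto
    moreover have "closedin X (E \<union> S)" using E(1) S'(1) by (rule closedin_Un)
    ultimately show ?case using E S S' by (intro exI[of _ "E \<union> S"]) auto
  qed
  then show thesis using that by blast
qed

lemma finite_nonseparating: "finite P \<Longrightarrow> P \<subseteq> topspace X \<Longrightarrow> nonseparating X P"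
  using nonseparating_UN[of P X "\<lambda>x. {x}"] nonseparating_singleton by auto

text \<open>\<open>Y i j\<close> is a corridor between regions \<open>i\<close> and
  \<open>j\<close>, grown around a continuum that joins two of four points and misses the others.
  \<open>B k\<close> is what remains outside the closed corridors not ending at \<open>k\<close>,
  and \<open>A k\<close> is shrunk into all corridors ending there.\<close>

lemma four_regions:
  "\<exists>(A :: nat \<Rightarrow> 'a set) B Y.
    (\<forall>k<4. openin X (A k) \<and> A k \<noteq> {} \<and> openin X (B k) \<and> X closure_of (A k) \<subseteq> B k) \<and>
    (\<forall>i<4. \<forall>j<4. i \<noteq> j \<longrightarrow> openin X (Y i j) \<and> connectedin X (Y i j) \<and> A i \<subseteq> Y i j \<and> A j \<subseteq> Y i j) \<and>
    (\<forall>i<4. \<forall>j<4. \<forall>k<4. i \<noteq> j \<longrightarrow> k \<noteq> i \<longrightarrow> k \<noteq> j \<longrightarrow> Y i j \<inter> B k = {})"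
proof -
  have "infinite (topspace X)"
  proof
    assume "finite (topspace X)"
    then have "topspace X - topspace X \<noteq> {}"
      using open_diff_nonseparating[OF openin_topspace nonempty] finite_nonseparating by blast
    then show False by simp
  qed
  then obtain p :: "nat \<Rightarrow> 'a" where inj: "inj p" and pX: "range p \<subseteq> topspace X"
    using infinite_countable_subset by blast
  have pne: "p i \<noteq> p j" if "i \<noteq> j" for i j using inj that by (simp add: inj_eq)
  have px: "p i \<in> topspace X" for i using pX by blast
  define V where "V i j = topspace X - p ` ({..<4} - {i, j})" for i j
  have ns: "nonseparating X (p ` ({..<4} - {i, j}))" for i j
    using pX by (intro finite_nonseparating) auto
  have V: "openin X (V i j)" "connectedin X (V i j)" for i j
    using ns[of i j] connected nonempty openin_topspace[of X]
    unfolding V_def nonseparating_def connectedin_topspace[symmetric] by auto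
  have Vp: "p i \<in> V i j" "p j \<in> V i j" for i j using px pne unfolding V_def by (auto dest: injD[OF inj])
  have "\<exists>Y. openin X Y \<and> connectedin X Y \<and> p i \<in> Y \<and> p j \<in> Y \<and> X closure_of Y \<subseteq> V i j" for i j
  proof -
    obtain E where E: "closedin X E" "connectedin X E" "p i \<in> E" "p j \<in> E" "E \<subseteq> V i j"
      using continuum_in_open[OF V Vp] by metis
    obtain N where N: "openin X N" "E \<subseteq> N" "X closure_of N \<subseteq> V i j"
      using closure_shrink[OF E(1) V(1) E(5)] by metis
    have "E \<noteq> {}" using E by blast
    then obtain Y where Y: "openin X Y" "connectedin X Y" "E \<subseteq> Y" "Y \<subseteq> N"
      using connected_nbhd[OF E(2) _ N(2,1)] by metis
    have "X closure_of Y \<subseteq> V i j" using closure_of_mono[OF Y(4)] N(3) by (rule order_trans)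
    then show ?thesis using Y E by blast
  qed
  then obtain Y where Y: "\<And>i j. openin X (Y i j) \<and> connectedin X (Y i j) \<and> p i \<in> Y i j \<and> p j \<in> Y i j \<and>
     X closure_of (Y i j) \<subseteq> V i j"
    by metis
  define B where "B k = topspace X - (\<Union>q\<in>{..<4} \<times> {..<4} \<inter> {q. k \<noteq> fst q \<and> k \<noteq> snd q}. X closure_of (Y (fst q) (snd q)))" for k
  have oB: "openin X (B k)" for k unfolding B_def
    by (intro openin_diff openin_topspace closedin_Union) auto
  have pB: "p k \<in> B k" if "k < 4" for k
  proof -
    have "p k \<notin> X closure_of (Y i j)" if "k \<noteq> i" "k \<noteq> j" for i j
      using Y[of i j] that \<open>k < 4\<close> unfolding V_def by blast
    then show ?thesis using px by (auto simp: B_def)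
  qed
  define D where "D k = \<Inter>({B k} \<union> (\<lambda>j. Y k j) ` {..<4} \<union> (\<lambda>j. Y j k) ` {..<4})" for k
  have oD: "openin X (D k)" for k unfolding D_def using oB Y by (intro openin_Inter) auto
  have pD: "p k \<in> D k" if "k < 4" for k using pB[OF that] Y by (auto simp: D_def)
  have "\<exists>A. openin X A \<and> p k \<in> A \<and> X closure_of A \<subseteq> D k" if "k < 4" for k
  proof -
    have "closedin X {p k}" "{p k} \<subseteq> D k" using px t1 pD[OF that] by (auto simp: t1_space_closedin_singleton)
    then show ?thesis using closure_shrink[OF _ oD, of "{p k}"] by (metis insert_subset)
  qed
  then obtain A where A: "\<And>k. k < 4 \<Longrightarrow> openin X (A k) \<and> p k \<in> A k \<and> X closure_of (A k) \<subseteq> D k" by metis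
  have AD: "A k \<subseteq> D k" if "k < 4" for k
    using A[OF that] closure_of_subset[OF openin_subset] by blast
  have 1: "openin X (A k) \<and> A k \<noteq> {} \<and> openin X (B k) \<and> X closure_of (A k) \<subseteq> B k" if "k < 4" for k
  proof -
    have "D k \<subseteq> B k" by (auto simp: D_def)
    then show ?thesis using A[OF that] oB by blast
  qed
  have 2: "openin X (Y i j) \<and> connectedin X (Y i j) \<and> A i \<subseteq> Y i j \<and> A j \<subseteq> Y i j" if "i < 4" "j < 4" for i j
  proof -
    have "D i \<subseteq> Y i j" "D j \<subseteq> Y i j" using that by (auto simp: D_def)
    then show ?thesis using Y AD that by blast
  qed
  have 3: "Y i j \<inter> B k = {}" if "i < 4" "j < 4" "k \<noteq> i" "k \<noteq> j" for i j k
  proof -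
    have "Y i j \<subseteq> X closure_of (Y i j)" using Y closure_of_subset[OF openin_subset] by blast
    moreover have "X closure_of (Y i j) \<inter> B k = {}" using that by (force simp: B_def)
    ultimately show ?thesis by blast
  qed
  show ?thesis
    using 1 2 3 by (intro exI[of _ A] exI[of _ B] exI[of _ Y]) simp
qed

text \<open>One use of \<open>hosted_extend\<close> inside a corridor spells one more letter of
  \<open>w\<close>; \<open>s k\<close> marks the host where letter \<open>k\<close> is reached. This
  host counts for both adjacent laps, as its region lies in both corridors.\<close>

lemma zigzag_extend:
  assumes h: "hosted \<A> m J H" and \<A>': "\<forall>A\<in>\<A>. openin X A" "topspace X \<subseteq> \<Union>\<A>"
    and H0: "H m \<subseteq> A (w 0)"
    and A: "\<And>k. openin X (A (w k)) \<and> A (w k) \<noteq> {}"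
    and Y: "\<And>k. openin X (Y (w k) (w (Suc k))) \<and> connectedin X (Y (w k) (w (Suc k))) \<and>
      A (w k) \<subseteq> Y (w k) (w (Suc k)) \<and> A (w (Suc k)) \<subseteq> Y (w k) (w (Suc k))"
  shows "\<exists>n J' H' s. hosted \<A> n J' H' \<and> extends m J H n J' H' \<and> s M = n \<and> (\<forall>k<M. s k < s (Suc k)) \<and>
    (\<forall>k\<le>M. H' (s k) \<subseteq> A (w k)) \<and>
    (\<forall>k<M. \<forall>i. s k \<le> i \<longrightarrow> i \<le> s (Suc k) \<longrightarrow> H' i \<subseteq> Y (w k) (w (Suc k))) \<and>
    (\<forall>i. m < i \<longrightarrow> i \<le> n \<longrightarrow> (\<exists>k. H' i \<subseteq> Y (w k) (w (Suc k))))"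
proof (induction M)
  case 0
  show ?case
    using h H0 by (intro exI[of _ m] exI[of _ J] exI[of _ H] exI[of _ "\<lambda>_. m"]) (auto simp: extends_def)
next
  case (Suc M)
  then obtain n J' H' s where n: "hosted \<A> n J' H'" "extends m J H n J' H'" "s M = n"
    "\<And>k. k < M \<Longrightarrow> s k < s (Suc k)" "\<And>k. k \<le> M \<Longrightarrow> H' (s k) \<subseteq> A (w k)"
    "\<And>k i. k < M \<Longrightarrow> s k \<le> i \<Longrightarrow> i \<le> s (Suc k) \<Longrightarrow> H' i \<subseteq> Y (w k) (w (Suc k))"
    "\<And>i. m < i \<Longrightarrow> i \<le> n \<Longrightarrow> \<exists>k. H' i \<subseteq> Y (w k) (w (Suc k))"
    by (elim exE conjE) blast
  have \<A>: "\<And>A. A \<in> \<A> \<Longrightarrow> openin X A" "topspace X \<subseteq> \<Union>\<A>" using \<A>' by auto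
  let ?Y = "Y (w M) (w (Suc M))" and ?A = "A (w (Suc M))"
  have H'n: "H' n \<subseteq> A (w M)" using n(3) n(5)[of M] by simp
  have JY: "J' n \<subseteq> ?Y" using n(1) H'n Y[of M] by (force simp: hosted_def)
  have oY: "openin X ?Y" "connectedin X ?Y" and oA: "openin X ?A" "?A \<inter> ?Y \<noteq> {}"
    using Y[of M] A[of "Suc M"] by blast+
  obtain n' J'' H'' where n': "n < n'" "hosted \<A> n' J'' H''" "extends n J' H' n' J'' H''"
    "\<And>i. n < i \<Longrightarrow> i \<le> n' \<Longrightarrow> H'' i \<subseteq> ?Y" "H'' n' \<subseteq> ?A"
    using hosted_extend[OF n(1) \<A> oY JY oA] by blast
  define s' where "s' = s(Suc M := n')"
  have eq: "H'' i = H' i" if "i \<le> n" for i using n'(3) that by (simp add: extends_def)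
  have sn: "s k \<le> n" if "k \<le> M" for k
    using that
  proof (induction rule: inc_induct)
    case (step k) then show ?case using n(4)[of k] by simp
  qed (use n(3) in simp)
  show ?case
  proof (rule exI[of _ n'], rule exI[of _ J''], rule exI[of _ H''], rule exI[of _ s'], intro conjI allI impI)
    show "hosted \<A> n' J'' H''" by fact
    show "extends m J H n' J'' H''" using extends_trans n(2) n'(3) by blast
    show "s' (Suc M) = n'" by (simp add: s'_def)
    show "s' k < s' (Suc k)" if "k < Suc M" for k
      using that n(3,4) n'(1) by (cases "k = M") (auto simp: s'_def)
    show "H'' (s' k) \<subseteq> A (w k)" if "k \<le> Suc M" for k
      using that n(5)[of k] n'(5) eq[of "s k"] sn[of k] by (cases "k = Suc M") (auto simp: s'_def)
    show "H'' i \<subseteq> Y (w k) (w (Suc k))" if "k < Suc M" "s' k \<le> i" "i \<le> s' (Suc k)" for k i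
    proof (cases "k = M")
      case True
      show ?thesis
      proof (cases "i = n")
        case True then show ?thesis using \<open>k = M\<close> eq[of n] H'n Y[of M] by auto
      next
        case False
        then show ?thesis using \<open>k = M\<close> that n(3) n'(4) by (simp add: s'_def)
      qed
    next
      case False
      then have "k < M" "i \<le> n" using that sn[of "Suc k"] by (auto simp: s'_def)
      then show ?thesis using that n(6)[of k i] eq[of i] by (simp add: s'_def)
    qed
    show "\<exists>k. H'' i \<subseteq> Y (w k) (w (Suc k))" if "m < i" "i \<le> n'" for i
    proof (cases "i \<le> n")
      case True then show ?thesis using n(7)[of i] eq[of i] that by simp
    next
      case False then show ?thesis using n'(4)[of i] that by auto
    qed
  qed
qed

text \<open>Renaming regions by \<open>\<sigma>\<close> turns the word along \<open>Z\<close> into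
  \<open>0, 1, 2\<close> repeated and gives the letter \<open>2\<close> to the region avoided by the
  far part of \<open>W\<close>; this is the setting of \<open>no_common_word\<close>.\<close>

lemma zigzag_incompatible:
  assumes L: "connectedin X L" and \<phi>: "continuous_map X X \<phi>" and \<psi>: "continuous_map X X \<psi>"
    and near: "\<And>x. x \<in> L \<Longrightarrow> \<exists>S\<in>\<A>. \<phi> x \<in> S \<and> \<psi> x \<in> S"
    and scale: "\<And>A1 A2 A3 j. A1 \<in> \<A> \<Longrightarrow> A2 \<in> \<A> \<Longrightarrow> A3 \<in> \<A> \<Longrightarrow> j < 4 \<Longrightarrow> A1 \<inter> A j \<noteq> {} \<Longrightarrow> A1 \<inter> A2 \<noteq> {} \<Longrightarrow>
       A2 \<inter> A3 \<noteq> {} \<Longrightarrow> A3 \<subseteq> B j"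
    and W: "tube m W" "\<And>i. i \<le> m \<Longrightarrow> W i \<subseteq> H i" "hosted \<A> m J H"
    and Z: "tube q Z" "\<And>i. i \<le> q \<Longrightarrow> Z i \<subseteq> H' i"
    and \<phi>L: "\<phi> ` L \<subseteq> (\<Union>i\<le>m. W i)" and \<psi>L: "\<psi> ` L \<subseteq> (\<Union>i\<le>q. Z i)" "\<And>i. i \<le> q \<Longrightarrow> \<psi> ` L \<inter> Z i \<noteq> {}"
    and AB: "\<And>k. k < 4 \<Longrightarrow> A k \<subseteq> B k" "\<And>i j. i < 4 \<Longrightarrow> j < 4 \<Longrightarrow> i \<noteq> j \<Longrightarrow> A i \<inter> B j = {}"
    and YB: "\<And>i j k. i < 4 \<Longrightarrow> j < 4 \<Longrightarrow> i \<noteq> j \<Longrightarrow> k < 4 \<Longrightarrow> k \<noteq> i \<Longrightarrow> k \<noteq> j \<Longrightarrow> Y i j \<inter> B k = {}"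
    and \<sigma>: "inj_on \<sigma> {..<3}" "\<And>j. j < 3 \<Longrightarrow> \<sigma> j < (4::nat)"
    and avoid: "\<And>b. r < b \<Longrightarrow> b \<le> m \<Longrightarrow> H b \<inter> B (\<sigma> 2) = {}"
    and s: "\<And>k. k < M \<Longrightarrow> s k < s (Suc k)" "s M = q"
    and sA: "\<And>k. k \<le> M \<Longrightarrow> H' (s k) \<subseteq> A (\<sigma> (k mod 3))"
    and sY: "\<And>k i. k < M \<Longrightarrow> s k \<le> i \<Longrightarrow> i \<le> s (Suc k) \<Longrightarrow> H' i \<subseteq> Y (\<sigma> (k mod 3)) (\<sigma> (Suc k mod 3))"
    and M: "2 * r + 10 < M"
  shows False
proof (rule no_common_word[where A = "\<lambda>j. if j < 3 then A (\<sigma> j) else {}" and B = "\<lambda>j. if j < 3 then B (\<sigma> j) else {}",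
      OF L \<phi> \<psi> W(1) Z(1) _ _ _ _ _ _ _ _ s _ _ M])
  have inj: "\<sigma> i \<noteq> \<sigma> j" if "i < 3" "j < 3" "i \<noteq> j" for i j
    using \<sigma>(1) that by (auto dest: inj_onD)
  show "\<phi> x \<in> (\<Union>i\<le>m. W i)" "\<psi> x \<in> (\<Union>i\<le>q. Z i)" if "x \<in> L" for x
    using \<phi>L \<psi>L(1) that by blast+
  show "\<exists>x\<in>L. \<psi> x \<in> Z i" if "i \<le> q" for i using \<psi>L(2)[OF that] by blast
  show "(if j < 3 then A (\<sigma> j) else {}) \<subseteq> (if j < 3 then B (\<sigma> j) else {})" for j
    using AB(1) \<sigma>(2) by simp
  show "(if i < 3 then A (\<sigma> i) else {}) \<inter> (if j < 3 then B (\<sigma> j) else {}) = {}" if "i < 3" "j < 3" "i \<noteq> j" for i j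
    using AB(2)[OF \<sigma>(2) \<sigma>(2) inj] that by simp
  show "\<psi> y \<in> (if j < 3 then B (\<sigma> j) else {})"
    if b: "b \<le> m" "x \<in> L" "y \<in> L" "\<phi> x \<in> W b" "\<phi> y \<in> W b" "j < 3" "\<psi> x \<in> (if j < 3 then A (\<sigma> j) else {})" for b x y j
  proof -
    \<comment> \<open>\<open>S1\<close> contains \<open>\<phi> x\<close> and
      \<open>\<psi> x\<close>, the host of \<open>b\<close> contains \<open>\<phi> x\<close> and
      \<open>\<phi> y\<close>, and \<open>S3\<close> contains \<open>\<phi> y\<close> and
      \<open>\<psi> y\<close>: three successive members, as \<open>scale\<close> allows.\<close>
    obtain S1 S3 where S1: "S1 \<in> \<A>" "\<phi> x \<in> S1" "\<psi> x \<in> S1" and S3: "S3 \<in> \<A>" "\<phi> y \<in> S3" "\<psi> y \<in> S3"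
      using near b(2,3) by meson
    obtain S2 where S2: "S2 \<in> \<A>" "H b \<subseteq> S2" using W(3) b(1) by (auto simp: hosted_def)
    have xy2: "\<phi> x \<in> S2" "\<phi> y \<in> S2" using S2 W(2)[OF b(1)] b(4,5) by blast+
    have "S1 \<inter> A (\<sigma> j) \<noteq> {}" "S1 \<inter> S2 \<noteq> {}" "S2 \<inter> S3 \<noteq> {}"
      using S1 S3 xy2 b(6,7) by auto
    then have "S3 \<subseteq> B (\<sigma> j)" using scale[OF S1(1) S2(1) S3(1) \<sigma>(2)[OF b(6)]] by blast
    then show ?thesis using S3 b(6) by auto
  qed
  show "\<phi> x \<in> (if j < 3 then B (\<sigma> j) else {})" if x: "x \<in> L" "j < 3" "\<psi> x \<in> (if j < 3 then A (\<sigma> j) else {})" for x j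
  proof -
    obtain S1 where S1: "S1 \<in> \<A>" "\<phi> x \<in> S1" "\<psi> x \<in> S1" using near x(1) by meson
    have "S1 \<inter> A (\<sigma> j) \<noteq> {}" "S1 \<inter> S1 \<noteq> {}" using S1 x(2,3) by auto
    then have "S1 \<subseteq> B (\<sigma> j)" using scale[OF S1(1) S1(1) S1(1) \<sigma>(2)[OF x(2)]] by blast
    then show ?thesis using S1 x(2) by auto
  qed
  show "W b \<inter> (if 2 < 3 then B (\<sigma> 2) else {}) = {}" if "r < b" "b \<le> m" for b
    using avoid[OF that] W(2)[OF that(2)] by auto
  have smono: "s (Suc k) \<le> q" if "k < M" for k
    using Suc_leI[OF that] unfolding s(2)[symmetric]
  proof (induction rule: inc_induct)
    case (step n) then show ?case using s(1)[of n] by simp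
  qed simp
  have sq: "s k \<le> q" if "k \<le> M" for k
    using smono[of "k - 1"] s(1)[of 0] s(2) that M smono[of 0] by (cases k) auto
  show "Z (s k) \<subseteq> (if k mod 3 < 3 then A (\<sigma> (k mod 3)) else {})" if "k \<le> M" for k
    using Z(2)[OF sq[OF that]] sA[OF that] by auto
  show "Z i \<inter> (if (k + 2) mod 3 < 3 then B (\<sigma> ((k + 2) mod 3)) else {}) = {}"
    if k: "k < M" "s k \<le> i" "i \<le> s (Suc k)" for k i
  proof -
    have "k mod 3 \<noteq> Suc k mod 3" "(k + 2) mod 3 \<noteq> k mod 3" "(k + 2) mod 3 \<noteq> Suc k mod 3" by presburger+
    then have "Y (\<sigma> (k mod 3)) (\<sigma> (Suc k mod 3)) \<inter> B (\<sigma> ((k + 2) mod 3)) = {}"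
      using \<sigma>(2) by (intro YB inj) auto
    moreover have "Z i \<subseteq> Y (\<sigma> (k mod 3)) (\<sigma> (Suc k mod 3))"
      using Z(2)[of i] sY[OF k] smono[OF k(1)] k(3) by auto
    ultimately show ?thesis by auto
  qed
qed

text \<open>At the scale of \<open>\<A>\<close> a homeomorphism is described by finitely many pairs
  \<open>(b, A)\<close>, where \<open>A\<close> contains the image of the basic open set
  \<open>b\<close>. A finite subcover of \<open>\<A>\<close> keeps the descriptions countable, and
  maps sharing one are close at every point.\<close>

lemma homeo_countable_decomposition:
  assumes sc: "second_countable X" and \<A>: "\<And>A. A \<in> \<A> \<Longrightarrow> openin X A" "topspace X \<subseteq> \<Union>\<A>"
  obtains \<S> where "countable \<S>" "\<Union>\<S> = carrier (homeo_group X)"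
    "\<And>S f g x. S \<in> \<S> \<Longrightarrow> f \<in> S \<Longrightarrow> g \<in> S \<Longrightarrow> x \<in> topspace X \<Longrightarrow> \<exists>A\<in>\<A>. f x \<in> A \<and> g x \<in> A"
proof -
  obtain \<B> where B: "countable \<B>" "\<And>V. V \<in> \<B> \<Longrightarrow> openin X V"
    "\<And>U x. openin X U \<Longrightarrow> x \<in> U \<Longrightarrow> \<exists>V\<in>\<B>. x \<in> V \<and> V \<subseteq> U"
    using sc unfolding second_countable_def by metis
  have "\<exists>\<F>. finite \<F> \<and> \<F> \<subseteq> \<A> \<and> topspace X \<subseteq> \<Union>\<F>"
    using compactinD[of X "topspace X" \<A>] \<A> compact by (simp add: compact_space_def)
  then obtain \<F> where F: "finite \<F>" "\<F> \<subseteq> \<A>" "topspace X \<subseteq> \<Union>\<F>" by blast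
  define S where "S P = {f \<in> carrier (homeo_group X). \<forall>p\<in>P. f ` fst p \<subseteq> snd p}" for P :: "('a set \<times> 'a set) set"
  define \<I> where "\<I> = {P. P \<subseteq> \<B> \<times> \<F> \<and> finite P \<and> topspace X \<subseteq> \<Union>(fst ` P)}"
  have "countable {P. finite P \<and> P \<subseteq> \<B> \<times> \<F>}"
    using B(1) F(1) by (intro countable_Collect_finite_subset countable_SIGMA) (auto simp: countable_finite)
  then have cI: "countable \<I>" by (rule countable_subset[rotated]) (auto simp: \<I>_def)
  show thesis
  proof (rule that[of "S ` \<I>"])
    show "countable (S ` \<I>)" using cI by simp
    show "\<Union>(S ` \<I>) = carrier (homeo_group X)"
    proof
      show "carrier (homeo_group X) \<subseteq> \<Union>(S ` \<I>)"
      proof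
        fix f assume f: "f \<in> carrier (homeo_group X)"
        define P where "P = {(b, A). b \<in> \<B> \<and> A \<in> \<F> \<and> f ` b \<subseteq> A}"
        have cov: "topspace X \<subseteq> \<Union>(fst ` P)"
        proof
          fix x assume x: "x \<in> topspace X"
          then obtain A where A: "A \<in> \<F>" "f x \<in> A" using F(3) homeo_groupD(4)[OF f] by blast
          have "openin X {y \<in> topspace X. f y \<in> A}"
            using openin_continuous_map_preimage[OF homeo_groupD(1)[OF f]] A(1) F(2) \<A>(1) by blast
          then obtain b where b: "b \<in> \<B>" "x \<in> b" "b \<subseteq> {y \<in> topspace X. f y \<in> A}"
            using B(3)[of _ x] x A(2) by (metis (mono_tags, lifting) mem_Collect_eq)
          then have "(b, A) \<in> P" using A(1) by (auto simp: P_def)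
          then show "x \<in> \<Union>(fst ` P)" using b(2) by force
        qed
        have "\<And>U. U \<in> fst ` P \<Longrightarrow> openin X U" using B(2) by (auto simp: P_def)
        then have "\<exists>\<G>. finite \<G> \<and> \<G> \<subseteq> fst ` P \<and> topspace X \<subseteq> \<Union>\<G>"
          using compactinD[of X "topspace X" "fst ` P"] compact cov by (simp add: compact_space_def)
        then obtain Q where Q: "Q \<subseteq> P" "finite Q" "topspace X \<subseteq> \<Union>(fst ` Q)"
          by (metis (no_types, lifting) finite_subset_image)
        have "Q \<in> \<I>" using Q by (auto simp: \<I>_def P_def)
        moreover have "f ` fst p \<subseteq> snd p" if "p \<in> Q" for p
        proof -
          have "p \<in> P" using Q(1) that by blast
          then show ?thesis by (cases p) (simp add: P_def)
        qed
        then have "f \<in> S Q" using f by (simp add: S_def)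
        ultimately show "f \<in> \<Union>(S ` \<I>)" by blast
      qed
    qed (auto simp: S_def)
    fix T f g x assume T: "T \<in> S ` \<I>" "f \<in> T" "g \<in> T" and x: "x \<in> topspace X"
    then obtain P where P: "P \<in> \<I>" "f \<in> S P" "g \<in> S P" by blast
    then obtain b A where bA: "(b, A) \<in> P" "x \<in> b" using x by (force simp: \<I>_def)
    then have "f ` b \<subseteq> A" "g ` b \<subseteq> A" using P(2,3) by (fastforce simp: S_def)+
    then have "f x \<in> A" "g x \<in> A" using bA(2) by auto
    moreover have "A \<in> \<A>" using bA(1) P(1) F(2) by (auto simp: \<I>_def)
    ultimately show "\<exists>A\<in>\<A>. f x \<in> A \<and> g x \<in> A" by blast
  qed
qed

lemma homeo_orbit_meager:
  assumes sc: "second_countable X" and c: "c \<in> topspace (connected_chains X)"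
  shows "meager_in (connected_chains X) (orbit (homeo_group X) (chain_action X) c)"
proof -
  obtain A B :: "nat \<Rightarrow> 'a set" and Y :: "nat \<Rightarrow> nat \<Rightarrow> 'a set"
    where A0: "\<forall>k<4. openin X (A k) \<and> A k \<noteq> {} \<and> openin X (B k) \<and> X closure_of (A k) \<subseteq> B k"
    and Y0: "\<forall>i<4. \<forall>j<4. i \<noteq> j \<longrightarrow> openin X (Y i j) \<and> connectedin X (Y i j) \<and> A i \<subseteq> Y i j \<and> A j \<subseteq> Y i j"
    and YB0: "\<forall>i<4. \<forall>j<4. \<forall>k<4. i \<noteq> j \<longrightarrow> k \<noteq> i \<longrightarrow> k \<noteq> j \<longrightarrow> Y i j \<inter> B k = {}"
    using four_regions by (elim exE conjE)
  have A: "openin X (A k) \<and> A k \<noteq> {} \<and> openin X (B k) \<and> X closure_of (A k) \<subseteq> B k" if "k < 4" for k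
    using A0 that by blast
  have Y: "openin X (Y i j) \<and> connectedin X (Y i j) \<and> A i \<subseteq> Y i j \<and> A j \<subseteq> Y i j"
    if "i < 4" "j < 4" "i \<noteq> j" for i j using Y0 that by blast
  have YB: "Y i j \<inter> B k = {}" if "i < 4" "j < 4" "i \<noteq> j" "k < 4" "k \<noteq> i" "k \<noteq> j" for i j k
    using YB0 that by blast
  have Acl: "A k \<subseteq> X closure_of (A k)" if "k < 4" for k
    using A[OF that] by (simp add: closure_of_subset openin_subset)
  have AB: "A k \<subseteq> B k" if "k < 4" for k using Acl[OF that] A[OF that] by blast
  have AB': "A i \<inter> B k = {}" if "i < 4" "k < 4" "i \<noteq> k" for i k
  proof -
    obtain j :: nat where j: "j < 4" "j \<noteq> i" "j \<noteq> k"
    proof -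
      have "card {i, k} < card {..<4::nat}" using that by (simp add: card_insert_if)
      then have "\<not> {..<4} \<subseteq> {i, k}" using card_mono[of "{i, k}" "{..<4::nat}"] by (metis finite.emptyI finite.insertI not_le)
      then show ?thesis using that by blast
    qed
    then show ?thesis using YB[of i j k] Y[of i j] that by blast
  qed
  have KB: "\<forall>j\<in>{..<4}. closedin X (X closure_of (A j)) \<and> openin X (B j) \<and> (X closure_of (A j)) \<subseteq> B j"
    using A by auto
  obtain \<A> where \<A>0: "\<forall>S\<in>\<A>. openin X S" and \<A>2: "topspace X \<subseteq> \<Union>\<A>"
    and scale': "\<forall>A1\<in>\<A>. \<forall>A2\<in>\<A>. \<forall>A3\<in>\<A>. \<forall>j\<in>{..<4}. A1 \<inter> X closure_of (A j) \<noteq> {} \<longrightarrow>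
       A1 \<inter> A2 \<noteq> {} \<longrightarrow> A2 \<inter> A3 \<noteq> {} \<longrightarrow> A3 \<subseteq> B j"
    using scale_cover[OF finite_lessThan KB] by (elim exE conjE)
  have \<A>1: "openin X S" if "S \<in> \<A>" for S using \<A>0 that by blast
  note \<A> = \<A>1 \<A>2
  have scale: "A3 \<subseteq> B j" if "A1 \<in> \<A>" "A2 \<in> \<A>" "A3 \<in> \<A>" "j < 4" "A1 \<inter> A j \<noteq> {}" "A1 \<inter> A2 \<noteq> {}" "A2 \<inter> A3 \<noteq> {}"
    for A1 A2 A3 j
  proof -
    have "A1 \<inter> X closure_of (A j) \<noteq> {}" using that(5) Acl[OF that(4)] by blast
    then show ?thesis using scale'[rule_format, of A1 A2 A3 j] that by simp
  qed
  obtain \<S> where \<S>: "countable \<S>" "\<Union>\<S> = carrier (homeo_group X)"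
    "\<And>S f g x. S \<in> \<S> \<Longrightarrow> f \<in> S \<Longrightarrow> g \<in> S \<Longrightarrow> x \<in> topspace X \<Longrightarrow> \<exists>A\<in>\<A>. f x \<in> A \<and> g x \<in> A"
    using homeo_countable_decomposition[OF sc \<A>] by metis
  let ?C = "connected_chains X"
  define \<O> where "\<O> S = (\<lambda>f. (image f) ` c) ` S" for S :: "('a \<Rightarrow> 'a) set"
  have orbit: "orbit (homeo_group X) (chain_action X) c = \<Union>(\<O> ` \<S>)"
    unfolding \<O>_def orbit_def using \<S>(2) c by (auto simp: chain_action_apply)
  have "nowhere_dense_in ?C (\<O> S)" if S: "S \<in> \<S>" for S
    unfolding nowhere_dense_in_def
  proof
    have SH: "f \<in> carrier (homeo_group X)" if "f \<in> S" for f using \<S>(2) S that by blast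
    show "\<O> S \<subseteq> topspace ?C" using chain_action_closed[OF SH c] by (auto simp: \<O>_def)
    show "?C interior_of (?C closure_of \<O> S) = {}"
    proof (rule ccontr)
      let ?I = "?C interior_of (?C closure_of \<O> S)"
      assume "?I \<noteq> {}"
      then obtain c0 where "c0 \<in> ?I" by blast
      obtain r0 J0 H0 where h0: "hosted \<A> r0 J0 H0"
        and foll: "\<And>c. c \<in> topspace ?C \<Longrightarrow> follows r0 H0 c \<Longrightarrow> c \<in> ?I"
        using open_contains_followers[OF openin_interior_of \<open>c0 \<in> ?I\<close> \<A>] by blast
      have JX: "J0 r0 \<subseteq> topspace X" "A 0 \<inter> topspace X \<noteq> {}" "openin X (A 0)" "connectedin X (topspace X)"
        using h0 A[of 0] openin_subset[of X "A 0"] connected connectedin_subset_topspace[of X "J0 r0"]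
        by (auto simp: hosted_def links_def connectedin_topspace)
      \<comment> \<open>The common part is prolonged into region 0, where both words start.\<close>
      obtain r J H where h: "hosted \<A> r J H" and ext: "extends r0 J0 H0 r J H" and Hr: "H r \<subseteq> A 0"
      proof -
        note ex = hosted_extend[OF h0 \<A> openin_topspace JX(4,1,3,2)]
        show thesis by (rule ex, assumption) (rule that)
      qed
      \<comment> \<open>The least value above the bound \<open>2 * r + 10\<close> of
        \<open>no_common_word\<close>, where \<open>r\<close> is the index of the last common
        link.\<close>
      define M where "M = 2 * r + 11"
      have zig: "\<exists>n W H' J' s. tube n W \<and> (\<forall>i\<le>n. W i \<subseteq> H' i) \<and> hosted \<A> n J' H' \<and>
          s M = n \<and> (\<forall>k<M. s k < s (Suc k)) \<and> (\<forall>k\<le>M. H' (s k) \<subseteq> A (\<sigma> (k mod 3))) \<and>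
          (\<forall>k<M. \<forall>i. s k \<le> i \<longrightarrow> i \<le> s (Suc k) \<longrightarrow> H' i \<subseteq> Y (\<sigma> (k mod 3)) (\<sigma> (Suc k mod 3))) \<and>
          (\<forall>b. r < b \<longrightarrow> b \<le> n \<longrightarrow> (\<forall>l<4. l \<notin> \<sigma> ` {..<3} \<longrightarrow> H' b \<inter> B l = {})) \<and>
          (\<exists>f\<in>S. (image f) ` c \<in> tube_chains n W)"
        if \<sigma>: "inj_on \<sigma> {..<3}" "\<forall>j<3. \<sigma> j < 4" "\<sigma> 0 = 0" for \<sigma> :: "nat \<Rightarrow> nat"
      proof -
        have \<sigma>4: "\<sigma> (k mod 3) < 4" for k using \<sigma>(2) by simp
        have \<sigma>ne: "\<sigma> (k mod 3) \<noteq> \<sigma> (Suc k mod 3)" for k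
        proof -
          have "k mod 3 \<noteq> Suc k mod 3" by presburger
          then show ?thesis using \<sigma>(1) by (auto dest: inj_onD)
        qed
        have H0: "H r \<subseteq> A (\<sigma> (0 mod 3))" using Hr \<sigma>(3) by simp
        have YY: "openin X (Y (\<sigma> (k mod 3)) (\<sigma> (Suc k mod 3))) \<and> connectedin X (Y (\<sigma> (k mod 3)) (\<sigma> (Suc k mod 3))) \<and>
            A (\<sigma> (k mod 3)) \<subseteq> Y (\<sigma> (k mod 3)) (\<sigma> (Suc k mod 3)) \<and> A (\<sigma> (Suc k mod 3)) \<subseteq> Y (\<sigma> (k mod 3)) (\<sigma> (Suc k mod 3))" for k
          by (rule Y[OF \<sigma>4 \<sigma>4 \<sigma>ne])
        have AA: "openin X (A (\<sigma> (k mod 3))) \<and> A (\<sigma> (k mod 3)) \<noteq> {}" for k using A[OF \<sigma>4] by blast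
        obtain n J' H' s where n: "hosted \<A> n J' H'" "extends r J H n J' H'" "s M = n" "\<forall>k<M. s k < s (Suc k)"
          "\<forall>k\<le>M. H' (s k) \<subseteq> A (\<sigma> (k mod 3))"
          "\<forall>k<M. \<forall>i. s k \<le> i \<longrightarrow> i \<le> s (Suc k) \<longrightarrow> H' i \<subseteq> Y (\<sigma> (k mod 3)) (\<sigma> (Suc k mod 3))"
          "\<forall>i. r < i \<longrightarrow> i \<le> n \<longrightarrow> (\<exists>k. H' i \<subseteq> Y (\<sigma> (k mod 3)) (\<sigma> (Suc k mod 3)))"
          using zigzag_extend[where w = "\<lambda>k. \<sigma> (k mod 3)" and A = A and Y = Y and M = M, OF h \<A>0 \<A>2 H0 AA YY]
          by (elim exE conjE)
        obtain W where W: "tube n W" "\<And>i. i \<le> n \<Longrightarrow> J' i \<subseteq> W i" "\<And>i. i \<le> n \<Longrightarrow> W i \<subseteq> H' i"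
          using hosted_tube[OF n(1)] by metis
        have sub: "tube_chains n W \<subseteq> ?I"
        proof
          fix d assume d: "d \<in> tube_chains n W"
          then have "follows n H' d" using follows_mono[OF tube_chains_follow[OF W(1) d] W(3)] by blast
          then have "follows r0 H0 d" using follows_extends extends_trans[OF ext n(2)] by blast
          then show "d \<in> ?I" using foll d by (simp add: tube_chains_def)
        qed
        obtain d where d: "d \<in> tube_chains n W" using tube_chains_nonempty[OF n(1) W(1,2)] by blast
        have "d \<in> ?C closure_of \<O> S" by (rule subsetD[OF interior_of_subset subsetD[OF sub d]])
        then obtain e where "e \<in> \<O> S" "e \<in> tube_chains n W"
          using openin_tube_chains[OF W(1)] d unfolding in_closure_of by meson
        then have fS: "\<exists>f\<in>S. (image f) ` c \<in> tube_chains n W" by (auto simp: \<O>_def)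
        have av: "H' b \<inter> B l = {}" if b: "r < b" "b \<le> n" "l < 4" "l \<notin> \<sigma> ` {..<3}" for b l
        proof -
          obtain k where k: "H' b \<subseteq> Y (\<sigma> (k mod 3)) (\<sigma> (Suc k mod 3))" using n(7) b by blast
          have "\<sigma> (k mod 3) \<in> \<sigma> ` {..<3}" for k by simp
          then have "l \<noteq> \<sigma> (k mod 3)" for k using b(4) by metis
          then show ?thesis using YB[OF \<sigma>4 \<sigma>4 \<sigma>ne b(3)] k by blast
        qed
        have av': "\<forall>b. r < b \<longrightarrow> b \<le> n \<longrightarrow> (\<forall>l<4. l \<notin> \<sigma> ` {..<3} \<longrightarrow> H' b \<inter> B l = {})" using av by blast
        have WH: "\<forall>i\<le>n. W i \<subseteq> H' i" using W(3) by blast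
        show ?thesis
          by (rule exI[of _ n], rule exI[of _ W], rule exI[of _ H'], rule exI[of _ J'], rule exI[of _ s])
            (intro conjI W(1) WH n(1,3-6) av' fS)
      qed
      \<comment> \<open>The words cycle through \<open>0, 1, 2\<close> and \<open>0, 1, 3\<close>;
        beyond link \<open>r\<close> each arc avoids the last letter of the other word.\<close>
      define \<sigma>1 where "\<sigma>1 j = j" for j :: nat
      define \<sigma>2 where "\<sigma>2 j = (if j = 2 then 3 else j)" for j :: nat
      have s1: "inj_on \<sigma>1 {..<3}" "\<forall>j<3. \<sigma>1 j < 4" "\<sigma>1 0 = 0" by (auto simp: \<sigma>1_def inj_on_def)
      have s2: "inj_on \<sigma>2 {..<3}" "\<forall>j<3. \<sigma>2 j < 4" "\<sigma>2 0 = 0" by (auto simp: \<sigma>2_def inj_on_def)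
      obtain n1 W1 H1 J1 t1 f1 where z1o: "tube n1 W1" "\<forall>i\<le>n1. W1 i \<subseteq> H1 i" "hosted \<A> n1 J1 H1"
          "t1 M = n1" "\<forall>k<M. t1 k < t1 (Suc k)" "\<forall>k\<le>M. H1 (t1 k) \<subseteq> A (\<sigma>1 (k mod 3))"
          "\<forall>k<M. \<forall>i. t1 k \<le> i \<longrightarrow> i \<le> t1 (Suc k) \<longrightarrow> H1 i \<subseteq> Y (\<sigma>1 (k mod 3)) (\<sigma>1 (Suc k mod 3))"
          "\<forall>b. r < b \<longrightarrow> b \<le> n1 \<longrightarrow> (\<forall>l<4. l \<notin> \<sigma>1 ` {..<3} \<longrightarrow> H1 b \<inter> B l = {})"
          "f1 \<in> S" "(image f1) ` c \<in> tube_chains n1 W1"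
        using zig[OF s1] by (elim exE conjE bexE)
      note z1 = z1o[rule_format]
      obtain n2 W2 H2 J2 t2 f2 where z2o: "tube n2 W2" "\<forall>i\<le>n2. W2 i \<subseteq> H2 i" "hosted \<A> n2 J2 H2"
          "t2 M = n2" "\<forall>k<M. t2 k < t2 (Suc k)" "\<forall>k\<le>M. H2 (t2 k) \<subseteq> A (\<sigma>2 (k mod 3))"
          "\<forall>k<M. \<forall>i. t2 k \<le> i \<longrightarrow> i \<le> t2 (Suc k) \<longrightarrow> H2 i \<subseteq> Y (\<sigma>2 (k mod 3)) (\<sigma>2 (Suc k mod 3))"
          "\<forall>b. r < b \<longrightarrow> b \<le> n2 \<longrightarrow> (\<forall>l<4. l \<notin> \<sigma>2 ` {..<3} \<longrightarrow> H2 b \<inter> B l = {})"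
          "f2 \<in> S" "(image f2) ` c \<in> tube_chains n2 W2"
        using zig[OF s2] by (elim exE conjE bexE)
      note z2 = z2o[rule_format]
      obtain L1 where L1: "L1 \<in> c" "f1 ` L1 \<subseteq> (\<Union>i\<le>n1. W1 i)" "\<And>i. i \<le> n1 \<Longrightarrow> f1 ` L1 \<inter> W1 i \<noteq> {}"
        using tube_chains_follow[OF z1(1,10)] by (auto simp: follows_def)
      obtain L2 where L2: "L2 \<in> c" "f2 ` L2 \<subseteq> (\<Union>i\<le>n2. W2 i)" "\<And>i. i \<le> n2 \<Longrightarrow> f2 ` L2 \<inter> W2 i \<noteq> {}"
        using tube_chains_follow[OF z2(1,10)] by (auto simp: follows_def)
      have cont: "continuous_map X X f1" "continuous_map X X f2"
        using homeo_groupD(1) SH z1(9) z2(9) by blast+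
      have near1: "\<exists>A\<in>\<A>. f1 x \<in> A \<and> f2 x \<in> A" if "x \<in> L2" for x
        using \<S>(3)[OF S z1(9) z2(9)] chain_memberD(4)[OF c L2(1)] that by blast
      have near2: "\<exists>A\<in>\<A>. f2 x \<in> A \<and> f1 x \<in> A" if "x \<in> L1" for x
        using \<S>(3)[OF S z2(9) z1(9)] chain_memberD(4)[OF c L1(1)] that by blast
      have M: "2 * r + 10 < M" by (simp add: M_def)
      \<comment> \<open>The smaller of the two members is mapped into both tubes and, by its own
        map, meets every part of its own tube. Its word is then read along the tube of the larger
        member.\<close>
      show False
        using chain_comparable[OF c L1(1) L2(1)]
      proof
        assume "L2 \<subseteq> L1"
        then have sub: "f1 ` L2 \<subseteq> (\<Union>i\<le>n1. W1 i)" using L1(2) by blast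
        have av: "H1 b \<inter> B (\<sigma>2 2) = {}" if "r < b" "b \<le> n1" for b
          using z1(8)[OF that, of 3] by (auto simp: \<sigma>2_def \<sigma>1_def)
        show False
          by (rule zigzag_incompatible[where L = L2 and \<phi> = f1 and \<psi> = f2 and \<A> = \<A> and A = A and B = B and Y = Y and
            m = n1 and W = W1 and H = H1 and J = J1 and q = n2 and Z = W2 and H' = H2 and \<sigma> = \<sigma>2 and r = r and M = M and s = t2,
            OF chain_member_connected[OF c L2(1)] cont near1 scale z1(1-3) z2(1,2)
            sub L2(2,3) AB AB' YB s2(1) s2(2)[rule_format] av z2(5,4,6,7) M])
      next
        assume "L1 \<subseteq> L2"
        then have sub: "f2 ` L1 \<subseteq> (\<Union>i\<le>n2. W2 i)" using L2(2) by blast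
        have av: "H2 b \<inter> B (\<sigma>1 2) = {}" if "r < b" "b \<le> n2" for b
          using z2(8)[OF that, of 2] by (auto simp: \<sigma>2_def \<sigma>1_def)
        show False
          by (rule zigzag_incompatible[where L = L1 and \<phi> = f2 and \<psi> = f1 and \<A> = \<A> and A = A and B = B and Y = Y and
            m = n2 and W = W2 and H = H2 and J = J2 and q = n1 and Z = W1 and H' = H1 and \<sigma> = \<sigma>1 and r = r and M = M and s = t1,
            OF chain_member_connected[OF c L1(1)] cont(2,1) near2 scale z2(1-3) z1(1,2)
            sub L1(2,3) AB AB' YB s1(1) s1(2)[rule_format] av z1(5,4,6,7) M])
      qed
    qed
  qed
  then show ?thesis
    unfolding meager_in_def using \<S>(1) orbit by (intro exI[of _ "\<O> ` \<S>"]) auto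
qed

section \<open>Minimality\<close>

lemma rigid_stabilizer_mult:
  assumes G: "subgroup G (homeo_group X)" and g: "g \<in> rigid_stabilizer X G U" and h: "h \<in> rigid_stabilizer X G U"
  shows "g \<otimes>\<^bsub>homeo_group X\<^esub> h \<in> rigid_stabilizer X G U"
proof -
  have GH: "g \<in> G" "h \<in> G" using g h by (auto simp: rigid_stabilizer_def)
  then have c: "g \<in> carrier (homeo_group X)" "h \<in> carrier (homeo_group X)" using G subgroup.subset by blast+
  have "(g \<otimes>\<^bsub>homeo_group X\<^esub> h) x = x" if "x \<in> topspace X - U" for x
    using mult_homeo_apply[OF c] g h that by (auto simp: rigid_stabilizer_def)
  then show ?thesis using subgroup.m_closed[OF G GH] by (simp add: rigid_stabilizer_def)
qed

lemma rigid_stabilizer_inv: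
  assumes G: "subgroup G (homeo_group X)" and g: "g \<in> rigid_stabilizer X G U"
  obtains h where "h \<in> rigid_stabilizer X G U" "\<And>x. x \<in> topspace X \<Longrightarrow> h (g x) = x"
proof -
  interpret group "homeo_group X" by (rule group_homeo)
  have gG: "g \<in> G" using g by (simp add: rigid_stabilizer_def)
  define h where "h = inv\<^bsub>homeo_group X\<^esub> g"
  have hG: "h \<in> G" using subgroup.m_inv_closed[OF G gG] by (simp add: h_def)
  have c: "g \<in> carrier (homeo_group X)" "h \<in> carrier (homeo_group X)" using G gG hG subgroup.subset by blast+
  have hg: "h (g x) = x" if "x \<in> topspace X" for x
  proof -
    have "(h \<otimes>\<^bsub>homeo_group X\<^esub> g) x = x"
      using l_inv[OF c(1)] that by (simp add: h_def homeo_group_def BijGroup_def)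
    then show ?thesis using mult_homeo_apply[OF c(2,1) that] by simp
  qed
  have "h x = x" if "x \<in> topspace X - U" for x
    using hg[of x] g that by (simp add: rigid_stabilizer_def)
  then show thesis using that[of h] hG hg by (simp add: rigid_stabilizer_def)
qed

text \<open>A value outside \<open>U\<close> is itself fixed by \<open>g\<close>, so injectivity
  would make \<open>x\<close> equal to it.\<close>

lemma rigid_stabilizer_maps_into:
  assumes G: "subgroup G (homeo_group X)" and g: "g \<in> rigid_stabilizer X G U" and "x \<in> U" "U \<subseteq> topspace X"
  shows "g x \<in> U"
proof (rule ccontr)
  assume no: "g x \<notin> U"
  have c: "g \<in> carrier (homeo_group X)" using g G subgroup.subset by (auto simp: rigid_stabilizer_def)
  have gx: "g x \<in> topspace X" using homeo_groupD(4)[OF c] assms by blast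
  then have "g (g x) = g x" using g no by (simp add: rigid_stabilizer_def)
  then have "g x = x" using homeo_groupD(3)[OF c] gx assms by (meson inj_onD subsetD)
  then show False using no assms by simp
qed

text \<open>Local transitivity makes every orbit of the rigid stabilizer in \<open>U\<close> open;
  orbits partition the connected set \<open>U\<close>, so there is only one.\<close>

lemma rigid_stabilizer_transitive:
  assumes G: "subgroup G (homeo_group X)" and lt: "locally_transitive X G"
    and U: "openin X U" "connectedin X U" and xy: "x \<in> U" "y \<in> U"
  obtains g where "g \<in> rigid_stabilizer X G U" "g x = y"
proof -
  have UX: "U \<subseteq> topspace X" using openin_subset[OF U(1)] .
  have loc: "\<exists>W. openin X W \<and> z \<in> W \<and> W \<subseteq> U \<and> (\<forall>w\<in>W. \<exists>g\<in>rigid_stabilizer X G U. g z = w)" if z: "z \<in> U" for z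
  proof -
    obtain W where W: "openin X W" "z \<in> W" "W \<subseteq> {g z | g. g \<in> rigid_stabilizer X G U}"
      using lt U(1) z unfolding locally_transitive_def by meson
    have "W \<subseteq> U" using W(3) rigid_stabilizer_maps_into[OF G _ z UX] by blast
    then show ?thesis using W by blast
  qed
  define P where "P = {z \<in> U. \<exists>g\<in>rigid_stabilizer X G U. g x = z}"
  have car: "g \<in> carrier (homeo_group X)" if "g \<in> rigid_stabilizer X G U" for g
    using that G subgroup.subset by (auto simp: rigid_stabilizer_def)
  have comp: "\<exists>k\<in>rigid_stabilizer X G U. k x = h (g x)"
    if gh: "g \<in> rigid_stabilizer X G U" "h \<in> rigid_stabilizer X G U" for g h
    using rigid_stabilizer_mult[OF G gh(2,1)] mult_homeo_apply[OF car[OF gh(2)] car[OF gh(1)]] UX xy by blast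
  have oP: "openin X P"
  proof (subst openin_subopen, intro ballI)
    fix z assume "z \<in> P"
    then obtain g where g: "z \<in> U" "g \<in> rigid_stabilizer X G U" "g x = z" by (auto simp: P_def)
    obtain W where W: "openin X W" "z \<in> W" "W \<subseteq> U" "\<And>w. w \<in> W \<Longrightarrow> \<exists>h\<in>rigid_stabilizer X G U. h z = w"
      using loc[OF g(1)] by blast
    have "W \<subseteq> P"
    proof
      fix w assume w: "w \<in> W"
      obtain h where h: "h \<in> rigid_stabilizer X G U" "h z = w" using W(4)[OF w] by blast
      then show "w \<in> P" using comp[OF g(2) h(1)] g(3) W(3) w by (auto simp: P_def)
    qed
    then show "\<exists>T. openin X T \<and> z \<in> T \<and> T \<subseteq> P" using W by blast
  qed
  have oQ: "openin X (U - P)"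
  proof (subst openin_subopen, intro ballI)
    fix z assume z: "z \<in> U - P"
    then obtain W where W: "openin X W" "z \<in> W" "W \<subseteq> U" "\<And>w. w \<in> W \<Longrightarrow> \<exists>h\<in>rigid_stabilizer X G U. h z = w"
      using loc[of z] by blast
    have "w \<notin> P" if w: "w \<in> W" for w
    proof
      assume "w \<in> P"
      then obtain g where g: "g \<in> rigid_stabilizer X G U" "g x = w" by (auto simp: P_def)
      obtain h where h: "h \<in> rigid_stabilizer X G U" "h z = w" using W(4)[OF w] by blast
      obtain h' where h': "h' \<in> rigid_stabilizer X G U" "\<And>x. x \<in> topspace X \<Longrightarrow> h' (h x) = x"
        using rigid_stabilizer_inv[OF G h(1)] by metis
      have "h' w = z" using h'(2)[of z] h(2) z UX by auto
      then have "\<exists>k\<in>rigid_stabilizer X G U. k x = z" using comp[OF g(1) h'(1)] g(2) by simp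
      then show False using z by (simp add: P_def)
    qed
    then have "W \<subseteq> U - P" using W(3) by blast
    then show "\<exists>T. openin X T \<and> z \<in> T \<and> T \<subseteq> U - P" using W by blast
  qed
  have "\<one>\<^bsub>homeo_group X\<^esub> z = z" if "z \<in> topspace X" for z
    using that by (simp add: homeo_group_def BijGroup_def)
  then have "\<one>\<^bsub>homeo_group X\<^esub> \<in> rigid_stabilizer X G U" "\<one>\<^bsub>homeo_group X\<^esub> x = x"
    using subgroup.one_closed[OF G] UX xy by (auto simp: rigid_stabilizer_def)
  then have "x \<in> P" using xy by (auto simp: P_def)
  have "U - P = {}"
  proof (rule ccontr)
    assume "U - P \<noteq> {}"
    then show False
      using connectedinD[OF U(2) oP oQ] \<open>x \<in> P\<close> xy by (auto simp: P_def)
  qed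
  then have "y \<in> P" using xy by blast
  then show thesis using that by (auto simp: P_def)
qed

text \<open>Two points are steered: the root \<open>x0\<close>, kept in \<open>W 0\<close>, and a
  point \<open>y\<close> of a member \<open>K\<close>, moved from one part of the tube to the next.
  Each move is supported in \<open>W k\<close> minus the image of the root, so it fixes that image
  and keeps the image of \<open>K\<close> inside the parts already visited.\<close>

lemma chain_pushed_into_tube:
  assumes G: "subgroup G (homeo_group X)" and lt: "locally_transitive X G"
    and c: "c \<in> topspace (connected_chains X)" and t: "tube m W"
  obtains g where "g \<in> G" "(image g) ` c \<in> tube_chains m W"
proof -
  interpret H: group "homeo_group X" by (rule group_homeo)
  have GH: "g \<in> carrier (homeo_group X)" if "g \<in> G" for g using that G subgroup.subset by blast
  have RG: "g \<in> G" if "g \<in> rigid_stabilizer X G U" for g U using that by (simp add: rigid_stabilizer_def)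
  have W: "openin X (W i) \<and> connectedin X (W i) \<and> W i \<noteq> {}" if "i \<le> m" for i using t that by (simp add: tube_def)
  obtain x0 where x0: "{x0} \<in> c" using c by (auto simp: connected_chains_iff)
  have x0X: "x0 \<in> topspace X" using chain_memberD(4)[OF c x0] by simp
  have XX: "topspace X \<in> c" using c by (simp add: connected_chains_iff)
  have claim: "\<exists>g\<in>G. \<exists>K\<in>c. g x0 \<in> W 0 \<and> g ` K \<subseteq> (\<Union>i\<le>k. W i) \<and> (\<exists>y\<in>K. y \<noteq> x0 \<and> g y \<in> W k)" if "k \<le> m" for k
    using that
  proof (induction k)
    case 0
    obtain z where z: "z \<in> W 0" using W[of 0] by blast
    have zX: "z \<in> topspace X" using z W[of 0] openin_subset[of X "W 0"] by blast
    have cX: "connectedin X (topspace X)" using connected by (simp add: connectedin_topspace)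
    obtain g where g: "g \<in> rigid_stabilizer X G (topspace X)" "g x0 = z"
      using rigid_stabilizer_transitive[OF G lt openin_topspace cX x0X zX] by blast
    have gH: "g \<in> carrier (homeo_group X)" using GH RG g(1) by blast
    let ?V = "{u \<in> topspace X. g u \<in> W 0}"
    have oV: "openin X ?V" using openin_continuous_map_preimage[OF homeo_groupD(1)[OF gH]] W[of 0] by blast
    have oQ: "openin X (topspace X - {x0})"
      using x0X t1 by (auto simp: t1_space_closedin_singleton)
    have "topspace X - {x0} \<noteq> {}"
      using open_diff_nonseparating[OF openin_topspace nonempty nonseparating_singleton[OF x0X]] .
    then have ne: "topspace X \<inter> (topspace X - {x0}) \<noteq> {}" by blast
    have V0: "{x0} \<subseteq> ?V" using x0X g(2) z by simp
    \<comment> \<open>Some member is small enough to lie in the preimage of \<open>W 0\<close> and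
      still has a second point, which will be the point to move.\<close>
    have "\<exists>L\<in>c. L \<subseteq> ?V \<and> L \<inter> (topspace X - {x0}) \<noteq> {}"
    proof (rule chain_connected_split[OF c oV oQ _ x0 V0 XX ne])
      fix L assume "L \<in> c"
      then show "L \<subseteq> ?V \<or> L \<inter> (topspace X - {x0}) \<noteq> {}"
        using chain_memberD(4)[OF c] V0 by blast
    qed
    then obtain L y where "L \<in> c" "L \<subseteq> ?V" "y \<in> L" "y \<noteq> x0" by blast
    then show ?case using g z RG by (intro bexI[of _ g] bexI[of _ L]) auto
  next
    case (Suc k)
    then obtain g K y where g: "g \<in> G" and K: "K \<in> c" and gx: "g x0 \<in> W 0" and gK: "g ` K \<subseteq> (\<Union>i\<le>k. W i)"
      and y: "y \<in> K" "y \<noteq> x0" "g y \<in> W k"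
      by (metis Suc_leD)
    have gH: "g \<in> carrier (homeo_group X)" using GH g by blast
    have km: "k \<le> m" "k < m" using Suc.prems by auto
    have KX: "K \<subseteq> topspace X" using chain_memberD(4)[OF c K] .
    have gx0X: "g x0 \<in> topspace X" using homeo_groupD(4)[OF gH x0X] .
    have ns: "nonseparating X {g x0}" by (rule nonseparating_singleton[OF gx0X])
    let ?U = "W k - {g x0}"
    have oU: "openin X ?U" using W[OF km(1)] ns unfolding nonseparating_def by blast
    have cU: "connectedin X ?U" using W[OF km(1)] ns unfolding nonseparating_def by blast
    have "g y \<noteq> g x0" using homeo_groupD(3)[OF gH] y KX x0X by (meson inj_onD subsetD)
    then have yU: "g y \<in> ?U" using y by blast
    have "openin X (W k \<inter> W (Suc k))" "W k \<inter> W (Suc k) \<noteq> {}"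
      using W[OF km(1)] W[OF Suc.prems] t km by (auto simp: tube_def)
    \<comment> \<open>The target lies in two consecutive parts, so a move inside \<open>W k\<close>
      already brings the point into the next part.\<close>
    then obtain z where z: "z \<in> W k" "z \<in> W (Suc k)" "z \<noteq> g x0"
      using open_diff_nonseparating[OF _ _ ns] by blast
    then have "z \<in> ?U" by blast
    then obtain h where h: "h \<in> rigid_stabilizer X G ?U" "h (g y) = z"
      using rigid_stabilizer_transitive[OF G lt oU cU yU] by metis
    have hH: "h \<in> carrier (homeo_group X)" using GH RG h(1) by blast
    let ?f = "h \<otimes>\<^bsub>homeo_group X\<^esub> g"
    have f: "?f u = h (g u)" if "u \<in> topspace X" for u by (rule mult_homeo_apply[OF hH gH that])
    have fG: "?f \<in> G" using subgroup.m_closed[OF G RG[OF h(1)] g] .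
    have "h (g x0) = g x0" using h(1) gx0X by (simp add: rigid_stabilizer_def)
    then have fx: "?f x0 \<in> W 0" using f[OF x0X] gx by simp
    have "?f u \<in> (\<Union>i\<le>Suc k. W i)" if u: "u \<in> K" for u
    proof (cases "g u \<in> ?U")
      case True
      then have "h (g u) \<in> ?U"
        using rigid_stabilizer_maps_into[OF G h(1)] openin_subset[OF oU] by blast
      then have "?f u \<in> W k" using f u KX by auto
      then show ?thesis by (intro UN_I[of k]) auto
    next
      case False
      have "g u \<in> topspace X" using homeo_groupD(4)[OF gH] u KX by blast
      then have "h (g u) = g u" using False h(1) by (simp add: rigid_stabilizer_def)
      moreover obtain i where i: "i \<le> k" "g u \<in> W i" using gK u by blast
      ultimately have "?f u \<in> W i" using f u KX by auto
      then show ?thesis using i(1) by (intro UN_I[of i]) auto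
    qed
    then have "?f ` K \<subseteq> (\<Union>i\<le>Suc k. W i)" by blast
    moreover have "?f y \<in> W (Suc k)" using f[of y] y(1) KX h(2) z(2) by auto
    ultimately show ?case using fG K fx y(1,2) by blast
  qed
  obtain g K y where g: "g \<in> G" "K \<in> c" "g x0 \<in> W 0" "g ` K \<subseteq> (\<Union>i\<le>m. W i)" "y \<in> K" "g y \<in> W m"
    using claim[of m] by blast
  have "{g x0} \<in> (image g) ` c" using x0 by (metis image_empty image_eqI image_insert)
  moreover have "{g x0} \<subseteq> W 0" using g(3) by simp
  moreover have "g ` K \<in> (image g) ` c" "g ` K \<inter> W m \<noteq> {}" using g by auto
  ultimately have "(image g) ` c \<in> tube_chains m W"
    using chain_action_closed[OF GH[OF g(1)] c] g(4) unfolding tube_chains_def by blast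
  then show thesis using that g(1) by blast
qed

lemma minimal_flow_connected_chains:
  assumes G: "subgroup G (homeo_group X)" and lt: "locally_transitive X G"
  shows "minimal_flow (homeo_group X \<lparr>carrier := G\<rparr>) (subtopology (homeo_topology X) G) (connected_chains X) (chain_action X)"
  unfolding minimal_flow_def
proof (intro conjI ballI)
  show "flow (homeo_group X \<lparr>carrier := G\<rparr>) (subtopology (homeo_topology X) G) (connected_chains X) (chain_action X)"
    by (rule flow_connected_chains[OF G])
  obtain x where x: "x \<in> topspace X" using nonempty by blast
  have "compactin X {x}" "connectedin X {x}" "x \<in> {x}" using x by auto
  then show "topspace (connected_chains X) \<noteq> {}" using order_arc_exists[OF connected] by blast
  fix c assume c: "c \<in> topspace (connected_chains X)"
  let ?C = "connected_chains X" and ?O = "orbit (homeo_group X \<lparr>carrier := G\<rparr>) (chain_action X) c"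
  have "d \<in> ?C closure_of ?O" if d: "d \<in> topspace ?C" for d
    unfolding in_closure_of
  proof (intro conjI allI impI d)
    fix T assume T: "d \<in> T \<and> openin ?C T"
    have cov: "topspace X \<subseteq> \<Union>{topspace X}" "\<And>A. A \<in> {topspace X} \<Longrightarrow> openin X A" by auto
    obtain m J H where h: "hosted {topspace X} m J H"
      and foll: "\<And>c. c \<in> topspace ?C \<Longrightarrow> follows m H c \<Longrightarrow> c \<in> T"
      using open_contains_followers[of T d "{topspace X}"] T cov by blast
    obtain W where W: "tube m W" "\<And>i. i \<le> m \<Longrightarrow> J i \<subseteq> W i" "\<And>i. i \<le> m \<Longrightarrow> W i \<subseteq> H i"
      using hosted_tube[OF h] by metis
    obtain g where g: "g \<in> G" "(image g) ` c \<in> tube_chains m W"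
      by (rule chain_pushed_into_tube[OF G lt c W(1)])
    have "follows m H ((image g) ` c)" by (rule follows_mono[OF tube_chains_follow[OF W(1) g(2)] W(3)])
    then have "(image g) ` c \<in> T" using foll g(2) by (simp add: tube_chains_def)
    moreover have "(image g) ` c \<in> ?O" using g(1) c by (auto simp: orbit_def chain_action_apply)
    ultimately show "\<exists>y. y \<in> ?O \<and> y \<in> T" by blast
  qed
  then show "?C closure_of ?O = topspace ?C"
    by (intro subset_antisym closure_of_subset_topspace subsetI)
qed

end

section \<open>Meager sets and factor maps\<close>

lemma nowhere_dense_in_subset:
  assumes "nowhere_dense_in X A" "B \<subseteq> A"
  shows "nowhere_dense_in X B"
  using assms interior_of_mono[OF closure_of_mono[OF assms(2)], of X X] unfolding nowhere_dense_in_def by blast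

lemma finite_union_empty_interior:
  assumes "finite \<F>" "\<And>F. F \<in> \<F> \<Longrightarrow> closedin X F \<and> X interior_of F = {}"
  shows "X interior_of (\<Union>\<F>) = {}"
  using assms
proof (induction rule: finite_induct)
  case (insert F \<F>)
  then show ?case using interior_of_union_eq_empty[of X F "\<Union>\<F>"] by simp
qed simp

lemma flow_translation_continuous:
  assumes "flow G T M \<phi>" "g \<in> topspace T"
  shows "continuous_map M M (\<phi> g)"
proof -
  have "continuous_map M (prod_topology T M) (\<lambda>y. (g, y))" using assms(2) by (simp add: continuous_map_pairedI)
  moreover have "continuous_map (prod_topology T M) M (\<lambda>(g, y). \<phi> g y)" using assms(1) by (simp add: flow_def)
  ultimately have "continuous_map M M ((\<lambda>(g, y). \<phi> g y) \<circ> (\<lambda>y. (g, y)))" by (rule continuous_map_compose)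
  then show ?thesis by (simp add: o_def)
qed

text \<open>Finitely many translates of a nonempty open set cover a minimal flow. So if the preimage of a
  closed nowhere dense set \<open>F\<close> had interior points, finitely many translates of \<open>F\<close> would cover \<open>N\<close>.\<close>

lemma nowhere_dense_factor_preimage:
  assumes M: "minimal_flow G T M \<phi>" and N: "minimal_flow G T N \<psi>" and T: "topspace T = carrier G"
    and \<pi>: "factor_map G M \<phi> N \<psi> \<pi>" and A: "nowhere_dense_in N A"
  shows "nowhere_dense_in M {y \<in> topspace M. \<pi> y \<in> A}"
proof -
  have fM: "flow G T M \<phi>" and fN: "flow G T N \<psi>" using M N by (auto simp: minimal_flow_def)
  interpret M: group_action G "topspace M" \<phi> using fM by (simp add: flow_def)
  interpret N: group_action G "topspace N" \<psi> using fN by (simp add: flow_def)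
  interpret G: group G using M.group_hom group_hom.axioms(1) by blast
  have c\<pi>: "continuous_map M N \<pi>" and s\<pi>: "\<pi> ` topspace M = topspace N"
    and eq: "\<And>g y. g \<in> carrier G \<Longrightarrow> y \<in> topspace M \<Longrightarrow> \<pi> (\<phi> g y) = \<psi> g (\<pi> y)"
    using \<pi> by (auto simp: factor_map_def)
  define F where "F = N closure_of A"
  have F: "closedin N F" "N interior_of F = {}" using A by (simp_all add: F_def nowhere_dense_in_def)
  have clF: "closedin M {y \<in> topspace M. \<pi> y \<in> F}" by (rule closedin_continuous_map_preimage[OF c\<pi> F(1)])
  have AF: "A \<subseteq> F" using A by (simp add: F_def nowhere_dense_in_def closure_of_subset)
  define Oo where "Oo = M interior_of {y \<in> topspace M. \<pi> y \<in> F}"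
  have oO: "openin M Oo" "Oo \<subseteq> {y \<in> topspace M. \<pi> y \<in> F}" by (simp_all add: Oo_def interior_of_subset)
  have "Oo = {}"
  proof (rule ccontr)
    assume "Oo \<noteq> {}"
    then obtain z where z: "z \<in> Oo" by blast
    \<comment> \<open>Every orbit is dense and so visits \<open>Oo\<close>; hence these preimages of
      \<open>Oo\<close> cover \<open>M\<close>, and finitely many suffice by compactness.\<close>
    let ?V = "\<lambda>g. {y \<in> topspace M. \<phi> g y \<in> Oo}"
    have oV: "openin M U" if "U \<in> ?V ` carrier G" for U
      using that openin_continuous_map_preimage[OF flow_translation_continuous[OF fM] oO(1)] T by auto
    have cov: "topspace M \<subseteq> \<Union>(?V ` carrier G)"
    proof
      fix y assume y: "y \<in> topspace M"
      then have "z \<in> M closure_of (orbit G \<phi> y)" using M z oO openin_subset[OF oO(1)] by (auto simp: minimal_flow_def)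
      then obtain w where "w \<in> orbit G \<phi> y" "w \<in> Oo" using z oO(1) by (auto simp: in_closure_of)
      then show "y \<in> \<Union>(?V ` carrier G)" using y by (auto simp: orbit_def)
    qed
    have "compactin M (topspace M)" using fM by (simp add: flow_def compact_space_def)
    from compactinD[OF this oV cov] obtain I where I: "finite I" "I \<subseteq> carrier G" "topspace M \<subseteq> \<Union>(?V ` I)"
      by (metis (no_types, lifting) finite_subset_image)
    let ?F = "\<lambda>g. {u \<in> topspace N. \<psi> g u \<in> F}"
    have "closedin N (?F g) \<and> N interior_of (?F g) = {}" if g: "g \<in> carrier G" for g
    proof
      have cg: "continuous_map N N (\<psi> g)" using flow_translation_continuous[OF fN] g T by blast
      show "closedin N (?F g)" by (rule closedin_continuous_map_preimage[OF cg F(1)])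
      show "N interior_of (?F g) = {}"
      proof (rule ccontr)
        assume ne: "N interior_of (?F g) \<noteq> {}"
        let ?I = "N interior_of (?F g)" and ?h = "inv\<^bsub>G\<^esub> g"
        have hG: "?h \<in> carrier G" using g by simp
        let ?J = "{u \<in> topspace N. \<psi> ?h u \<in> ?I}"
        have ch: "continuous_map N N (\<psi> ?h)" using flow_translation_continuous[OF fN] hG T by blast
        have "openin N ?J" by (rule openin_continuous_map_preimage[OF ch openin_interior_of])
        moreover have JF: "?J \<subseteq> F"
        proof
          fix u assume u: "u \<in> ?J"
          then have "\<psi> g (\<psi> ?h u) \<in> F" using interior_of_subset[of N "?F g"] by blast
          moreover have "\<psi> g (\<psi> ?h u) = u"
            using N.orbit_sym_aux[OF hG, of u] u g by simp
          ultimately show "u \<in> F" by simp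
        qed
        moreover have "?J \<noteq> {}"
        proof -
          obtain v where v: "v \<in> ?I" using ne by blast
          then have vN: "v \<in> topspace N" using interior_of_subset[of N "?F g"] by blast
          have "\<psi> ?h (\<psi> g v) = v" by (rule N.orbit_sym_aux[OF g vN]) simp
          moreover have "\<psi> g v \<in> topspace N" using N.element_image[OF g vN] by simp
          ultimately show ?thesis using v by (intro ex_in_conv[THEN iffD1] exI[of _ "\<psi> g v"]) simp
        qed
        ultimately show False using F(2) interior_of_maximal[OF JF] by blast
      qed
    qed
    then have emp: "N interior_of (\<Union>(?F ` I)) = {}"
      using I by (intro finite_union_empty_interior) auto
    have "topspace N \<subseteq> \<Union>(?F ` I)"
    proof
      fix u assume "u \<in> topspace N"
      then obtain y where y: "y \<in> topspace M" "u = \<pi> y" using s\<pi> by blast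
      then obtain g where g: "g \<in> I" "\<phi> g y \<in> Oo" using I(3) by blast
      then have "\<pi> (\<phi> g y) \<in> F" using oO(2) by blast
      then have "\<psi> g u \<in> F" using eq[of g y] y I(2) g(1) by auto
      then show "u \<in> \<Union>(?F ` I)" using g(1) \<open>u \<in> topspace N\<close> by blast
    qed
    then have "topspace N \<subseteq> N interior_of (\<Union>(?F ` I))" by (intro interior_of_maximal) auto
    then show False using emp N by (auto simp: minimal_flow_def)
  qed
  moreover have "M closure_of {y \<in> topspace M. \<pi> y \<in> A} \<subseteq> {y \<in> topspace M. \<pi> y \<in> F}"
    using AF by (intro closure_of_minimal clF) auto
  ultimately show ?thesis
    unfolding nowhere_dense_in_def Oo_def using interior_of_mono by blast
qed

lemma meager_in_subset:
  assumes "meager_in X A" "B \<subseteq> A"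
  shows "meager_in X B"
proof -
  obtain \<N> where N: "countable \<N>" "\<And>N. N \<in> \<N> \<Longrightarrow> nowhere_dense_in X N" "A = \<Union>\<N>"
    using assms(1) by (auto simp: meager_in_def)
  then have "B = \<Union>((\<inter>) B ` \<N>)" using assms(2) by blast
  moreover have "\<forall>N\<in>(\<inter>) B ` \<N>. nowhere_dense_in X N" using N(2) nowhere_dense_in_subset by blast
  ultimately show ?thesis unfolding meager_in_def using N(1) by (intro exI[of _ "(\<inter>) B ` \<N>"]) auto
qed

lemma meager_factor_preimage:
  assumes M: "minimal_flow G T M \<phi>" and N: "minimal_flow G T N \<psi>" and T: "topspace T = carrier G"
    and \<pi>: "factor_map G M \<phi> N \<psi> \<pi>" and A: "meager_in N A"
  shows "meager_in M {y \<in> topspace M. \<pi> y \<in> A}"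
proof -
  obtain \<N> where N': "countable \<N>" "\<And>N'. N' \<in> \<N> \<Longrightarrow> nowhere_dense_in N N'" "A = \<Union>\<N>"
    using A by (auto simp: meager_in_def)
  let ?P = "\<lambda>B. {y \<in> topspace M. \<pi> y \<in> B}"
  have "\<forall>B\<in>?P ` \<N>. nowhere_dense_in M B"
    using nowhere_dense_factor_preimage[OF M N T \<pi> N'(2)] by blast
  moreover have "?P A = \<Union>(?P ` \<N>)" using N'(3) by blast
  ultimately show ?thesis unfolding meager_in_def using N'(1) by (intro exI[of _ "?P ` \<N>"]) auto
qed

section \<open>Manifolds and the Hilbert cube\<close>

text \<open>A local counterpart of \<open>nonseparating\<close>: it speaks of small neighbourhoods
  only, so it can be checked inside a chart.\<close>

definition thin :: "'a topology \<Rightarrow> 'a set \<Rightarrow> bool" where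
  "thin X S \<longleftrightarrow> closedin X S \<and> (\<forall>z\<in>S. \<forall>V. openin X V \<and> z \<in> V \<longrightarrow>
     (\<exists>N. openin X N \<and> z \<in> N \<and> N \<subseteq> V \<and> connectedin X (N - S) \<and> N - S \<noteq> {}))"

text \<open>If \<open>U - S\<close> split, the closures of its halves would cover \<open>U\<close>,
  as \<open>S\<close> has empty interior. They would be disjoint in \<open>U\<close> too: around a
  common point, which must lie in \<open>S\<close>, a small \<open>N\<close> with
  \<open>N - S\<close> connected would meet both halves. This would split \<open>U\<close>.\<close>

lemma thin_nonseparating:
  assumes "thin X S"
  shows "nonseparating X S"
  unfolding nonseparating_def
proof (intro conjI allI impI)
  show S: "closedin X S" using assms by (simp add: thin_def)
  have loc: "\<exists>N. openin X N \<and> z \<in> N \<and> N \<subseteq> V \<and> connectedin X (N - S) \<and> N - S \<noteq> {}"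
    if "z \<in> S" "openin X V" "z \<in> V" for z V
    using assms that unfolding thin_def by blast
  fix U assume U: "openin X U \<and> connectedin X U \<and> U \<noteq> {}"
  show "U - S \<noteq> {}"
  proof (cases "U \<inter> S = {}")
    case False
    then obtain z where "z \<in> S" "z \<in> U" by blast
    then obtain N where "N \<subseteq> U" "N - S \<noteq> {}" using loc U by meson
    then show ?thesis by blast
  qed (use U in blast)
  show "connectedin X (U - S)"
  proof (rule ccontr)
    assume "\<not> connectedin X (U - S)"
    moreover have UX: "U \<subseteq> topspace X" using U openin_subset[of X U] by blast
    ultimately obtain E1 E2 where E: "openin X E1" "openin X E2" "U - S \<subseteq> E1 \<union> E2" "E1 \<inter> E2 \<inter> (U - S) = {}"
      "E1 \<inter> (U - S) \<noteq> {}" "E2 \<inter> (U - S) \<noteq> {}"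
      unfolding connectedin by blast
    have oUS: "openin X (U - S)" using U S by blast
    define F1 where "F1 = X closure_of (E1 \<inter> (U - S))"
    define F2 where "F2 = X closure_of (E2 \<inter> (U - S))"
    have sub: "E1 \<inter> (U - S) \<subseteq> F1" "E2 \<inter> (U - S) \<subseteq> F2"
      unfolding F1_def F2_def using UX by (auto intro!: closure_of_subset)
    have cov: "U \<subseteq> F1 \<union> F2"
    proof
      fix z assume z: "z \<in> U"
      show "z \<in> F1 \<union> F2"
      proof (cases "z \<in> S")
        case True
        have "F1 \<union> F2 = X closure_of (U - S)"
          unfolding F1_def F2_def closure_of_Un[symmetric] using E(3) by (intro arg_cong[where f = "\<lambda>A. X closure_of A"]) blast
        moreover have "z \<in> X closure_of (U - S)"
          unfolding in_closure_of
        proof (intro conjI allI impI)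
          show "z \<in> topspace X" using z UX by blast
          fix T assume T: "z \<in> T \<and> openin X T"
          then have "openin X (T \<inter> U)" "z \<in> T \<inter> U" using U z by auto
          then obtain N where "N \<subseteq> T \<inter> U" "N - S \<noteq> {}" using loc[OF True] by meson
          then show "\<exists>y. y \<in> U - S \<and> y \<in> T" by blast
        qed
        ultimately show ?thesis by simp
      next
        case False
        then show ?thesis using z E(3) sub by blast
      qed
    qed
    have "F1 \<inter> F2 \<inter> U = {}"
    proof (rule ccontr)
      assume "F1 \<inter> F2 \<inter> U \<noteq> {}"
      then obtain z where z: "z \<in> F1" "z \<in> F2" "z \<in> U" by blast
      have "z \<in> S"
      proof (rule ccontr)
        assume "z \<notin> S"
        have meet: "\<exists>y. y \<in> E1 \<inter> (U - S) \<and> y \<in> T" "\<exists>y. y \<in> E2 \<inter> (U - S) \<and> y \<in> T" if "z \<in> T" "openin X T" for T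
          using z(1,2) that unfolding F1_def F2_def in_closure_of by blast+
        have o12: "openin X (E1 \<inter> (U - S))" "openin X (E2 \<inter> (U - S))" using E oUS by auto
        consider "z \<in> E1 \<inter> (U - S)" | "z \<in> E2 \<inter> (U - S)" using E(3) \<open>z \<notin> S\<close> z(3) by blast
        then show False
          using meet(2)[OF _ o12(1)] meet(1)[OF _ o12(2)] E(4) by cases blast+
      qed
      then obtain N where N: "openin X N" "z \<in> N" "N \<subseteq> U" "connectedin X (N - S)"
        using loc[of z U] U z(3) by blast
      have "E1 \<inter> (N - S) \<noteq> {}" "E2 \<inter> (N - S) \<noteq> {}"
        using z(1,2) N(1,2) unfolding F1_def F2_def in_closure_of by blast+
      then show False
        using connectedinD[OF N(4) E(1,2)] E(3,4) N(3) by blast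
    qed
    moreover have "F1 \<inter> U \<noteq> {}" "F2 \<inter> U \<noteq> {}" using sub E(5,6) by blast+
    ultimately show False
      using U cov unfolding connectedin_closedin F1_def F2_def by (meson closedin_closure_of)
  qed
qed

section \<open>Segments in products of intervals\<close>

definition segment :: "(nat \<Rightarrow> real) \<Rightarrow> (nat \<Rightarrow> real) \<Rightarrow> (nat \<Rightarrow> real) set" where
  "segment p q = (\<lambda>t i. (1 - t) * p i + t * q i) ` {0..1}"

lemma segment_ends: "p \<in> segment p q" "q \<in> segment p q"
  unfolding segment_def by (rule image_eqI[of _ _ 0], simp, simp) (rule image_eqI[of _ _ 1], simp, simp)

definition proj3 :: "(nat \<Rightarrow> real) \<Rightarrow> real \<times> real \<times> real" where
  "proj3 x = (x 0, x 1, x 2)"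

text \<open>Two models in one: Euclidean space as a product of lines and one-point factors, and the
  Hilbert cube as a product of unit intervals. The condition \<open>fat\<close> gives room in three
  coordinates, also near the ends of an interval.\<close>

locale interval_product =
  fixes C :: "nat \<Rightarrow> real set"
  assumes convex: "\<And>i. convex (C i)" and fat: "\<And>i. i < 3 \<Longrightarrow> C i \<subseteq> closure (interior (C i))"
begin

definition cube_space :: "(nat \<Rightarrow> real) topology" where
  "cube_space = product_topology (\<lambda>i. top_of_set (C i)) UNIV"

lemma topspace_cube_space: "topspace cube_space = {x. \<forall>i. x i \<in> C i}"
  by (auto simp: cube_space_def)

definition interval_box :: "(nat \<Rightarrow> real) set \<Rightarrow> bool" where
  "interval_box N \<longleftrightarrow> openin cube_space N \<and> (\<exists>B. N = {x. \<forall>i. x i \<in> B i} \<and> (\<forall>i. convex (B i) \<and> B i \<subseteq> C i) \<and>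
     (\<forall>i<3. interior (B i) \<noteq> {}))"

lemma Hausdorff_space: "Hausdorff_space cube_space"
  unfolding cube_space_def Hausdorff_space_product_topology by (simp add: Hausdorff_space_subtopology)

lemma box_exists:
  assumes V: "openin cube_space V" "x \<in> V"
  obtains N where "interval_box N" "x \<in> N" "N \<subseteq> V"
proof -
  obtain U where U: "finite {i. U i \<noteq> C i}" "\<And>i. openin (top_of_set (C i)) (U i)" "\<And>i. x i \<in> U i" "{x. \<forall>i. x i \<in> U i} \<subseteq> V"
    using V unfolding cube_space_def openin_product_topology_alt by (auto simp: PiE_UNIV_domain Pi_def) 
  have "\<exists>e>0. C i \<inter> ball (x i) e \<subseteq> U i" for i
    using U(2)[of i] U(3)[of i] unfolding openin_contains_ball by (metis inf_commute)
  then obtain e where e: "\<And>i. e i > 0 \<and> C i \<inter> ball (x i) (e i) \<subseteq> U i" by metis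
  have xC: "x i \<in> C i" for i using U(2)[of i] U(3)[of i] openin_imp_subset by blast
  define B where "B i = (if U i = C i then C i else C i \<inter> ball (x i) (e i))" for i
  have BU: "B i \<subseteq> U i" "B i \<subseteq> C i" "x i \<in> B i" "convex (B i)" for i
    using e[of i] xC[of i] convex[of i] by (auto simp: B_def convex_Int)
  let ?N = "{x. \<forall>i. x i \<in> B i}"
  have "openin cube_space (Pi\<^sub>E UNIV B)"
    unfolding cube_space_def
  proof (rule product_topology_basis)
    show "finite {i. B i \<noteq> topspace (top_of_set (C i))}"
      by (rule finite_subset[OF _ U(1)]) (auto simp: B_def)
    show "openin (top_of_set (C i)) (B i)" for i
      by (auto simp: B_def openin_open_Int)
  qed
  then have "openin cube_space ?N" by (simp add: PiE_UNIV_domain Pi_def)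
  moreover have "interior (B i) \<noteq> {}" if "i < 3" for i
  proof -
    \<comment> \<open>\<open>x i\<close> may be an end point of \<open>C i\<close>, but interior
      points of \<open>C i\<close> lie arbitrarily close to it.\<close>
    have "x i \<in> closure (interior (C i))" using fat[OF that] xC by blast
    then obtain y where y: "y \<in> interior (C i)" "dist y (x i) < e i"
      using e[of i] unfolding closure_approachable by blast
    have "interior (C i) \<inter> ball (x i) (e i) \<subseteq> interior (B i)"
      using interior_subset[of "C i"] by (intro interior_maximal) (auto simp: B_def)
    then show ?thesis using y by (auto simp: dist_commute)
  qed
  ultimately have "interval_box ?N" unfolding interval_box_def using BU(2,4) by (intro conjI exI[of _ B]) auto
  then show thesis using that BU U(4) by blast
qed

lemma segment_subset_box:
  assumes "interval_box N" "p \<in> N" "q \<in> N"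
  shows "segment p q \<subseteq> N"
proof -
  obtain B where B: "N = {x. \<forall>i. x i \<in> B i}" "\<And>i. convex (B i)"
    using assms(1) by (auto simp: interval_box_def)
  have "(1 - t) * p i + t * q i \<in> B i" if "t \<in> {0..1}" for t i
    using convexD_alt[OF B(2)[of i], of "p i" "q i" t] assms(2,3) that by (auto simp: B(1))
  then show ?thesis by (auto simp: segment_def B(1))
qed

lemma segment_continuum:
  assumes p: "p \<in> topspace cube_space" and q: "q \<in> topspace cube_space"
  shows "compactin cube_space (segment p q)" "connectedin cube_space (segment p q)"
proof -
  have "continuous_map (top_of_set {0..1}) (top_of_set (C k)) (\<lambda>t. (1 - t) * p k + t * q k)" for k
  proof (rule continuous_map_into_subtopology)
    show "continuous_map (top_of_set {0..1}) euclidean (\<lambda>t. (1 - t) * p k + t * q k)"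
      by (simp, intro continuous_intros)
    show "(\<lambda>t. (1 - t) * p k + t * q k) \<in> topspace (top_of_set {0..1}) \<rightarrow> C k"
      using convexD_alt[OF convex[of k], of "p k" "q k"] p q by (auto simp: topspace_cube_space)
  qed
  then have c: "continuous_map (top_of_set {0..1}) cube_space (\<lambda>t i. (1 - t) * p i + t * q i)"
    unfolding cube_space_def continuous_map_componentwise_UNIV by simp
  have "compactin (top_of_set {0..1::real}) {0..1}" "connectedin (top_of_set {0..1::real}) {0..1}"
    by (simp_all add: compactin_subtopology connectedin_subtopology)
  then show "compactin cube_space (segment p q)" "connectedin cube_space (segment p q)"
    unfolding segment_def using image_compactin[OF _ c] connectedin_continuous_map_image[OF c] by blast+
qed

lemma proj3_segment: "proj3 (\<lambda>i. (1 - t) * p i + t * q i) = (1 - t) *\<^sub>R proj3 p + t *\<^sub>R proj3 q"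
  by (simp add: proj3_def)

text \<open>A point \<open>z\<close> whose projection avoids the planes spanned by the segment and \<open>u\<close>, resp. \<open>v\<close>, is
  joined to both by segments avoiding the given one. This needs three free coordinates.\<close>

lemma detour:
  assumes N: "interval_box N" and u: "u \<in> N" and v: "v \<in> N"
  shows "\<exists>z\<in>N. z \<notin> segment p q \<and> (u \<notin> segment p q \<longrightarrow> segment u z \<inter> segment p q = {}) \<and>
    (v \<notin> segment p q \<longrightarrow> segment v z \<inter> segment p q = {})"
proof -
  obtain B where B: "N = {x. \<forall>i. x i \<in> B i}" "\<And>i. convex (B i)" "\<And>i. i < 3 \<Longrightarrow> interior (B i) \<noteq> {}"
    using N unfolding interval_box_def by blast
  \<comment> \<open>Three points span an affine subspace of dimension at most 2, which has empty
    interior in three-space.\<close>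
  let ?H = "\<lambda>w. affine hull {proj3 w, proj3 p, proj3 q}"
  have int: "interior (?H w) = {}" for w
    by (rule empty_interior_affine_hull) (simp_all add: card_insert_if)
  have "interior (?H u \<union> ?H v) = {}"
    using interior_closed_Un_empty_interior[OF closed_affine_hull int] int by simp
  moreover have "open (interior (B 0) \<times> interior (B 1) \<times> interior (B 2))"
    by (intro open_Times open_interior)
  moreover have "interior (B 0) \<times> interior (B 1) \<times> interior (B 2) \<noteq> {}" using B(3) by simp
  ultimately have "\<not> interior (B 0) \<times> interior (B 1) \<times> interior (B 2) \<subseteq> ?H u \<union> ?H v"
    using interior_maximal by blast
  then obtain a b c where abc: "a \<in> interior (B 0)" "b \<in> interior (B 1)" "c \<in> interior (B 2)"
    "(a, b, c) \<notin> ?H u" "(a, b, c) \<notin> ?H v"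
    by auto
  define z where "z = u(0 := a, 1 := b, 2 := c)"
  have pz: "proj3 z = (a, b, c)" by (simp add: z_def proj3_def)
  have "z i \<in> B i" for i
    using u abc(1-3) interior_subset[of "B i"] by (auto simp: z_def B(1))
  then have zN: "z \<in> N" by (simp add: B(1))
  have avoid: "segment w z \<inter> segment p q = {}" if w: "w \<notin> segment p q" "(a, b, c) \<notin> ?H w" for w
  proof (rule ccontr)
    assume "segment w z \<inter> segment p q \<noteq> {}"
    then obtain y where y: "y \<in> segment w z" "y \<in> segment p q" by blast
    obtain t where t: "y = (\<lambda>i. (1 - t) * w i + t * z i)" using y(1) unfolding segment_def by blast
    obtain s where s: "y = (\<lambda>i. (1 - s) * p i + s * q i)" using y(2) unfolding segment_def by blast
    \<comment> \<open>Since \<open>w\<close> is off the segment, the meeting point has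
      \<open>t \<noteq> 0\<close>; the equation can be solved for the projection of \<open>z\<close>
      as an affine combination of the points spanning \<open>?H w\<close>.\<close>
    have "t \<noteq> 0" using t y(2) w(1) by auto
    have "(1 - t) *\<^sub>R proj3 w + t *\<^sub>R proj3 z = (1 - s) *\<^sub>R proj3 p + s *\<^sub>R proj3 q"
      using proj3_segment[of t w z] proj3_segment[of s p q] t s by metis
    then have "t *\<^sub>R proj3 z = (- (1 - t)) *\<^sub>R proj3 w + (1 - s) *\<^sub>R proj3 p + s *\<^sub>R proj3 q"
      by (simp add: algebra_simps)
    then have "(1 / t) *\<^sub>R (t *\<^sub>R proj3 z) = (1 / t) *\<^sub>R ((- (1 - t)) *\<^sub>R proj3 w + (1 - s) *\<^sub>R proj3 p + s *\<^sub>R proj3 q)"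
      by simp
    then have "proj3 z = (- (1 - t) / t) *\<^sub>R proj3 w + ((1 - s) / t) *\<^sub>R proj3 p + (s / t) *\<^sub>R proj3 q"
      using \<open>t \<noteq> 0\<close> by (simp add: scaleR_add_right)
    moreover have "- (1 - t) / t + (1 - s) / t + s / t = 1" using \<open>t \<noteq> 0\<close> by (simp add: field_simps)
    ultimately have "proj3 z \<in> ?H w" unfolding affine_hull_3 by blast
    then show False using w(2) pz by simp
  qed
  have "z \<notin> segment p q"
  proof
    assume "z \<in> segment p q"
    then obtain s where "z = (\<lambda>i. (1 - s) * p i + s * q i)" by (auto simp: segment_def)
    then have "proj3 z = 0 *\<^sub>R proj3 u + (1 - s) *\<^sub>R proj3 p + s *\<^sub>R proj3 q" using proj3_segment[of s p q] by simp
    then have "proj3 z \<in> ?H u" unfolding affine_hull_3 by (smt (verit) mem_Collect_eq)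
    then show False using abc(4) pz by simp
  qed
  then show ?thesis using zN avoid abc(4,5) by blast
qed

text \<open>Each point off the segment is joined to one fixed point \<open>w\<close> by two segments
  through a detour point, so the complement is a union of connected sets through
  \<open>w\<close>.\<close>

lemma box_diff_segment:
  assumes N: "interval_box N" "N \<noteq> {}"
  shows "connectedin cube_space (N - segment p q)" "N - segment p q \<noteq> {}"
proof -
  have oN: "openin cube_space N" using N by (simp add: interval_box_def)
  obtain u where u: "u \<in> N" using N by blast
  show "N - segment p q \<noteq> {}" using detour[OF N(1) u u, of p q] by blast
  then obtain w where w: "w \<in> N" "w \<notin> segment p q" by blast
  let ?\<T> = "{T. connectedin cube_space T \<and> w \<in> T \<and> T \<subseteq> N - segment p q}"
  have "N - segment p q \<subseteq> \<Union>?\<T>"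
  proof
    fix v assume v: "v \<in> N - segment p q"
    then have vN: "v \<in> N" by blast
    obtain z where z: "z \<in> N" "segment w z \<inter> segment p q = {}" "segment v z \<inter> segment p q = {}"
      using detour[OF N(1) w(1) vN, of p q] w(2) v by auto
    let ?T = "segment w z \<union> segment v z"
    have top: "w \<in> topspace cube_space" "v \<in> topspace cube_space" "z \<in> topspace cube_space"
      using openin_subset[OF oN] w v z by blast+
    have "connectedin cube_space ?T"
      using segment_continuum(2)[OF top(1,3)] segment_continuum(2)[OF top(2,3)] segment_ends(2)[of z w] segment_ends(2)[of z v]
      by (intro connectedin_Un) auto
    moreover have "?T \<subseteq> N - segment p q"
      using segment_subset_box[OF N(1) w(1) z(1)] segment_subset_box[OF N(1) _ z(1), of v] v z(2,3) by blast
    ultimately show "v \<in> \<Union>?\<T>" using segment_ends(1) by blast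
  qed
  then have "\<Union>?\<T> = N - segment p q" by blast
  moreover have "connectedin cube_space (\<Union>?\<T>)"
  proof (rule connectedin_Union)
    show "\<Inter>?\<T> \<noteq> {}" by blast
  qed blast
  ultimately show "connectedin cube_space (N - segment p q)" by simp
qed

text \<open>The inverse \<open>k\<close> of the chart maps segments to continua and boxes to open
  sets. Removing the segment leaves small boxes around its points connected, so its image is thin;
  the image of a box around \<open>h x\<close> serves as \<open>N\<close>.\<close>

lemma nonseparating_base_chart:
  assumes H: "Hausdorff_space X" and U: "openin X U" and chart: "subtopology X U homeomorphic_space cube_space"
    and V: "openin X V" "x \<in> V" "x \<in> U"
  shows "\<exists>N. openin X N \<and> x \<in> N \<and> N \<subseteq> V \<and>
      (\<forall>p\<in>N. \<forall>q\<in>N. \<exists>S. nonseparating X S \<and> connectedin X S \<and> p \<in> S \<and> q \<in> S \<and> S \<subseteq> N)"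
proof -
  obtain h k where hk: "homeomorphic_maps (subtopology X U) cube_space h k"
    using chart by (auto simp: homeomorphic_space_def)
  have topU: "topspace (subtopology X U) = U" using openin_subset[OF U] by auto
  have kh: "k (h y) = y" "h y \<in> topspace cube_space" if "y \<in> U" for y
    using hk that topU by (auto simp: homeomorphic_maps_def continuous_map_def)
  have hk': "h (k y) = y" if "y \<in> topspace cube_space" for y using hk that by (auto simp: homeomorphic_maps_def)
  have "continuous_map cube_space (subtopology X U) k" using hk by (simp add: homeomorphic_maps_def)
  then have kc: "continuous_map cube_space X k" by (simp add: continuous_map_in_subtopology)
  have "homeomorphic_map cube_space (subtopology X U) k"
    using hk homeomorphic_maps_map homeomorphic_maps_sym by blast
  then have kopen: "openin X (k ` T)" if "openin cube_space T" for T
    using that U homeomorphic_imp_open_map openin_trans_full unfolding open_map_def by blast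
  have small: "\<exists>N. interval_box N \<and> y \<in> N \<and> k ` N \<subseteq> O'" if y: "openin X O'" "y \<in> topspace cube_space" "k y \<in> O'" for O' y
  proof -
    have "openin cube_space {z \<in> topspace cube_space. k z \<in> O'}" by (rule openin_continuous_map_preimage[OF kc y(1)])
    then obtain N where "interval_box N" "y \<in> N" "N \<subseteq> {z \<in> topspace cube_space. k z \<in> O'}"
      using box_exists y(2,3) by (metis (mono_tags, lifting) mem_Collect_eq)
    then show ?thesis by blast
  qed
  obtain N where N: "interval_box N" "h x \<in> N" "k ` N \<subseteq> V" using small[OF V(1)] kh[OF V(3)] V(2) by metis
  have oN: "openin cube_space N" using N(1) by (simp add: interval_box_def)
  have NT: "N \<subseteq> topspace cube_space" by (rule openin_subset[OF oN])
  have "\<exists>S. nonseparating X S \<and> connectedin X S \<and> k a \<in> S \<and> k b \<in> S \<and> S \<subseteq> k ` N"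
    if ab: "a \<in> N" "b \<in> N" for a b
  proof -
    let ?s = "segment a b" and ?S = "k ` segment a b"
    have s: "compactin cube_space ?s" "connectedin cube_space ?s" using segment_continuum ab NT by blast+
    have sT: "?s \<subseteq> topspace cube_space" using s(1) compactin_subset_topspace by blast
    have "closedin X ?S" using image_compactin[OF s(1) kc] H compactin_imp_closedin by blast
    moreover have "\<exists>M. openin X M \<and> z \<in> M \<and> M \<subseteq> O' \<and> connectedin X (M - ?S) \<and> M - ?S \<noteq> {}"
      if z: "z \<in> ?S" "openin X O'" "z \<in> O'" for z O'
    proof -
      obtain y where y: "y \<in> ?s" "z = k y" using z(1) by blast
      obtain M where M: "interval_box M" "y \<in> M" "k ` M \<subseteq> O'" using small[OF z(2)] y z(3) sT by blast
      have oM: "openin cube_space M" using M(1) by (simp add: interval_box_def)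
      have MT: "M \<subseteq> topspace cube_space" by (rule openin_subset[OF oM])
      have eq: "k ` M - ?S = k ` (M - ?s)"
      proof -
        have "inj_on k (topspace cube_space)" using hk' by (metis inj_onI)
        then show ?thesis using MT sT by (metis inj_on_image_set_diff Diff_subset subset_trans inj_on_subset sup.bounded_iff image_set_diff)
      qed
      have "connectedin cube_space (M - ?s)" "M - ?s \<noteq> {}" using box_diff_segment[OF M(1)] M(2) by blast+
      then have "connectedin X (k ` M - ?S)" "k ` M - ?S \<noteq> {}"
        unfolding eq using connectedin_continuous_map_image[OF kc] by blast+
      then show ?thesis using kopen[OF oM] M(2,3) y(2) by blast
    qed
    ultimately have "thin X ?S" unfolding thin_def by blast
    then show ?thesis
      using thin_nonseparating connectedin_continuous_map_image[OF kc s(2)] segment_ends segment_subset_box[OF N(1) ab] by blast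
  qed
  then show ?thesis using kopen[OF oN] N(2,3) kh(1)[OF V(3)] by (intro exI[of _ "k ` N"]) (auto intro: rev_image_eqI)
qed

end

section \<open>Closed manifolds and the Hilbert cube are tame\<close>

lemma Euclidean_space_product:
  "Euclidean_space n = product_topology (\<lambda>i. top_of_set (if i < n then UNIV else {0})) UNIV"
proof -
  have "{x :: nat \<Rightarrow> real. \<forall>i\<ge>n. x i = 0} = (\<Pi>\<^sub>E i\<in>UNIV. if i < n then UNIV else {0})"
    by (auto simp: PiE_UNIV_domain Pi_def split: if_splits)
  then show ?thesis by (simp add: Euclidean_space_def subtopology_product_topology)
qed

lemma interval_product_Euclidean: "3 \<le> n \<Longrightarrow> interval_product (\<lambda>i. if i < n then UNIV else {0})"
  by unfold_locales auto

lemma interval_product_cube: "interval_product (\<lambda>_. {0..1})"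
  by unfold_locales (auto simp: interior_atLeastAtMost_real)

lemma closed_manifold_tame:
  assumes X: "closed_manifold n X" and n: "3 \<le> n"
  shows "tame_space X"
proof -
  interpret interval_product "\<lambda>i. if i < n then UNIV else {0}" by (rule interval_product_Euclidean[OF n])
  show ?thesis
  proof
    fix V x assume V: "openin X V" "x \<in> V"
    have "x \<in> topspace X" using V openin_subset[OF V(1)] by blast
    then obtain U where U: "openin X U" "x \<in> U" "subtopology X U homeomorphic_space Euclidean_space n"
      using X unfolding closed_manifold_def by blast
    have "subtopology X U homeomorphic_space cube_space" using U(3) by (simp add: cube_space_def Euclidean_space_product)
    then show "\<exists>N. openin X N \<and> x \<in> N \<and> N \<subseteq> V \<and>
      (\<forall>p\<in>N. \<forall>q\<in>N. \<exists>S. nonseparating X S \<and> connectedin X S \<and> p \<in> S \<and> q \<in> S \<and> S \<subseteq> N)"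
      using nonseparating_base_chart[OF _ U(1) _ V U(2)] X by (simp add: closed_manifold_def)
  qed (use X in \<open>auto simp: closed_manifold_def\<close>)
qed

lemma hilbert_cube_tame:
  assumes X: "X homeomorphic_space hilbert_cube"
  shows "tame_space X" "second_countable X"
proof -
  interpret interval_product "\<lambda>_. {0..1}" by (rule interval_product_cube)
  have sp: "cube_space = hilbert_cube" by (simp add: cube_space_def hilbert_cube_def)
  have H: "Hausdorff_space X" using X Hausdorff_space homeomorphic_Hausdorff_space unfolding sp by blast
  have "compact_space hilbert_cube" "connected_space hilbert_cube"
    unfolding hilbert_cube_def
    by (auto simp: compact_space_product_topology connected_space_product_topology compact_space_subtopology connected_space_subtopology)
  then have cc: "compact_space X" "connected_space X"
    using X homeomorphic_compact_space homeomorphic_connected_space by blast+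
  have "(\<lambda>_. 0) \<in> topspace hilbert_cube" by (simp add: hilbert_cube_def PiE_UNIV_domain)
  then have ne: "topspace X \<noteq> {}"
    using X unfolding homeomorphic_space_def homeomorphic_maps_def continuous_map_def by blast
  show "tame_space X"
  proof
    fix V x assume V: "openin X V" "x \<in> V"
    have x: "x \<in> topspace X" using V openin_subset[OF V(1)] by blast
    have "subtopology X (topspace X) homeomorphic_space cube_space" using X sp by simp
    then show "\<exists>N. openin X N \<and> x \<in> N \<and> N \<subseteq> V \<and>
      (\<forall>p\<in>N. \<forall>q\<in>N. \<exists>S. nonseparating X S \<and> connectedin X S \<and> p \<in> S \<and> q \<in> S \<and> S \<subseteq> N)"
      by (rule nonseparating_base_chart[OF H openin_topspace _ V x])
  qed (use H cc ne in auto)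
  have "second_countable (euclidean :: (nat \<Rightarrow> real) topology)"
  proof -
    obtain \<B> :: "(nat \<Rightarrow> real) set set" where "countable \<B>" "topological_basis \<B>"
      using ex_countable_basis by blast
    then show ?thesis
      unfolding second_countable_def
      by (metis open_openin topological_basis_def topological_basisE)
  qed
  moreover have "hilbert_cube = subtopology euclidean (\<Pi>\<^sub>E i\<in>UNIV. {0..1})"
    unfolding hilbert_cube_def euclidean_product_topology[symmetric] subtopology_product_topology ..
  ultimately have "second_countable hilbert_cube" using second_countable_subtopology by metis
  then show "second_countable X" using X homeomorphic_space_second_countability by blast
qed

theorem theorem1p2:
  fixes X :: "'a topology"
  assumes "(\<exists>n\<ge>3. closed_manifold n X) \<or> X homeomorphic_space hilbert_cube"
  shows "has_meager_orbits (homeo_group X) (connected_chains X) (chain_action X) \<and>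
    (\<forall>G (M :: 'b topology) \<phi>.
       subgroup G (homeo_group X) \<longrightarrow>
       locally_transitive X G \<longrightarrow>
       universal_minimal_flow (homeo_group X \<lparr>carrier := G\<rparr>) (subtopology (homeo_topology X) G) M \<phi> \<longrightarrow>
       has_meager_orbits (homeo_group X \<lparr>carrier := G\<rparr>) M \<phi>)"
proof -
  have sc: "second_countable X"
    using assms hilbert_cube_tame(2) by (auto simp: closed_manifold_def)
  have "tame_space X"
    using assms closed_manifold_tame hilbert_cube_tame(1) by blast
  then interpret tame_space X .
  have meager: "meager_in (connected_chains X) (orbit (homeo_group X) (chain_action X) c)"
    if "c \<in> topspace (connected_chains X)" for c
    by (rule homeo_orbit_meager[OF sc that])
  have "has_meager_orbits (homeo_group X \<lparr>carrier := G\<rparr>) M \<phi>"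
    if G: "subgroup G (homeo_group X)" and lt: "locally_transitive X G"
      and M: "universal_minimal_flow (homeo_group X \<lparr>carrier := G\<rparr>) (subtopology (homeo_topology X) G) M \<phi>"
    for G and M :: "'b topology" and \<phi>
    unfolding has_meager_orbits_def
  proof
    let ?G = "homeo_group X \<lparr>carrier := G\<rparr>" and ?T = "subtopology (homeo_topology X) G"
    have GH: "G \<subseteq> carrier (homeo_group X)" using G by (rule subgroup.subset)
    have C: "minimal_flow ?G ?T (connected_chains X) (chain_action X)"
      by (rule minimal_flow_connected_chains[OF G lt])
    obtain \<pi> where \<pi>: "factor_map ?G M \<phi> (connected_chains X) (chain_action X) \<pi>"
      using universal_minimal_flow_factor[OF M C] by blast
    have minM: "minimal_flow ?G ?T M \<phi>" using M by (simp add: universal_minimal_flow_def)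
    then interpret group_action ?G "topspace M" \<phi> by (simp add: minimal_flow_def flow_def)
    have T: "topspace ?T = carrier ?G" using GH by (auto simp: topspace_homeo_topology)
    fix y assume y: "y \<in> topspace M"
    have \<pi>y: "\<pi> y \<in> topspace (connected_chains X)" using \<pi> y by (auto simp: factor_map_def)
    \<comment> \<open>By equivariance the orbit of \<open>y\<close> under \<open>G\<close> lies over
      an orbit of the full homeomorphism group, whose meagerness is already known.\<close>
    have "orbit ?G \<phi> y \<subseteq> {z \<in> topspace M. \<pi> z \<in> orbit (homeo_group X) (chain_action X) (\<pi> y)}"
    proof
      fix z assume "z \<in> orbit ?G \<phi> y"
      then obtain g where g: "g \<in> G" "z = \<phi> g y" by (auto simp: orbit_def)
      then have "\<pi> z = chain_action X g (\<pi> y)" using \<pi> y by (simp add: factor_map_def)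
      moreover have "z \<in> topspace M" using element_image[of g y z] g y by simp
      ultimately show "z \<in> {z \<in> topspace M. \<pi> z \<in> orbit (homeo_group X) (chain_action X) (\<pi> y)}"
        using g(1) GH by (auto simp: orbit_def)
    qed
    then show "meager_in M (orbit ?G \<phi> y)"
      by (rule meager_in_subset[OF meager_factor_preimage[OF minM C T \<pi> meager[OF \<pi>y]]])
  qed
  then show ?thesis using meager unfolding has_meager_orbits_def by blast
qed

end
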